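(* Let $n\in\mathbb N_0$ and let $(s_j)_{j=0}^{2n}\in\mathcal H^{\ge}_{q,2n}$. Let $\langle (s_j)_{j=0}^{2n}\rangle$ denote the set of all $(t_j)_{j=0}^{2n}\in\mathcal H^{\ge}_{q,2n}$ with $(t_j)_{j=0}^{2n}\sim(s_j)_{j=0}^{2n}$. Then $\langle (s_j)_{j=0}^{2n}\rangle\cap\mathcal H^{\ge,e}_{q,2n}=\{(\tilde s_j)_{j=0}^{2n}\}$, where $\tilde s_j:=s_j$ for all $j\in\{0,\dots,2n-1\}$ and $\tilde s_{2n}:=\Xi_n$.
   Context: $q$ is a positive integer. For complex $q\times q$ matrices, $A\le B$ means that $A,B$ are Hermitian and $B-A$ is non-negative Hermitian (positive semidefinite). $M^\dagger$ is the Moore–Penrose inverse and $\mathcal R(M)$ the column space of a matrix $M$. For a non-negative Hermitian $q\times q$ matrix $A$ and a linear subspace $\mathcal V$ of $\mathbb C^q$, let $P_{A,\mathcal V}$ be the matrix of the orthogonal projection of $\mathbb C^q$ onto $\{x\in\mathbb C^q:\sqrt A\,x\in\mathcal V\}$ ($\sqrt A$ the non-negative Hermitian square root), and $\mathcal S(A,\mathcal V):=\sqrt A\,P_{A,\mathcal V}\sqrt A$. For a sequence of complex $q\times q$ matrices put $H_n:=(s_{j+k})_{j,k=0}^n$ (block Hankel matrix). $\mathcal H^{\ge}_{q,2n}$ is the set of all sequences $(s_j)_{j=0}^{2n}$ of complex $q\times q$ matrices with $H_n$ non-negative Hermitian. $\mathcal H^{\ge,e}_{q,2n}$ is the set of all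 sequences $(s_j)_{j=0}^{2n}$ of complex $q\times q$ matrices for which there exist complex $q\times q$ matrices $s_{2n+1},s_{2n+2}$ with $(s_j)_{j=0}^{2n+2}\in\mathcal H^{\ge}_{q,2n+2}$. Put $\Theta_0:=0_{q\times q}$ and, for $n\ge1$, $\Theta_n:=z\,H_{n-1}^\dagger\,y$, where $y$ is the block column with blocks $s_n,s_{n+1},\dots,s_{2n-1}$ and $z$ is the block row $[s_n,s_{n+1},\dots,s_{2n-1}]$. Put $L_n:=s_{2n}-\Theta_n$ for $n\ge0$. If $(s_j)_{j=0}^{2n}\in\mathcal H^{\ge}_{q,2n}$, then $L_k$ is non-negative Hermitian for $0\le k\le n$, so one may define $\Xi_0:=s_0$ and $\Xi_n:=\Theta_n+\mathcal S(L_n,\mathcal R(L_{n-1}))$ for $n\ge1$. A non-negative Hermitian $q\times q$ measure on $\mathbb R$ is a $\sigma$-additive map from the Borel sets of $\mathbb R$ to the non-negative Hermitian $q\times q$ matrices. For $(s_j)_{j=0}^{2n}$, let $\mathcal M_\le[(s_j)_{j=0}^{2n}]$ be the set of all such measures $\sigma$ for which the moment $\int_{\mathbb R}x^{2n}\sigma(dx)$ exists (then all moments of lower order exist as well), $s_{2n}-\int_{\mathbb R}x^{2n}\sigma(dx)$ is non-negative Hermitian, and $\int_{\mathbb R}x^j\sigma(dx)=s_j$ for all $j\in\{0,\dots,2n-1\}$. For two sequences in $\mathcal H^{\ge}_{q,2n}$, write $(s_j)_{j=0}^{2n}\sim(t_j)_{j=0}^{2n}$ if $\mathcal M_\le[(s_j)_{j=0}^{2n}]=\mathcal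 M_\le[(t_j)_{j=0}^{2n}]$; this is an equivalence relation on $\mathcal H^{\ge}_{q,2n}$. *)

theory Defs
  imports
    "HOL-Analysis.Set_Integral"
    "HOL-Library.FuncSet"
    "Jordan_Normal_Form.Schur_Decomposition"
    "Jordan_Normal_Form.VS_Connect"
begin

section \<open>Complex matrices\<close>

(* The order on complex numbers is the one of Complex_Order: 0 \<le> z says that z is real and
   non-negative. *)
definition psd_mats :: "nat \<Rightarrow> complex mat set" where
  "psd_mats q = {A \<in> carrier_mat q q. mat_adjoint A = A \<and> (\<forall>x\<in>carrier_vec q. 0 \<le> (A *\<^sub>v x) \<bullet>c x)}"

definition is_pinv :: "complex mat \<Rightarrow> complex mat \<Rightarrow> bool" where
  "is_pinv A X \<longleftrightarrow> X \<in> carrier_mat (dim_col A) (dim_row A) \<and>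
     A * X * A = A \<and> X * A * X = X \<and>
     mat_adjoint (A * X) = A * X \<and> mat_adjoint (X * A) = X * A"

definition pinv :: "complex mat \<Rightarrow> complex mat" where
  "pinv A = (THE X. is_pinv A X)"

definition psd_sqrt :: "nat \<Rightarrow> complex mat \<Rightarrow> complex mat" where
  "psd_sqrt q A = (THE B. B \<in> psd_mats q \<and> B * B = A)"

(* With v \<bullet>c w = \<Sum>i. v_i * cnj w_i, an orthogonal projection of x onto V is the point P x of V
   with x - P x orthogonal to V. *)
definition is_orth_proj :: "nat \<Rightarrow> complex vec set \<Rightarrow> complex mat \<Rightarrow> bool" where
  "is_orth_proj q V P \<longleftrightarrow> P \<in> carrier_mat q q \<and>
     (\<forall>x\<in>carrier_vec q. P *\<^sub>v x \<in> V \<and> (\<forall>y\<in>V. (x - P *\<^sub>v x) \<bullet>c y = 0))"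

definition orth_proj :: "nat \<Rightarrow> complex vec set \<Rightarrow> complex mat" where
  "orth_proj q V = (THE P. is_orth_proj q V P)"

(* The matrix S(A,V) for A in psd_mats q and a linear subspace V of C^q. *)
definition short_mat :: "nat \<Rightarrow> complex mat \<Rightarrow> complex vec set \<Rightarrow> complex mat" where
  "short_mat q A V =
     psd_sqrt q A * orth_proj q {x \<in> carrier_vec q. psd_sqrt q A *\<^sub>v x \<in> V} * psd_sqrt q A"

section \<open>Block Hankel matrices\<close>

(* Row index i = a * q + b with b < q is row b of block row a; likewise for columns. *)
definition block_hankel :: "nat \<Rightarrow> (nat \<Rightarrow> complex mat) \<Rightarrow> nat \<Rightarrow> complex mat" where
  "block_hankel q s n = mat ((n + 1) * q) ((n + 1) * q)
     (\<lambda>(i, j). s (i div q + j div q) $$ (i mod q, j mod q))"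

definition block_column :: "nat \<Rightarrow> (nat \<Rightarrow> complex mat) \<Rightarrow> nat \<Rightarrow> complex mat" where
  "block_column q s n = mat (n * q) q (\<lambda>(i, j). s (n + i div q) $$ (i mod q, j))"

definition block_row :: "nat \<Rightarrow> (nat \<Rightarrow> complex mat) \<Rightarrow> nat \<Rightarrow> complex mat" where
  "block_row q s n = mat q (n * q) (\<lambda>(i, j). s (n + j div q) $$ (i, j mod q))"

(* A finite sequence s_0, ..., s_m is an extensional function on {..m} (undefined beyond m), so
   that equality of functions is equality of finite sequences. The argument n of the two
   definitions below stands for sequences with last index 2n. *)
definition hankel_nonneg :: "nat \<Rightarrow> nat \<Rightarrow> (nat \<Rightarrow> complex mat) set" where
  "hankel_nonneg q n =
     {s \<in> {..2 * n} \<rightarrow>\<^sub>E carrier_mat q q. block_hankel q s n \<in> psd_mats ((n + 1) * q)}"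

definition hankel_nonneg_ext :: "nat \<Rightarrow> nat \<Rightarrow> (nat \<Rightarrow> complex mat) set" where
  "hankel_nonneg_ext q n =
     {s \<in> {..2 * n} \<rightarrow>\<^sub>E carrier_mat q q.
        \<exists>A\<in>carrier_mat q q. \<exists>B\<in>carrier_mat q q.
          s(2 * n + 1 := A, 2 * n + 2 := B) \<in> hankel_nonneg q (n + 1)}"

definition Theta :: "nat \<Rightarrow> (nat \<Rightarrow> complex mat) \<Rightarrow> nat \<Rightarrow> complex mat" where
  "Theta q s n = (if n = 0 then 0\<^sub>m q q
     else block_row q s n * pinv (block_hankel q s (n - 1)) * block_column q s n)"

definition Lmat :: "nat \<Rightarrow> (nat \<Rightarrow> complex mat) \<Rightarrow> nat \<Rightarrow> complex mat" where
  "Lmat q s n = s (2 * n) - Theta q s n"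

definition Xi :: "nat \<Rightarrow> (nat \<Rightarrow> complex mat) \<Rightarrow> nat \<Rightarrow> complex mat" where
  "Xi q s n = (if n = 0 then s 0
     else Theta q s n + short_mat q (Lmat q s n) (vec_space.col_space q (Lmat q s (n - 1))))"

section \<open>Matrix measures on the real line and their moments\<close>

(* Sigma-additivity is convergence of the matrix series, i.e. of each entry. *)
definition psd_measures :: "nat \<Rightarrow> (real set \<Rightarrow> complex mat) set" where
  "psd_measures q = {\<sigma> \<in> sets borel \<rightarrow>\<^sub>E psd_mats q.
     \<forall>A :: nat \<Rightarrow> real set. range A \<subseteq> sets borel \<longrightarrow> disjoint_family A \<longrightarrow>
       (\<forall>i<q. \<forall>j<q. (\<lambda>k. \<sigma> (A k) $$ (i, j)) sums (\<sigma> (\<Union>k. A k) $$ (i, j)))}"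

definition trace_measure :: "nat \<Rightarrow> (real set \<Rightarrow> complex mat) \<Rightarrow> real measure" where
  "trace_measure q \<sigma> =
     measure_of UNIV (sets borel) (\<lambda>A. ennreal (Re (\<Sum>i<q. \<sigma> A $$ (i, i))))"

definition is_trace_density ::
    "nat \<Rightarrow> (real set \<Rightarrow> complex mat) \<Rightarrow> (real \<Rightarrow> complex mat) \<Rightarrow> bool" where
  "is_trace_density q \<sigma> D \<longleftrightarrow> (\<forall>x. D x \<in> carrier_mat q q) \<and>
     (\<forall>i<q. \<forall>j<q. integrable (trace_measure q \<sigma>) (\<lambda>x. D x $$ (i, j)) \<and>
       (\<forall>A\<in>sets borel. \<sigma> A $$ (i, j) = (LINT x:A|trace_measure q \<sigma>. D x $$ (i, j))))"

(* A non-negative Hermitian measure is absolutely continuous with respect to its trace measure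
   \<tau>. As usual for matrix measures, the integral of a scalar f is defined as the integral of
   f (d\<sigma>/d\<tau>) with respect to \<tau>; since d\<sigma>/d\<tau> is unique up to \<tau>-null sets, the choice of the
   density does not matter. *)
definition trace_density :: "nat \<Rightarrow> (real set \<Rightarrow> complex mat) \<Rightarrow> real \<Rightarrow> complex mat" where
  "trace_density q \<sigma> = (SOME D. is_trace_density q \<sigma> D)"

definition psd_integrable :: "nat \<Rightarrow> (real set \<Rightarrow> complex mat) \<Rightarrow> (real \<Rightarrow> real) \<Rightarrow> bool" where
  "psd_integrable q \<sigma> f \<longleftrightarrow>
     (\<forall>i<q. \<forall>j<q. integrable (trace_measure q \<sigma>) (\<lambda>x. f x *\<^sub>R trace_density q \<sigma> x $$ (i, j)))"

definition psd_integral :: "nat \<Rightarrow> (real set \<Rightarrow> complex mat) \<Rightarrow> (real \<Rightarrow> real) \<Rightarrow> complex mat" where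
  "psd_integral q \<sigma> f =
     mat q q (\<lambda>(i, j). LINT x|trace_measure q \<sigma>. f x *\<^sub>R trace_density q \<sigma> x $$ (i, j))"

(* Existence of the moment of order 2n implies that of all lower ones, so the moments of order
   j < 2n are only required to have the right value. *)
definition moment_solutions ::
    "nat \<Rightarrow> nat \<Rightarrow> (nat \<Rightarrow> complex mat) \<Rightarrow> (real set \<Rightarrow> complex mat) set" where
  "moment_solutions q n s = {\<sigma> \<in> psd_measures q.
     psd_integrable q \<sigma> (\<lambda>x. x ^ (2 * n)) \<and>
     s (2 * n) - psd_integral q \<sigma> (\<lambda>x. x ^ (2 * n)) \<in> psd_mats q \<and>
     (\<forall>j<2 * n. psd_integral q \<sigma> (\<lambda>x. x ^ j) = s j)}"

definition moment_equiv ::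
    "nat \<Rightarrow> nat \<Rightarrow> (nat \<Rightarrow> complex mat) \<Rightarrow> (nat \<Rightarrow> complex mat) \<Rightarrow> bool" where
  "moment_equiv q n s t \<longleftrightarrow> moment_solutions q n s = moment_solutions q n t"

definition moment_class :: "nat \<Rightarrow> nat \<Rightarrow> (nat \<Rightarrow> complex mat) \<Rightarrow> (nat \<Rightarrow> complex mat) set" where
  "moment_class q n s = {t \<in> hankel_nonneg q n. moment_equiv q n t s}"

end

theory Submission
  imports Defs "Jordan_Normal_Form.Spectral_Radius"
begin

text \<open>Call a sequence with \<open>H\<^sub>n \<ge> 0\<close> shift-null if \<open>H\<^sub>n\<^sub>-\<^sub>1 x = 0\<close> implies \<open>H\<^sub>n (0, x) = 0\<close>. For \<open>n \<ge> 1\<close> this says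
  that the kernel of \<open>L\<^sub>n\<^sub>-\<^sub>1\<close> is contained in that of \<open>L\<^sub>n\<close>, that is, that the column space of \<open>L\<^sub>n\<close>
  is contained in that of \<open>L\<^sub>n\<^sub>-\<^sub>1\<close>. An extendable sequence
  is shift-null. The moments of a measure are shift-null: if the vector polynomial \<open>p\<close> with coefficients
  \<open>x\<close> has norm zero in \<open>L\<^sup>2(\<sigma>)\<close>, so has \<open>\<lambda> p\<close>. Conversely, for a shift-null sequence the
  block shift is a well-defined symmetric operator, which extends to a Hermitian matrix; its spectral
  decomposition is a finitely atomic measure with moments \<open>s\<^sub>0, \<dots>, s\<^sub>2\<^sub>n\<close>, whose further moments
  extend the sequence.

  Hence a measure \<open>\<sigma>\<close> with the moments \<open>s\<^sub>j\<close>, \<open>j < 2n\<close>, and with last moment \<open>\<Theta>\<^sub>n + B \<le> s\<^sub>2\<^sub>n\<close> satisfies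
  \<open>0 \<le> B \<le> L\<^sub>n\<close> and has the column space of \<open>B\<close> inside that of \<open>L\<^sub>n\<^sub>-\<^sub>1\<close>. The largest such \<open>B\<close> is
  \<open>S(L\<^sub>n, R(L\<^sub>n\<^sub>-\<^sub>1))\<close>, so replacing \<open>s\<^sub>2\<^sub>n\<close> by \<open>\<Xi>\<^sub>n\<close> changes no solution and gives an extendable sequence.
  It is unique because an extendable sequence is the moment sequence of one of its own solutions, so
  that the last entries of two equivalent extendable sequences dominate each other.\<close>


section \<open>Adjoint matrices and the spectral theorem\<close>

text \<open>Column spaces are replaced throughout by kernels. The projection
  \<open>Q = 1 - L * pinv L\<close> has the column space of a Hermitian \<open>L\<close> as its
  kernel, so that an inclusion of column spaces becomes the equation \<open>Q * B = 0\<close>; its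
  adjoint is an inclusion of kernels, which null vectors of block Hankel matrices can express. An
  extension requires two new entries at once. They are not sought by solving matrix equations: one
  Hermitian matrix that extends the shift represents the given entries by its powers, and the higher
  powers supply the missing ones. The analytic obstacle is that integrals against a matrix measure
  are defined by a chosen density with respect to the trace measure. Positivity of the measure is a
  statement about sets; it first has to become positivity of almost every density matrix, with one
  null set for all vectors, before the form of a moment matrix can be read as the integral of a
  non-negative function.\<close>

lemma dim_mat_adjoint [simp]:
  "dim_row (mat_adjoint A) = dim_col A" "dim_col (mat_adjoint A) = dim_row A"
  by (auto simp: mat_adjoint_def)

lemma mat_adjoint_carrier [simp, intro]:
  "A \<in> carrier_mat m n \<Longrightarrow> mat_adjoint A \<in> carrier_mat n m"
  by (intro carrier_matI) auto

lemma index_mat_adjoint [simp]: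
  fixes A :: "complex mat"
  assumes "i < dim_col A" "j < dim_row A"
  shows "mat_adjoint A $$ (i, j) = cnj (A $$ (j, i))"
  using assms by (auto simp: mat_adjoint_def mat_of_rows_def conjugate_complex_def)

lemma mat_adjoint_adjoint [simp]: "mat_adjoint (mat_adjoint A) = (A :: complex mat)"
  by (rule eq_matI) auto

lemma index_mult_mat_sum:
  assumes "A \<in> carrier_mat m n" "B \<in> carrier_mat n p" "i < m" "j < p"
  shows "(A * B) $$ (i, j) = (\<Sum>k<n. A $$ (i, k) * B $$ (k, j))"
  using assms by (auto simp: scalar_prod_def lessThan_atLeast0)

lemma index_mult_mat_vec_sum:
  assumes "A \<in> carrier_mat m n" "v \<in> carrier_vec n" "i < m"
  shows "(A *\<^sub>v v) $ i = (\<Sum>k<n. A $$ (i, k) * v $ k)"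
  using assms by (auto simp: scalar_prod_def lessThan_atLeast0)

lemma cscalar_prod_sum:
  fixes v w :: "complex vec"
  assumes "v \<in> carrier_vec n" "w \<in> carrier_vec n"
  shows "v \<bullet>c w = (\<Sum>k<n. v $ k * cnj (w $ k))"
  using assms by (auto simp: scalar_prod_def lessThan_atLeast0 conjugate_complex_def)

lemma mat_adjoint_mult:
  fixes A B :: "complex mat"
  assumes "A \<in> carrier_mat m n" "B \<in> carrier_mat n p"
  shows "mat_adjoint (A * B) = mat_adjoint B * mat_adjoint A"
proof (rule eq_matI)
  fix i j assume "i < dim_row (mat_adjoint B * mat_adjoint A)" "j < dim_col (mat_adjoint B * mat_adjoint A)"
  then have i: "i < p" and j: "j < m" using assms by auto
  show "mat_adjoint (A * B) $$ (i, j) = (mat_adjoint B * mat_adjoint A) $$ (i, j)"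
    using assms i j
    by (simp add: index_mult_mat_sum[of _ m n _ p] index_mult_mat_sum[of _ p n _ m] mult.commute
        del: index_mult_mat(1))
qed (use assms in auto)

lemma mat_adjoint_minus:
  fixes A B :: "complex mat"
  assumes "A \<in> carrier_mat m n" "B \<in> carrier_mat m n"
  shows "mat_adjoint (A - B) = mat_adjoint A - mat_adjoint B"
  by (rule eq_matI) (use assms in auto)

lemma mat_adjoint_plus:
  fixes A B :: "complex mat"
  assumes "A \<in> carrier_mat m n" "B \<in> carrier_mat m n"
  shows "mat_adjoint (A + B) = mat_adjoint A + mat_adjoint B"
  by (rule eq_matI) (use assms in auto)

lemma mat_adjoint_one [simp]: "mat_adjoint (1\<^sub>m n) = (1\<^sub>m n :: complex mat)"
  by (rule eq_matI) auto

lemma mat_adjoint_zero [simp]: "mat_adjoint (0\<^sub>m m n) = (0\<^sub>m n m :: complex mat)"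
  by (rule eq_matI) auto

lemma mat_adjoint_four_block:
  fixes A B C D :: "complex mat"
  assumes "A \<in> carrier_mat r1 c1" "B \<in> carrier_mat r1 c2" "C \<in> carrier_mat r2 c1" "D \<in> carrier_mat r2 c2"
  shows "mat_adjoint (four_block_mat A B C D) =
    four_block_mat (mat_adjoint A) (mat_adjoint C) (mat_adjoint B) (mat_adjoint D)"
  by (rule eq_matI) (use assms in auto)

lemma cscalar_prod_adjoint:
  fixes A :: "complex mat"
  assumes A: "A \<in> carrier_mat m n" and v: "v \<in> carrier_vec n" and w: "w \<in> carrier_vec m"
  shows "(A *\<^sub>v v) \<bullet>c w = v \<bullet>c (mat_adjoint A *\<^sub>v w)"
proof -
  have "(A *\<^sub>v v) \<bullet>c w = (\<Sum>i<m. (\<Sum>k<n. A $$ (i, k) * v $ k) * cnj (w $ i))"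
    using assms index_mult_mat_vec_sum[OF A v] cscalar_prod_sum[of "A *\<^sub>v v" m w] by simp
  also have "\<dots> = (\<Sum>k<n. v $ k * (\<Sum>i<m. A $$ (i, k) * cnj (w $ i)))"
    unfolding sum_distrib_left sum_distrib_right by (subst sum.swap) (simp add: mult_ac)
  also have "\<dots> = (\<Sum>k<n. v $ k * cnj ((mat_adjoint A *\<^sub>v w) $ k))"
    using A w index_mult_mat_vec_sum[OF mat_adjoint_carrier[OF A] w]
    by (intro sum.cong) auto
  also have "\<dots> = v \<bullet>c (mat_adjoint A *\<^sub>v w)"
    using v mult_mat_vec_carrier[OF mat_adjoint_carrier[OF A] w] by (simp add: cscalar_prod_sum[of _ n])
  finally show ?thesis .
qed

lemma mat_eq_if_mult_vec_eq:
  fixes A B :: "complex mat"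
  assumes A: "A \<in> carrier_mat m n" and B: "B \<in> carrier_mat m n"
    and eq: "\<And>v. v \<in> carrier_vec n \<Longrightarrow> A *\<^sub>v v = B *\<^sub>v v"
  shows "A = B"
proof (rule eq_matI)
  fix i j assume ij: "i < dim_row B" "j < dim_col B"
  have "(A *\<^sub>v unit_vec n j) $ i = (B *\<^sub>v unit_vec n j) $ i"
    by (simp add: eq)
  then show "A $$ (i, j) = B $$ (i, j)" using A B ij by simp
qed (use A B in auto)

text \<open>Gram-Schmidt keeps the first vector of a basis that starts with \<open>v\<close>.
  Scaling the orthogonal vectors to length one leaves the first column a multiple of
  \<open>v\<close>, so an eigenvector stays an eigenvector.\<close>

lemma unitary_with_first_col:
  fixes v :: "complex vec"
  assumes v: "v \<in> carrier_vec n" and v0: "v \<noteq> 0\<^sub>v n"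
  shows "\<exists>U c. U \<in> carrier_mat n n \<and> mat_adjoint U * U = 1\<^sub>m n \<and> U * mat_adjoint U = 1\<^sub>m n
    \<and> col U 0 = c \<cdot>\<^sub>v v"
proof -
  interpret cof_vec_space n "TYPE(complex)" .
  define b where "b = basis_completion v"
  from basis_completion[OF v v0, folded b_def]
  have dist_b: "distinct b" and indep: "\<not> lin_dep (set b)" and b: "set b \<subseteq> carrier_vec n"
    and hdb: "hd b = v" and len_b: "length b = n" by auto
  have n: "n > 0" using v v0 by (cases n) auto
  obtain vs where bv: "b = v # vs" using hdb len_b n by (cases b) auto
  define ws where "ws = gram_schmidt n b"
  from gram_schmidt_result[OF b dist_b indep refl, folded ws_def]
  have ws: "set ws \<subseteq> carrier_vec n" "corthogonal ws" "length ws = n"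
    by (auto simp: len_b)
  from gram_schmidt_hd[OF v, of vs, folded bv] have "hd ws = v" unfolding ws_def .
  then have ws0: "ws ! 0 = v" using ws n by (cases ws) auto
  have wsc: "ws ! i \<in> carrier_vec n" if "i < n" for i using ws that by auto
  define c where "c j = complex_of_real (1 / sqrt (Re (ws ! j \<bullet>c ws ! j)))" for j
  define U where "U = mat n n (\<lambda>(i, j). c j * ws ! j $ i)"
  have U: "U \<in> carrier_mat n n" by (simp add: U_def)
  have norm: "cnj (c j) * c j * (ws ! j \<bullet>c ws ! j) = 1" if "j < n" for j
  proof -
    let ?z = "ws ! j \<bullet>c ws ! j"
    have "?z \<noteq> 0" using corthogonalD[OF ws(2)] that ws(3) by auto
    moreover have "?z \<ge> 0" by (rule conjugate_square_ge_0_vec)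
    ultimately have "?z = of_real (Re ?z)" "Re ?z > 0"
      by (auto simp: less_eq_complex_def complex_eq_iff)
    moreover have "cnj (c j) * c j = of_real (1 / Re ?z)"
      using \<open>Re ?z > 0\<close> unfolding c_def complex_cnj_complex_of_real of_real_mult[symmetric] by simp
    ultimately show ?thesis
      by (metis less_irrefl nonzero_divide_eq_eq of_real_1 of_real_mult)
  qed
  have "mat_adjoint U * U = 1\<^sub>m n"
  proof (rule eq_matI)
    fix i j assume "i < dim_row (1\<^sub>m n :: complex mat)" "j < dim_col (1\<^sub>m n :: complex mat)"
    then have ij: "i < n" "j < n" by auto
    have "(mat_adjoint U * U) $$ (i, j) = (\<Sum>k<n. cnj (c i) * c j * (ws ! j $ k * cnj (ws ! i $ k)))"
      using ij U by (subst index_mult_mat_sum[of _ n n _ n])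
        (auto simp: U_def mult_ac intro!: sum.cong)
    also have "\<dots> = cnj (c i) * c j * (ws ! j \<bullet>c ws ! i)"
      using cscalar_prod_sum[OF wsc[OF ij(2)] wsc[OF ij(1)]] by (simp add: sum_distrib_left)
    also have "\<dots> = (if i = j then 1 else 0)"
      using norm[of i] corthogonalD[OF ws(2), of j i] ij ws(3) by auto
    finally show "(mat_adjoint U * U) $$ (i, j) = (1\<^sub>m n) $$ (i, j)" using ij by simp
  qed (use U in auto)
  moreover from mat_mult_left_right_inverse[OF mat_adjoint_carrier[OF U] U this]
  have "U * mat_adjoint U = 1\<^sub>m n" .
  moreover have "col U 0 = c 0 \<cdot>\<^sub>v v"
    using n v by (intro eq_vecI) (auto simp: U_def ws0)
  ultimately show ?thesis using U by blast
qed

definition real_diag :: "nat \<Rightarrow> (nat \<Rightarrow> real) \<Rightarrow> complex mat" where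
  "real_diag n d = mat n n (\<lambda>(i, j). if i = j then complex_of_real (d i) else 0)"

lemma real_diag_carrier [simp, intro]: "real_diag n d \<in> carrier_mat n n"
  by (simp add: real_diag_def)

lemma dim_real_diag [simp]: "dim_row (real_diag n d) = n" "dim_col (real_diag n d) = n"
  by (simp_all add: real_diag_def)

lemma index_real_diag [simp]:
  "i < n \<Longrightarrow> j < n \<Longrightarrow> real_diag n d $$ (i, j) = (if i = j then complex_of_real (d i) else 0)"
  by (simp add: real_diag_def)

lemma mat_adjoint_real_diag [simp]: "mat_adjoint (real_diag n d) = real_diag n d"
  by (rule eq_matI) auto

lemma real_diag_mult: "real_diag n d * real_diag n e = real_diag n (\<lambda>i. d i * e i)"
proof (rule eq_matI)
  fix i j assume "i < dim_row (real_diag n (\<lambda>i. d i * e i))" "j < dim_col (real_diag n (\<lambda>i. d i * e i))"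
  then have ij: "i < n" "j < n" by auto
  have "(real_diag n d * real_diag n e) $$ (i, j) =
      (\<Sum>k<n. if k = i then complex_of_real (d i) * real_diag n e $$ (k, j) else 0)"
    unfolding index_mult_mat_sum[OF real_diag_carrier real_diag_carrier ij]
    using ij by (intro sum.cong) auto
  also have "\<dots> = real_diag n (\<lambda>i. d i * e i) $$ (i, j)"
    using ij by (subst sum.delta) auto
  finally show "(real_diag n d * real_diag n e) $$ (i, j) = real_diag n (\<lambda>i. d i * e i) $$ (i, j)" .
qed auto

text \<open>Deflation: conjugation with a unitary matrix whose first column is an eigenvector clears
  the first column below the diagonal. The result is still Hermitian, which clears the first row as
  well and makes the eigenvalue real; the induction hypothesis treats the remaining block.\<close>

theorem hermitian_spectral:
  fixes A :: "complex mat"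
  assumes "A \<in> carrier_mat n n" "mat_adjoint A = A"
  obtains U d where "U \<in> carrier_mat n n" "mat_adjoint U * U = 1\<^sub>m n" "U * mat_adjoint U = 1\<^sub>m n"
    "A = U * real_diag n d * mat_adjoint U"
proof -
  have "\<exists>U d. U \<in> carrier_mat n n \<and> mat_adjoint U * U = 1\<^sub>m n \<and> A = U * real_diag n d * mat_adjoint U"
    using assms
  proof (induction n arbitrary: A)
    case 0
    then show ?case
      by (intro exI[of _ "1\<^sub>m 0"] exI[of _ "\<lambda>_. 0"]) (auto intro!: eq_matI)
  next
    case (Suc n A)
    let ?N = "Suc n"
    note A = Suc.prems(1)
    obtain e where "eigenvalue A e"
      using spectrum_non_empty[OF A] by (auto simp: spectrum_def)
    then obtain v where v: "v \<in> carrier_vec ?N" "v \<noteq> 0\<^sub>v ?N" and Av: "A *\<^sub>v v = e \<cdot>\<^sub>v v"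
      using A by (auto simp: eigenvalue_def eigenvector_def)
    obtain U c where U: "U \<in> carrier_mat ?N ?N" and UU: "mat_adjoint U * U = 1\<^sub>m ?N"
      "U * mat_adjoint U = 1\<^sub>m ?N" and col: "col U 0 = c \<cdot>\<^sub>v v"
      using unitary_with_first_col[OF v] by blast
    note Ua = mat_adjoint_carrier[OF U]
    define A' where "A' = mat_adjoint U * A * U"
    have A': "A' \<in> carrier_mat ?N ?N" using U A by (auto simp: A'_def)
    have A'h: "mat_adjoint A' = A'"
      using U A Suc.prems(2) by (simp add: A'_def mat_adjoint_mult[of _ ?N ?N _ ?N]

          assoc_mult_mat[of _ ?N ?N _ ?N _ ?N] mult_carrier_mat[of _ ?N ?N _ ?N])
    have "A' = mat_adjoint U * (A * U)"
      using U A by (simp add: A'_def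
          assoc_mult_mat[of _ ?N ?N _ ?N _ ?N] mult_carrier_mat[of _ ?N ?N _ ?N])
    then have "col A' 0 = mat_adjoint U *\<^sub>v (A *\<^sub>v col U 0)"
      using col_mult2[OF Ua mult_carrier_mat[OF A U], of 0] col_mult2[OF A U, of 0] by simp
    also have "A *\<^sub>v col U 0 = e \<cdot>\<^sub>v col U 0"
      using A v Av by (simp add: col mult_mat_vec[of _ ?N ?N] smult_smult_assoc mult.commute)
    also have "mat_adjoint U *\<^sub>v (e \<cdot>\<^sub>v col U 0) = e \<cdot>\<^sub>v (mat_adjoint U *\<^sub>v col U 0)"
      using U by (intro mult_mat_vec[of _ ?N ?N]) (auto intro!: carrier_vecI)
    also have "mat_adjoint U *\<^sub>v col U 0 = col (mat_adjoint U * U) 0"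
      using col_mult2[OF Ua U, of 0] by simp
    finally have c0: "col A' 0 = e \<cdot>\<^sub>v unit_vec ?N 0" by (simp add: UU)
    have a0: "A' $$ (i, 0) = (if i = 0 then e else 0)" if "i < ?N" for i
      using arg_cong[OF c0, of "\<lambda>v. v $ i"] A' that by auto
    have cnjA': "A' $$ (i, j) = cnj (A' $$ (j, i))" if "i < ?N" "j < ?N" for i j
      using index_mat_adjoint[of i A' j] A' that unfolding A'h by auto
    have "cnj e = e" using cnjA'[of 0 0] a0[of 0] by simp
    then have er: "e = of_real (Re e)" by (simp add: complex_eq_iff)
    have a1: "A' $$ (0, i) = (if i = 0 then e else 0)" if "i < ?N" for i
      using cnjA'[of 0 i] a0[OF that] that \<open>cnj e = e\<close> by simp
    define A3 where "A3 = mat n n (\<lambda>(i, j). A' $$ (Suc i, Suc j))"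
    have A3: "A3 \<in> carrier_mat n n" by (simp add: A3_def)
    have "mat_adjoint A3 = A3"
    proof (rule eq_matI)
      fix i j assume "i < dim_row A3" "j < dim_col A3"
      then have ij: "i < n" "j < n" using A3 by auto
      have "mat_adjoint A' $$ (Suc i, Suc j) = A' $$ (Suc i, Suc j)" by (simp add: A'h)
      then show "mat_adjoint A3 $$ (i, j) = A3 $$ (i, j)" using ij A' by (simp add: A3_def)
    qed (use A3 in auto)
    from Suc.IH[OF A3 this] obtain V d where V: "V \<in> carrier_mat n n"
      and VV: "mat_adjoint V * V = 1\<^sub>m n" and A3eq: "A3 = V * real_diag n d * mat_adjoint V" by blast
    define W where "W = four_block_mat (1\<^sub>m 1) (0\<^sub>m 1 n) (0\<^sub>m n 1) V"
    have W: "W \<in> carrier_mat ?N ?N" using V by (auto simp: W_def)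
    have Wa: "mat_adjoint W = four_block_mat (1\<^sub>m 1) (0\<^sub>m 1 n) (0\<^sub>m n 1) (mat_adjoint V)"
      using V by (simp add: W_def mat_adjoint_four_block[of _ 1 1 _ n _ n])
    have one: "four_block_mat (1\<^sub>m 1) (0\<^sub>m 1 n) (0\<^sub>m n 1) (1\<^sub>m n) = (1\<^sub>m ?N :: complex mat)"
      by (rule eq_matI) auto
    have WW: "mat_adjoint W * W = 1\<^sub>m ?N"
      unfolding Wa unfolding W_def
      using V by (subst mult_four_block_mat[of _ 1 1 _ n _ n _ _ 1 _ n]) (auto simp: VV one)
    define d' where "d' = case_nat (Re e) d"
    have D: "real_diag ?N d' = four_block_mat (of_real (Re e) \<cdot>\<^sub>m 1\<^sub>m 1) (0\<^sub>m 1 n) (0\<^sub>m n 1) (real_diag n d)"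
      by (rule eq_matI) (auto simp: d'_def split: nat.split)
    have WD: "W * real_diag ?N d' = four_block_mat (of_real (Re e) \<cdot>\<^sub>m 1\<^sub>m 1) (0\<^sub>m 1 n) (0\<^sub>m n 1) (V * real_diag n d)"
      unfolding D unfolding W_def
      using V by (subst mult_four_block_mat[of _ 1 1 _ n _ n _ _ 1 _ n]) auto
    have "W * real_diag ?N d' * mat_adjoint W =
        four_block_mat (of_real (Re e) \<cdot>\<^sub>m 1\<^sub>m 1) (0\<^sub>m 1 n) (0\<^sub>m n 1) A3"
      unfolding WD Wa using V
      by (subst mult_four_block_mat[of _ 1 1 _ n _ n _ _ 1 _ n]) (auto simp: A3eq)
    also have "\<dots> = A'"
      using A' by (intro eq_matI) (auto simp: a0 a1 A3_def er[symmetric])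
    finally have WDW: "W * real_diag ?N d' * mat_adjoint W = A'" .
    have "A = U * mat_adjoint U * A * (U * mat_adjoint U)"
      using A by (simp add: UU)
    also have "\<dots> = U * A' * mat_adjoint U"
      using A U by (simp add: A'_def
          assoc_mult_mat[of _ ?N ?N _ ?N _ ?N] mult_carrier_mat[of _ ?N ?N _ ?N])
    also have "\<dots> = (U * W) * real_diag ?N d' * mat_adjoint (U * W)"
      using U W by (simp add: WDW[symmetric] mat_adjoint_mult[of _ ?N ?N _ ?N]

          assoc_mult_mat[of _ ?N ?N _ ?N _ ?N] mult_carrier_mat[of _ ?N ?N _ ?N])
    finally have "A = (U * W) * real_diag ?N d' * mat_adjoint (U * W)" .
    moreover have "mat_adjoint (U * W) * (U * W) = 1\<^sub>m ?N"
    proof -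
      have "mat_adjoint (U * W) * (U * W) = mat_adjoint W * (mat_adjoint U * U) * W"
        using U W by (simp add: mat_adjoint_mult[of _ ?N ?N _ ?N]
          assoc_mult_mat[of _ ?N ?N _ ?N _ ?N] mult_carrier_mat[of _ ?N ?N _ ?N])
      then show ?thesis using W by (simp add: UU WW)
    qed
    ultimately show ?case using U W by (metis mult_carrier_mat)
  qed
  then obtain U d where "U \<in> carrier_mat n n" "mat_adjoint U * U = 1\<^sub>m n"
    "A = U * real_diag n d * mat_adjoint U" by blast
  then show ?thesis
    using that mat_mult_left_right_inverse[of "mat_adjoint U" n U] by blast
qed


section \<open>Moore-Penrose inverses and non-negative Hermitian matrices\<close>

lemma mult_mat_vec_zero: "A \<in> carrier_mat m n \<Longrightarrow> A *\<^sub>v 0\<^sub>v n = (0\<^sub>v m :: complex vec)"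
  by (rule eq_vecI) auto

lemma zero_mult_mat_vec: "v \<in> carrier_vec n \<Longrightarrow> 0\<^sub>m m n *\<^sub>v v = (0\<^sub>v m :: complex vec)"
  by (rule eq_vecI) auto

text \<open>Since \<open>A * Y * A = A\<close>, the product \<open>A * Y\<close> fixes
  \<open>A * X\<close> from the left; both are Hermitian, so taking adjoints identifies them. The
  same works for \<open>X * A\<close> and \<open>Y * A\<close>, and \<open>X = X * A * X\<close> is
  then rewritten into \<open>Y\<close>.\<close>

lemma is_pinv_unique:
  assumes X: "is_pinv A X" and Y: "is_pinv A Y"
  shows "X = Y"
proof -
  let ?m = "dim_row A" and ?n = "dim_col A"
  have A: "A \<in> carrier_mat ?m ?n" by auto
  have Xc: "X \<in> carrier_mat ?n ?m" and Yc: "Y \<in> carrier_mat ?n ?m"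
    using X Y by (auto simp: is_pinv_def)
  have Xs: "A * X * A = A" "X * A * X = X" "mat_adjoint (A * X) = A * X" "mat_adjoint (X * A) = X * A"
    using X unfolding is_pinv_def by blast+
  have Ys: "A * Y * A = A" "Y * A * Y = Y" "mat_adjoint (A * Y) = A * Y" "mat_adjoint (Y * A) = Y * A"
    using Y unfolding is_pinv_def by blast+
  have 1: "A * X = (A * Y) * (A * X)"
    using assoc_mult_mat[OF mult_carrier_mat[OF A Yc] A Xc] by (simp only: Ys(1))
  have "mat_adjoint (A * X) = mat_adjoint (A * X) * mat_adjoint (A * Y)"
    by (subst (1) 1, rule mat_adjoint_mult) (use A Xc Yc in auto)
  then have "A * X = (A * X) * (A * Y)" by (simp only: Xs(3) Ys(3))
  also have "\<dots> = (A * X * A) * Y"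
    by (rule assoc_mult_mat[OF mult_carrier_mat[OF A Xc] A Yc, symmetric])
  finally have AXY: "A * X = A * Y" by (simp only: Xs(1))
  have 2: "X * A = (X * A) * (Y * A)"
    using assoc_mult_mat[OF Xc A mult_carrier_mat[OF Yc A]] assoc_mult_mat[OF A Yc A] by (simp only: Ys(1))
  have "mat_adjoint (X * A) = mat_adjoint (Y * A) * mat_adjoint (X * A)"
    by (subst (1) 2, rule mat_adjoint_mult) (use A Xc Yc in auto)
  then have "X * A = (Y * A) * (X * A)" by (simp only: Xs(4) Ys(4))
  also have "\<dots> = Y * (A * X * A)"
    using assoc_mult_mat[OF Yc A mult_carrier_mat[OF Xc A]] assoc_mult_mat[OF A Xc A] by (simp only:)
  finally have XYA: "X * A = Y * A" by (simp only: Xs(1))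
  have "X = Y * A * X" using Xs(2) by (simp only: XYA)
  also have "\<dots> = Y * (A * X)" by (rule assoc_mult_mat[OF Yc A Xc])
  also have "\<dots> = Y * A * Y" unfolding AXY by (rule assoc_mult_mat[OF Yc A Yc, symmetric])
  finally show ?thesis by (simp only: Ys(2))
qed

lemma spectral_mult:
  assumes U: "U \<in> carrier_mat n n" and UU: "mat_adjoint U * U = 1\<^sub>m n"
  shows "(U * real_diag n d * mat_adjoint U) * (U * real_diag n e * mat_adjoint U) =
    U * real_diag n (\<lambda>i. d i * e i) * mat_adjoint U"
proof -
  have "(U * real_diag n d * mat_adjoint U) * (U * real_diag n e * mat_adjoint U) =
      U * (real_diag n d * ((mat_adjoint U * U) * real_diag n e)) * mat_adjoint U"
    using U by (simp add: assoc_mult_mat[of _ n n _ n _ n] mult_carrier_mat[of _ n n _ n])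
  then show ?thesis using U by (simp add: UU real_diag_mult)
qed

lemma spectral_adjoint:
  assumes U: "U \<in> carrier_mat n n"
  shows "mat_adjoint (U * real_diag n d * mat_adjoint U) = U * real_diag n d * mat_adjoint U"
  using U by (simp add: mat_adjoint_mult[of _ n n _ n] assoc_mult_mat[of _ n n _ n _ n] mult_carrier_mat[of _ n n _ n])

lemma hermitian_pinv:
  fixes A :: "complex mat"
  assumes A: "A \<in> carrier_mat n n" "mat_adjoint A = A"
  shows "pinv A \<in> carrier_mat n n" "A * pinv A * A = A" "pinv A * A * pinv A = pinv A"
    "mat_adjoint (pinv A) = pinv A" "mat_adjoint (A * pinv A) = A * pinv A" "pinv A * A = A * pinv A"
proof -
  obtain U d where U: "U \<in> carrier_mat n n" and UU: "mat_adjoint U * U = 1\<^sub>m n"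
    and AU: "A = U * real_diag n d * mat_adjoint U"
    using hermitian_spectral[OF A] by blast
  \<comment> \<open>The convention \<open>inverse 0 = 0\<close> lets one formula invert the nonzero
    eigenvalues and keep the zero ones.\<close>
  define X where "X = U * real_diag n (\<lambda>i. inverse (d i)) * mat_adjoint U"
  have Xc: "X \<in> carrier_mat n n" using U by (auto simp: X_def)
  have Xa: "mat_adjoint X = X" unfolding X_def by (rule spectral_adjoint[OF U])
  have AX: "A * X = U * real_diag n (\<lambda>i. d i * inverse (d i)) * mat_adjoint U"
    unfolding AU X_def by (rule spectral_mult[OF U UU])
  have XA: "X * A = A * X"
    unfolding AX unfolding AU X_def spectral_mult[OF U UU] by (simp add: mult.commute)
  have inv: "x * inverse x * x = x" "x * inverse x * inverse x = inverse x" for x :: real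
    by (cases "x = 0"; simp)+
  have AXA: "A * X * A = A"
    unfolding AX unfolding AU spectral_mult[OF U UU]
    by (simp only: inv)
  have XAX: "A * X * X = X"
    unfolding AX unfolding X_def spectral_mult[OF U UU]
    by (simp only: inv)
  have AXa: "mat_adjoint (A * X) = A * X" unfolding AX by (rule spectral_adjoint[OF U])
  have "is_pinv A X"
    using A(1) Xc AXA XAX AXa by (auto simp: is_pinv_def XA)
  then have "pinv A = X"
    unfolding pinv_def using is_pinv_unique by (intro the_equality) blast+
  with Xc AXA XAX AXa XA Xa show "pinv A \<in> carrier_mat n n" "A * pinv A * A = A"
    "pinv A * A * pinv A = pinv A" "mat_adjoint (pinv A) = pinv A"
    "mat_adjoint (A * pinv A) = A * pinv A" "pinv A * A = A * pinv A" by simp_all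
qed

section \<open>Non-negative Hermitian matrices, their square roots and null vectors\<close>

definition vnorm2 :: "complex vec \<Rightarrow> real" where
  "vnorm2 v = Re (v \<bullet>c v)"

lemma vnorm2_nonneg [simp]: "vnorm2 v \<ge> 0"
  using conjugate_square_ge_0_vec[of v] by (simp add: vnorm2_def less_eq_complex_def)

lemma cscalar_prod_self: "v \<bullet>c v = of_real (vnorm2 v)"
  using conjugate_square_ge_0_vec[of v] by (simp add: vnorm2_def less_eq_complex_def complex_eq_iff)

lemma vnorm2_eq_0: "v \<in> carrier_vec n \<Longrightarrow> vnorm2 v = 0 \<longleftrightarrow> v = 0\<^sub>v n"
  using conjugate_square_eq_0_vec[of v n] cscalar_prod_self[of v] by simp

lemma cscalar_prod_cnj:
  fixes v w :: "complex vec"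
  assumes "v \<in> carrier_vec n" "w \<in> carrier_vec n"
  shows "w \<bullet>c v = cnj (v \<bullet>c w)"
  using assms by (simp add: cscalar_prod_sum[of _ n] mult.commute)

lemma cscalar_prod_diff:
  fixes u v w :: "complex vec"
  assumes "u \<in> carrier_vec n" "v \<in> carrier_vec n" "w \<in> carrier_vec n"
  shows "(u - v) \<bullet>c w = u \<bullet>c w - v \<bullet>c w"
  using assms by (intro minus_scalar_prod_distrib[of _ n]) auto

lemma cscalar_prod_add:
  fixes u v w :: "complex vec"
  assumes "u \<in> carrier_vec n" "v \<in> carrier_vec n" "w \<in> carrier_vec n"
  shows "(u + v) \<bullet>c w = u \<bullet>c w + v \<bullet>c w" "w \<bullet>c (u + v) = w \<bullet>c u + w \<bullet>c v"
  using assms add_scalar_prod_distrib[of u n v "conjugate w"]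
    scalar_prod_add_distrib[of w n "conjugate u" "conjugate v"] conjugate_add_vec[of u n v]
  by auto

lemma psd_matsD:
  assumes "A \<in> psd_mats n"
  shows "A \<in> carrier_mat n n" "mat_adjoint A = A" "\<And>x. x \<in> carrier_vec n \<Longrightarrow> 0 \<le> (A *\<^sub>v x) \<bullet>c x"
  using assms by (auto simp: psd_mats_def)

text \<open>The form of a Hermitian matrix is real, so only the sign of its real part remains to be
  checked.\<close>

lemma psd_matsI:
  assumes A: "A \<in> carrier_mat n n" "mat_adjoint A = A"
    and nonneg: "\<And>x. x \<in> carrier_vec n \<Longrightarrow> 0 \<le> Re ((A *\<^sub>v x) \<bullet>c x)"
  shows "A \<in> psd_mats n"
proof -
  have "0 \<le> (A *\<^sub>v x) \<bullet>c x" if x: "x \<in> carrier_vec n" for x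
  proof -
    have Ax: "A *\<^sub>v x \<in> carrier_vec n" using A x by auto
    have "cnj ((A *\<^sub>v x) \<bullet>c x) = (A *\<^sub>v x) \<bullet>c x"
      using cscalar_prod_adjoint[OF A(1) x x] cscalar_prod_cnj[OF x Ax] A(2) by simp
    with nonneg[OF x] show ?thesis by (simp add: less_eq_complex_def complex_eq_iff)
  qed
  with A show ?thesis by (auto simp: psd_mats_def)
qed

lemma gram_quadratic:
  fixes Z :: "complex mat"
  assumes Z: "Z \<in> carrier_mat m n" and x: "x \<in> carrier_vec n"
  shows "((mat_adjoint Z * Z) *\<^sub>v x) \<bullet>c x = of_real (vnorm2 (Z *\<^sub>v x))"
proof -
  have "((mat_adjoint Z * Z) *\<^sub>v x) \<bullet>c x = (mat_adjoint Z *\<^sub>v (Z *\<^sub>v x)) \<bullet>c x"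
    using Z x by (subst assoc_mult_mat_vec[of _ n m _ n]) auto
  also have "\<dots> = (Z *\<^sub>v x) \<bullet>c (Z *\<^sub>v x)"
    using Z x cscalar_prod_adjoint[of "mat_adjoint Z" n m "Z *\<^sub>v x" x] by auto
  finally show ?thesis by (simp add: cscalar_prod_self)
qed

lemma gram_adjoint:
  fixes Z :: "complex mat"
  assumes Z: "Z \<in> carrier_mat m n"
  shows "mat_adjoint (mat_adjoint Z * Z) = mat_adjoint Z * Z"
  using mat_adjoint_mult[OF mat_adjoint_carrier[OF Z] Z] by simp

lemma gram_psd:
  fixes Z :: "complex mat"
  assumes Z: "Z \<in> carrier_mat m n"
  shows "mat_adjoint Z * Z \<in> psd_mats n"
  using Z by (intro psd_matsI) (auto simp: gram_quadratic gram_adjoint simp del: assoc_mult_mat_vec)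

lemma mat_eq_zero_if_vnorm2:
  fixes M :: "complex mat"
  assumes M: "M \<in> carrier_mat m n" and zero: "\<And>x. x \<in> carrier_vec n \<Longrightarrow> vnorm2 (M *\<^sub>v x) = 0"
  shows "M = 0\<^sub>m m n"
proof (rule mat_eq_if_mult_vec_eq[OF M])
  fix v :: "complex vec" assume v: "v \<in> carrier_vec n"
  have "M *\<^sub>v v \<in> carrier_vec m" using M v by auto
  with zero[OF v] have "M *\<^sub>v v = 0\<^sub>v m" by (simp add: vnorm2_eq_0)
  then show "M *\<^sub>v v = 0\<^sub>m m n *\<^sub>v v" using v by (simp add: zero_mult_mat_vec)
qed auto

lemma gram_eq_zero:
  fixes Z :: "complex mat"
  assumes Z: "Z \<in> carrier_mat m n" and zero: "mat_adjoint Z * Z = 0\<^sub>m n n"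
  shows "Z = 0\<^sub>m m n"
proof (rule mat_eq_zero_if_vnorm2[OF Z])
  fix x :: "complex vec" assume x: "x \<in> carrier_vec n"
  show "vnorm2 (Z *\<^sub>v x) = 0"
    using gram_quadratic[OF Z x] x unfolding zero by (simp add: zero_mult_mat_vec)
qed

text \<open>Non-negative \<open>d i\<close> have square roots, which exhibit the matrix as a Gram
  matrix. Conversely, the form at the \<open>i\<close>-th column of \<open>U\<close> equals
  \<open>d i\<close>.\<close>

lemma spectral_psd_iff:
  assumes U: "U \<in> carrier_mat n n" and UU: "mat_adjoint U * U = 1\<^sub>m n"
  shows "U * real_diag n d * mat_adjoint U \<in> psd_mats n \<longleftrightarrow> (\<forall>i<n. d i \<ge> 0)"
proof
  assume *: "\<forall>i<n. d i \<ge> 0"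
  let ?R = "U * real_diag n (\<lambda>i. sqrt (d i)) * mat_adjoint U"
  have "real_diag n (\<lambda>i. sqrt (d i) * sqrt (d i)) = real_diag n d"
    using * by (intro eq_matI) auto
  then have "mat_adjoint ?R * ?R = U * real_diag n d * mat_adjoint U"
    unfolding spectral_adjoint[OF U] spectral_mult[OF U UU] by simp
  moreover have "?R \<in> carrier_mat n n" using U by auto
  ultimately show "U * real_diag n d * mat_adjoint U \<in> psd_mats n"
    using gram_psd by metis
next
  assume *: "U * real_diag n d * mat_adjoint U \<in> psd_mats n"
  show "\<forall>i<n. d i \<ge> 0"
  proof (intro allI impI)
    fix i assume i: "i < n"
    let ?e = "unit_vec n i :: complex vec" and ?A = "U * real_diag n d * mat_adjoint U"
    have Uc: "mat_adjoint U \<in> carrier_mat n n" using U by auto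
    have Ue: "U *\<^sub>v ?e \<in> carrier_vec n" using U by auto
    have "mat_adjoint U *\<^sub>v (U *\<^sub>v ?e) = ?e"
      using assoc_mult_mat_vec[OF Uc U, of ?e] by (simp add: UU)
    then have "?A *\<^sub>v (U *\<^sub>v ?e) = U *\<^sub>v (real_diag n d *\<^sub>v ?e)"
      using assoc_mult_mat_vec[OF mult_carrier_mat[OF U real_diag_carrier] Uc Ue]
        assoc_mult_mat_vec[OF U real_diag_carrier, of ?e] by simp
    then have "(?A *\<^sub>v (U *\<^sub>v ?e)) \<bullet>c (U *\<^sub>v ?e) = (U *\<^sub>v (real_diag n d *\<^sub>v ?e)) \<bullet>c (U *\<^sub>v ?e)"
      by simp
    also have "\<dots> = (real_diag n d *\<^sub>v ?e) \<bullet>c (mat_adjoint U *\<^sub>v (U *\<^sub>v ?e))"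
      using cscalar_prod_adjoint[OF U _ Ue, of "real_diag n d *\<^sub>v ?e"]
        mult_mat_vec_carrier[OF real_diag_carrier, of ?e n d] by simp
    also have "\<dots> = (real_diag n d *\<^sub>v ?e) \<bullet>c ?e"
      using \<open>mat_adjoint U *\<^sub>v (U *\<^sub>v ?e) = ?e\<close> by simp
    also have "real_diag n d *\<^sub>v ?e = of_real (d i) \<cdot>\<^sub>v ?e"
      using i by (intro eq_vecI) auto
    also have "(of_real (d i) \<cdot>\<^sub>v ?e) \<bullet>c ?e = of_real (d i)" using i by simp
    finally show "d i \<ge> 0"
      using psd_matsD(3)[OF * Ue] by (simp add: less_eq_complex_def)
  qed
qed

text \<open>In the two eigenbases the equation reads \<open>d i * d i * w = e j * e j * w\<close>
  for each entry \<open>w\<close> of \<open>W\<close>. So \<open>w = 0\<close> or the squares agree,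
  and in the latter case the non-negative numbers \<open>d i\<close> and \<open>e j\<close> agree.
  Hence \<open>W\<close> intertwines the diagonal matrices themselves and not only their
  squares.\<close>

lemma psd_sqrt_unique:
  assumes B: "B \<in> psd_mats n" and C: "C \<in> psd_mats n" and eq: "B * B = C * C"
  shows "B = C"
proof -
  obtain U d where U: "U \<in> carrier_mat n n" "mat_adjoint U * U = 1\<^sub>m n" "U * mat_adjoint U = 1\<^sub>m n"
    and BU: "B = U * real_diag n d * mat_adjoint U"
    using hermitian_spectral[OF psd_matsD(1,2)[OF B]] by blast
  obtain V e where V: "V \<in> carrier_mat n n" "mat_adjoint V * V = 1\<^sub>m n" "V * mat_adjoint V = 1\<^sub>m n"
    and CV: "C = V * real_diag n e * mat_adjoint V"
    using hermitian_spectral[OF psd_matsD(1,2)[OF C]] by blast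
  have d: "\<forall>i<n. d i \<ge> 0" using B unfolding BU spectral_psd_iff[OF U(1,2)] .
  have e: "\<forall>i<n. e i \<ge> 0" using C unfolding CV spectral_psd_iff[OF V(1,2)] .
  note as = assoc_mult_mat[of _ n n _ n _ n] mult_carrier_mat[of _ n n _ n]
  note cs = U(1) V(1) mat_adjoint_carrier[OF U(1)] mat_adjoint_carrier[OF V(1)]
  define W where "W = mat_adjoint U * V"
  have W: "W \<in> carrier_mat n n" using cs by (auto simp: W_def)
  let ?D = "real_diag n d" and ?E = "real_diag n e"
  have 1: "mat_adjoint U * (U * D * mat_adjoint U) * V = D * W" if "D \<in> carrier_mat n n" for D
  proof -
    have "mat_adjoint U * (U * D * mat_adjoint U) * V = (mat_adjoint U * U) * D * (mat_adjoint U * V)"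
      using cs that by (simp add: as)
    then show ?thesis using that by (simp only: U(2) W_def left_mult_one_mat)
  qed
  have 2: "mat_adjoint U * (V * D * mat_adjoint V) * V = W * D" if "D \<in> carrier_mat n n" for D
  proof -
    have "mat_adjoint U * (V * D * mat_adjoint V) * V = (mat_adjoint U * V) * D * (mat_adjoint V * V)"
      using cs that by (simp add: as)
    also have "\<dots> = W * D * 1\<^sub>m n" by (simp only: V(2) W_def)
    also have "\<dots> = W * D" by (rule right_mult_one_mat) (use W that in auto)
    finally show ?thesis .
  qed
  have "mat_adjoint U * (B * B) * V = mat_adjoint U * (C * C) * V" by (simp add: eq)
  then have sq: "real_diag n (\<lambda>i. d i * d i) * W = W * real_diag n (\<lambda>i. e i * e i)"
    unfolding BU CV spectral_mult[OF U(1,2)] spectral_mult[OF V(1,2)] by (simp add: 1 2)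
  have left: "(real_diag n f * W) $$ (i, j) = of_real (f i) * W $$ (i, j)" if "i < n" "j < n" for f i j
  proof -
    have "(real_diag n f * W) $$ (i, j) = (\<Sum>k<n. if k = i then of_real (f i) * W $$ (i, j) else 0)"
      unfolding index_mult_mat_sum[OF real_diag_carrier W that] using that by (intro sum.cong) auto
    then show ?thesis using that by simp
  qed
  have right: "(W * real_diag n f) $$ (i, j) = of_real (f j) * W $$ (i, j)" if "i < n" "j < n" for f i j
  proof -
    have "(W * real_diag n f) $$ (i, j) = (\<Sum>k<n. if k = j then of_real (f j) * W $$ (i, j) else 0)"
      unfolding index_mult_mat_sum[OF W real_diag_carrier that] using that by (intro sum.cong) auto
    then show ?thesis using that by simp
  qed
  have DWE: "?D * W = W * ?E"
  proof (rule eq_matI)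
    fix i j assume "i < dim_row (W * ?E)" "j < dim_col (W * ?E)"
    then have ij: "i < n" "j < n" using W by auto
    have "of_real (d i * d i) * W $$ (i, j) = of_real (e j * e j) * W $$ (i, j)"
      using left[OF ij, of "\<lambda>i. d i * d i"] right[OF ij, of "\<lambda>i. e i * e i"] by (simp only: sq)
    then have "W $$ (i, j) = 0 \<or> d i * d i = e j * e j"
      by (metis mult_cancel_right of_real_eq_iff)
    moreover have "d i = e j" if "d i * d i = e j * e j"
      using that d e ij by (metis abs_of_nonneg real_sqrt_abs2)
    ultimately show "(?D * W) $$ (i, j) = (W * ?E) $$ (i, j)"
      unfolding left[OF ij] right[OF ij] by auto
  qed (use W in auto)
  have "B = U * (?D * W) * mat_adjoint V"
  proof -
    have "U * (?D * W) * mat_adjoint V = U * ?D * mat_adjoint U * (V * mat_adjoint V)"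
      using cs by (simp add: W_def as)
    then show ?thesis using cs by (simp add: BU V)
  qed
  also have "\<dots> = (U * mat_adjoint U) * V * ?E * mat_adjoint V"
    unfolding DWE using cs by (simp add: W_def as)
  also have "\<dots> = C" using cs by (simp add: CV U)
  finally show ?thesis .
qed

lemma psd_sqrt:
  assumes A: "A \<in> psd_mats n"
  shows "psd_sqrt n A \<in> psd_mats n" "psd_sqrt n A * psd_sqrt n A = A"
proof -
  obtain U d where U: "U \<in> carrier_mat n n" "mat_adjoint U * U = 1\<^sub>m n"
    and AU: "A = U * real_diag n d * mat_adjoint U"
    using hermitian_spectral[OF psd_matsD(1,2)[OF A]] by blast
  have d: "\<forall>i<n. d i \<ge> 0" using A unfolding AU spectral_psd_iff[OF U] .
  let ?R = "U * real_diag n (\<lambda>i. sqrt (d i)) * mat_adjoint U"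
  have "real_diag n (\<lambda>i. sqrt (d i) * sqrt (d i)) = real_diag n d"
    using d by (intro eq_matI) auto
  then have RR: "?R * ?R = A" unfolding spectral_mult[OF U] by (simp add: AU)
  moreover have R: "?R \<in> psd_mats n" using d by (simp add: spectral_psd_iff[OF U])
  ultimately have "psd_sqrt n A = ?R"
    unfolding psd_sqrt_def using psd_sqrt_unique by (intro the_equality) auto
  with R RR show "psd_sqrt n A \<in> psd_mats n" "psd_sqrt n A * psd_sqrt n A = A" by simp_all
qed

lemma psd_quadratic:
  assumes A: "A \<in> psd_mats n" and x: "x \<in> carrier_vec n"
  shows "(A *\<^sub>v x) \<bullet>c x = of_real (vnorm2 (psd_sqrt n A *\<^sub>v x))"
  using gram_quadratic[OF psd_matsD(1)[OF psd_sqrt(1)[OF A]] x] psd_matsD(2)[OF psd_sqrt(1)[OF A]]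
  by (simp add: psd_sqrt(2)[OF A])

text \<open>The form at \<open>x\<close> is the squared norm of the square root applied to
  \<open>x\<close>. This turns one vanishing number into a vanishing vector and is the way in which
  null vectors are found below.\<close>

lemma psd_null_vector:
  assumes A: "A \<in> psd_mats n" and x: "x \<in> carrier_vec n" and zero: "(A *\<^sub>v x) \<bullet>c x = 0"
  shows "A *\<^sub>v x = 0\<^sub>v n"
proof -
  let ?R = "psd_sqrt n A"
  have R: "?R \<in> carrier_mat n n" using psd_matsD(1)[OF psd_sqrt(1)[OF A]] .
  then have Rx: "?R *\<^sub>v x \<in> carrier_vec n" using x by auto
  from zero have "?R *\<^sub>v x = 0\<^sub>v n" unfolding psd_quadratic[OF A x] using vnorm2_eq_0[OF Rx] by simp
  moreover have "A *\<^sub>v x = ?R *\<^sub>v (?R *\<^sub>v x)"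
    using psd_sqrt(2)[OF A] assoc_mult_mat_vec[OF R R x] by simp
  ultimately show ?thesis using R by (simp add: mult_mat_vec_zero)
qed

text \<open>\<open>Z\<close> may be rectangular, so the pseudoinverse is taken of the Gram matrix
  \<open>H\<close>, which is Hermitian and has the same kernel; \<open>pinv H * H\<close> projects
  onto the orthogonal complement of that kernel.\<close>

lemma kernel_projection:
  fixes Z :: "complex mat"
  assumes Z: "Z \<in> carrier_mat m n"
  obtains P where "P \<in> carrier_mat n n" "mat_adjoint P = P" "P * P = P" "Z * P = 0\<^sub>m m n"
    "\<And>x. x \<in> carrier_vec n \<Longrightarrow> Z *\<^sub>v x = 0\<^sub>v m \<Longrightarrow> P *\<^sub>v x = x"
proof -
  define H where "H = mat_adjoint Z * Z"
  have H: "H \<in> carrier_mat n n" "mat_adjoint H = H" using Z by (auto simp: H_def gram_adjoint)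
  note p = hermitian_pinv[OF H]
  define K where "K = pinv H * H"
  have K: "K \<in> carrier_mat n n" "mat_adjoint K = K" using H p by (auto simp: K_def)
  have HK: "H * K = H"
    unfolding K_def assoc_mult_mat[OF H(1) p(1) H(1), symmetric] by (rule p(2))
  have KK: "K * K = K"
    unfolding K_def assoc_mult_mat[OF mult_carrier_mat[OF p(1) H(1)] p(1) H(1), symmetric] p(3) ..
  define P where "P = 1\<^sub>m n - K"
  have P: "P \<in> carrier_mat n n" using K by (auto simp: P_def)
  have Pa: "mat_adjoint P = P" using K by (simp add: P_def mat_adjoint_minus[of _ n n])
  have z: "K - K = 0\<^sub>m n n" "H - H = 0\<^sub>m n n" using K H by auto
  have KP: "K * P = 0\<^sub>m n n"
  proof -
    have "K * P = K * 1\<^sub>m n - K * K" unfolding P_def by (rule mult_minus_distrib_mat[OF K(1) one_carrier_mat K(1)])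
    then show ?thesis by (simp only: KK right_mult_one_mat[OF K(1)] z)
  qed
  have PP: "P * P = P"
  proof -
    have "P * P = 1\<^sub>m n * P - K * P" using K P by (subst P_def) (rule minus_mult_distrib_mat, auto)
    then show ?thesis using P KP by auto
  qed
  have HP: "H * P = 0\<^sub>m n n"
  proof -
    have "H * P = H * 1\<^sub>m n - H * K" unfolding P_def by (rule mult_minus_distrib_mat[OF H(1) one_carrier_mat K(1)])
    then show ?thesis by (simp only: HK right_mult_one_mat[OF H(1)] z)
  qed
  have "mat_adjoint (Z * P) * (Z * P) = P * (H * P)"
    using Z P by (simp add: mat_adjoint_mult[of _ m n _ n] Pa H_def
        assoc_mult_mat[of _ n n _ m _ n] mult_carrier_mat[of _ n n _ m] mult_carrier_mat[of _ n m _ n]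
        assoc_mult_mat[of _ n m _ n _ n] mult_carrier_mat[of _ n m _ n] mult_carrier_mat[of _ m n _ n])
  then have "mat_adjoint (Z * P) * (Z * P) = 0\<^sub>m n n" using P HP by simp
  then have ZP: "Z * P = 0\<^sub>m m n" using gram_eq_zero[of "Z * P" m n] Z P by auto
  have "P *\<^sub>v x = x" if x: "x \<in> carrier_vec n" and zx: "Z *\<^sub>v x = 0\<^sub>v m" for x
  proof -
    have "H *\<^sub>v x = 0\<^sub>v n"
      using Z x by (simp add: H_def assoc_mult_mat_vec[of _ n m _ n] zx mult_mat_vec_zero)
    then have "K *\<^sub>v x = 0\<^sub>v n"
      unfolding K_def assoc_mult_mat_vec[OF p(1) H(1) x] by (simp add: mult_mat_vec_zero[OF p(1)])
    then show ?thesis using K x by (simp add: P_def minus_mult_distrib_mat_vec[of _ n n])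
  qed
  with that P Pa PP ZP show ?thesis by blast
qed


section \<open>Shorted matrices\<close>

text \<open>\<open>V\<close> is an arbitrary set here, so the difference of the two images need not
  lie in it. Orthogonality is tested on each image separately and combined by linearity.\<close>

lemma is_orth_proj_unique:
  assumes P: "is_orth_proj n V P" and P': "is_orth_proj n V P'"
  shows "P = P'"
proof (rule mat_eq_if_mult_vec_eq)
  show Pc: "P \<in> carrier_mat n n" and Pc': "P' \<in> carrier_mat n n"
    using P P' by (auto simp: is_orth_proj_def)
  fix x :: "complex vec" assume x: "x \<in> carrier_vec n"
  let ?a = "P *\<^sub>v x" and ?b = "P' *\<^sub>v x"
  have a: "?a \<in> carrier_vec n" and b: "?b \<in> carrier_vec n" using Pc Pc' x by auto
  have V: "?a \<in> V" "?b \<in> V" using P P' x by (auto simp: is_orth_proj_def)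
  have "(x - ?a) \<bullet>c y = 0 \<and> (x - ?b) \<bullet>c y = 0" if "y \<in> V" for y
    using P P' x that by (auto simp: is_orth_proj_def)
  then have "?a \<bullet>c y = x \<bullet>c y" "?b \<bullet>c y = x \<bullet>c y" if "y \<in> V" "y \<in> carrier_vec n" for y
    using that cscalar_prod_diff[OF x a that(2)] cscalar_prod_diff[OF x b that(2)] by auto
  then have "(?a - ?b) \<bullet>c ?a = 0" "(?a - ?b) \<bullet>c ?b = 0"
    using V a b cscalar_prod_diff[OF a b] by auto
  moreover have ab: "?a - ?b \<in> carrier_vec n" using a b by auto
  ultimately have "?a \<bullet>c (?a - ?b) = 0" "?b \<bullet>c (?a - ?b) = 0"
    using cscalar_prod_cnj[OF ab a] cscalar_prod_cnj[OF ab b] by auto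
  then have "(?a - ?b) \<bullet>c (?a - ?b) = 0" using cscalar_prod_diff[OF a b ab] by simp
  then have 0: "?a - ?b = 0\<^sub>v n" using conjugate_square_eq_0_vec[OF ab] by simp
  show "?a = ?b"
  proof (rule eq_vecI)
    fix i assume i: "i < dim_vec ?b"
    then have "i < n" using carrier_vecD[OF b] by simp
    then have "(?a - ?b) $ i = 0" unfolding 0 by simp
    then show "?a $ i = ?b $ i" using i by simp
  qed (use carrier_vecD[OF a] carrier_vecD[OF b] in simp)
qed

lemma psd_conj:
  fixes M :: "complex mat"
  assumes P: "P \<in> psd_mats m" and M: "M \<in> carrier_mat m n"
  shows "mat_adjoint M * P * M \<in> psd_mats n"
proof -
  let ?R = "psd_sqrt m P"
  note R = psd_matsD(1,2)[OF psd_sqrt(1)[OF P]]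
  have Ma: "mat_adjoint M \<in> carrier_mat n m" using M by auto
  have RM: "?R * M \<in> carrier_mat m n" using R M by auto
  have "mat_adjoint (?R * M) * (?R * M) = mat_adjoint M * ?R * (?R * M)"
    using R M by (simp only: mat_adjoint_mult[OF R(1) M])
  also have "\<dots> = mat_adjoint M * ?R * ?R * M"
    by (rule assoc_mult_mat[OF mult_carrier_mat[OF Ma R(1)] R(1) M, symmetric])
  also have "\<dots> = mat_adjoint M * P * M"
    by (simp only: assoc_mult_mat[OF Ma R(1) R(1)] psd_sqrt(2)[OF P])
  finally show ?thesis using gram_psd[OF RM] by simp
qed

lemma hermitian_projection_psd:
  fixes P :: "complex mat"
  assumes "P \<in> carrier_mat n n" "mat_adjoint P = P" "P * P = P"
  shows "P \<in> psd_mats n"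
  using gram_psd[OF assms(1)] by (simp add: assms)

text \<open>Pythagoras: the squared norms of \<open>P x\<close> and of \<open>x - P x\<close> add up
  to that of \<open>x\<close>.\<close>

lemma hermitian_projection_contraction:
  fixes P :: "complex mat"
  assumes P: "P \<in> carrier_mat n n" "mat_adjoint P = P" "P * P = P" and x: "x \<in> carrier_vec n"
  shows "vnorm2 (P *\<^sub>v x) \<le> vnorm2 x"
proof -
  let ?Q = "1\<^sub>m n - P"
  have Q: "?Q \<in> carrier_mat n n" using P by auto
  have Qa: "mat_adjoint ?Q = ?Q" using P by (simp add: mat_adjoint_minus[of _ n n])
  have PQ: "P * ?Q = P * 1\<^sub>m n - P * P" by (rule mult_minus_distrib_mat) (use P in auto)
  have "P * ?Q = 0\<^sub>m n n" unfolding PQ P(3) right_mult_one_mat[OF P(1)] using P by auto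
  moreover have "?Q * ?Q = 1\<^sub>m n * ?Q - P * ?Q" by (rule minus_mult_distrib_mat) (use P in auto)
  ultimately have "?Q * ?Q = ?Q" using P by auto
  then have "mat_adjoint ?Q * ?Q = ?Q" by (simp only: Qa)
  then have 1: "(?Q *\<^sub>v x) \<bullet>c x = of_real (vnorm2 (?Q *\<^sub>v x))" using gram_quadratic[OF Q x] by simp
  have 2: "(P *\<^sub>v x) \<bullet>c x = of_real (vnorm2 (P *\<^sub>v x))"
    using gram_quadratic[OF P(1) x] by (simp only: P)
  have Px: "P *\<^sub>v x \<in> carrier_vec n" using P x by auto
  have "?Q *\<^sub>v x = x - P *\<^sub>v x" using P x by (simp add: minus_mult_distrib_mat_vec[of _ n n])
  then have "(?Q *\<^sub>v x) \<bullet>c x = x \<bullet>c x - (P *\<^sub>v x) \<bullet>c x" using cscalar_prod_diff[OF x Px x] by simp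
  then have "complex_of_real (vnorm2 (?Q *\<^sub>v x)) = of_real (vnorm2 x - vnorm2 (P *\<^sub>v x))"
    by (simp only: 1 2 cscalar_prod_self of_real_diff)
  then have "vnorm2 (?Q *\<^sub>v x) = vnorm2 x - vnorm2 (P *\<^sub>v x)" by (simp only: of_real_eq_iff)
  then show ?thesis using vnorm2_nonneg[of "?Q *\<^sub>v x"] by linarith
qed

text \<open>The subspace is given as the kernel of a Hermitian matrix \<open>Q\<close>. The last claim, maximality of
  the shorted matrix, factors a competitor as \<open>B = R T\<^sup>* T R\<close> with \<open>R = \<surd>A\<close> and a contraction
  \<open>T = \<surd>B R\<^sup>+\<close> that vanishes on the orthogonal complement of \<open>{x. R x \<in> V}\<close>.\<close>
lemma short_mat_properties:
  assumes A: "A \<in> psd_mats n" and Q: "Q \<in> carrier_mat n n" "mat_adjoint Q = Q"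
    and V: "V = {y \<in> carrier_vec n. Q *\<^sub>v y = 0\<^sub>v n}"
  shows "short_mat n A V \<in> psd_mats n" "A - short_mat n A V \<in> psd_mats n"
    "Q * short_mat n A V = 0\<^sub>m n n"
    "\<And>B. B \<in> psd_mats n \<Longrightarrow> A - B \<in> psd_mats n \<Longrightarrow> Q * B = 0\<^sub>m n n \<Longrightarrow> short_mat n A V - B \<in> psd_mats n"
proof -
  define R where "R = psd_sqrt n A"
  have Rp: "R \<in> psd_mats n" and RR: "R * R = A" using psd_sqrt[OF A] by (simp_all add: R_def)
  note R = psd_matsD(1,2)[OF Rp]
  note Ac = psd_matsD(1,2)[OF A]
  have QR: "Q * R \<in> carrier_mat n n" using Q R by auto
  \<comment> \<open>The kernel of \<open>Q * R\<close> consists of the vectors that \<open>R\<close>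
    maps into \<open>V\<close>, so \<open>P\<close> is the projection in the definition of
    \<open>short_mat\<close>. The product \<open>Q * R\<close> need not be Hermitian.\<close>
  obtain P where P: "P \<in> carrier_mat n n" "mat_adjoint P = P" "P * P = P"
    and QRP: "(Q * R) * P = 0\<^sub>m n n"
    and Pfix: "\<And>x. x \<in> carrier_vec n \<Longrightarrow> (Q * R) *\<^sub>v x = 0\<^sub>v n \<Longrightarrow> P *\<^sub>v x = x"
    using kernel_projection[OF QR] by blast
  define U where "U = {x \<in> carrier_vec n. R *\<^sub>v x \<in> V}"
  have U: "U = {x \<in> carrier_vec n. (Q * R) *\<^sub>v x = 0\<^sub>v n}"
    unfolding U_def V using Q R by auto
  have "is_orth_proj n U P"
    unfolding is_orth_proj_def
  proof (intro conjI ballI P(1))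
    fix x :: "complex vec" assume x: "x \<in> carrier_vec n"
    have Px: "P *\<^sub>v x \<in> carrier_vec n" using P x by auto
    have "(Q * R) *\<^sub>v (P *\<^sub>v x) = 0\<^sub>v n"
      unfolding assoc_mult_mat_vec[OF QR P(1) x, symmetric] QRP by (rule zero_mult_mat_vec[OF x])
    with Px show "P *\<^sub>v x \<in> U" by (simp only: U mem_Collect_eq)
    fix y assume y: "y \<in> U"
    then have yc: "y \<in> carrier_vec n" and Py: "P *\<^sub>v y = y" using Pfix by (auto simp only: U)
    have "(P *\<^sub>v x) \<bullet>c y = x \<bullet>c y" using cscalar_prod_adjoint[OF P(1) x yc] by (simp only: P Py)
    then show "(x - P *\<^sub>v x) \<bullet>c y = 0" using cscalar_prod_diff[OF x Px yc] by simp
  qed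
  then have "orth_proj n U = P"
    unfolding orth_proj_def by (intro the_equality) (auto intro: is_orth_proj_unique)
  then have S: "short_mat n A V = R * P * R" by (simp add: short_mat_def R_def[symmetric] U_def[symmetric])
  have Sc: "R * P * R \<in> carrier_mat n n" using R P by auto
  show Sp: "short_mat n A V \<in> psd_mats n"
    using psd_conj[OF hermitian_projection_psd[OF P] R(1)] by (simp only: S R)
  have Squad: "((R * P * R) *\<^sub>v x) \<bullet>c x = of_real (vnorm2 (P *\<^sub>v (R *\<^sub>v x)))"
    if x: "x \<in> carrier_vec n" for x
  proof -
    have PR: "P * R \<in> carrier_mat n n" using P R by auto
    have "mat_adjoint (P * R) * (P * R) = R * P * (P * R)" by (simp only: mat_adjoint_mult[OF P(1) R(1)] P R)
    also have "\<dots> = R * (P * P) * R" using P(1) R(1)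
      by (simp add: assoc_mult_mat[of _ n n _ n _ n] mult_carrier_mat[of _ n n _ n])
    finally have "mat_adjoint (P * R) * (P * R) = R * P * R" by (simp only: P)
    then show ?thesis
      using gram_quadratic[OF PR x] assoc_mult_mat_vec[OF P(1) R(1) x] by (simp only:)
  qed
  have Aquad: "(A *\<^sub>v x) \<bullet>c x = of_real (vnorm2 (R *\<^sub>v x))" if "x \<in> carrier_vec n" for x
    unfolding R_def by (rule psd_quadratic[OF A that])
  show "A - short_mat n A V \<in> psd_mats n"
  proof (rule psd_matsI)
    show "A - short_mat n A V \<in> carrier_mat n n" using Ac psd_matsD(1)[OF Sp] by auto
    show "mat_adjoint (A - short_mat n A V) = A - short_mat n A V"
      using mat_adjoint_minus[OF Ac(1) psd_matsD(1)[OF Sp]] Ac psd_matsD(2)[OF Sp] by simp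
    fix x :: "complex vec" assume x: "x \<in> carrier_vec n"
    have Rx: "R *\<^sub>v x \<in> carrier_vec n" using R x by auto
    have c: "A *\<^sub>v x \<in> carrier_vec n" "(R * P * R) *\<^sub>v x \<in> carrier_vec n" using Ac Sc x by (auto simp del: assoc_mult_mat_vec)
    have "((A - R * P * R) *\<^sub>v x) \<bullet>c x = of_real (vnorm2 (R *\<^sub>v x)) - of_real (vnorm2 (P *\<^sub>v (R *\<^sub>v x)))"
      unfolding minus_mult_distrib_mat_vec[OF Ac(1) Sc x] cscalar_prod_diff[OF c x] Squad[OF x] Aquad[OF x] ..
    then show "0 \<le> Re (((A - short_mat n A V) *\<^sub>v x) \<bullet>c x)"
      using hermitian_projection_contraction[OF P Rx] by (simp add: S del: assoc_mult_mat_vec)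
  qed
  show "Q * short_mat n A V = 0\<^sub>m n n"
  proof -
    have "Q * (R * P * R) = (Q * R) * P * R"
      using Q R P by (simp add: assoc_mult_mat[of _ n n _ n _ n] mult_carrier_mat[of _ n n _ n])
    then show ?thesis using R by (simp only: S QRP left_mult_zero_mat)
  qed
  fix B assume B: "B \<in> psd_mats n" and AB: "A - B \<in> psd_mats n" and QB: "Q * B = 0\<^sub>m n n"
  define D where "D = psd_sqrt n B"
  have Dp: "D \<in> psd_mats n" and DD: "D * D = B" using psd_sqrt[OF B] by (simp_all add: D_def)
  note D = psd_matsD(1,2)[OF Dp] and Bc = psd_matsD(1,2)[OF B]
  have Bquad: "(B *\<^sub>v x) \<bullet>c x = of_real (vnorm2 (D *\<^sub>v x))" if "x \<in> carrier_vec n" for x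
    unfolding D_def by (rule psd_quadratic[OF B that])
  \<comment> \<open>The order of the matrices as an inequality between norms of the square roots; it
    makes \<open>T\<close> below a contraction.\<close>
  have DR: "vnorm2 (D *\<^sub>v x) \<le> vnorm2 (R *\<^sub>v x)" if x: "x \<in> carrier_vec n" for x
  proof -
    have c: "A *\<^sub>v x \<in> carrier_vec n" "B *\<^sub>v x \<in> carrier_vec n" using Ac Bc x by auto
    have "((A - B) *\<^sub>v x) \<bullet>c x = of_real (vnorm2 (R *\<^sub>v x)) - of_real (vnorm2 (D *\<^sub>v x))"
      unfolding minus_mult_distrib_mat_vec[OF Ac(1) Bc(1) x] cscalar_prod_diff[OF c x] Bquad[OF x] Aquad[OF x] ..
    then show ?thesis using psd_matsD(3)[OF AB x] by (simp add: less_eq_complex_def)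
  qed
  note p = hermitian_pinv[OF R]
  let ?X = "pinv R"
  have XR: "?X * R \<in> carrier_mat n n" "mat_adjoint (?X * R) = ?X * R" using p R(1) by auto
  have RX: "R * ?X \<in> carrier_mat n n" using p R(1) by auto
  have XRXR: "(R * ?X) * (R * ?X) = R * ?X"
    using assoc_mult_mat[OF RX R(1) p(1)] by (simp only: p(2))
  have RXR: "R * (?X * R) = R" using assoc_mult_mat[OF R(1) p(1) R(1)] p(2) by simp
  \<comment> \<open>\<open>N\<close> projects onto the kernel of \<open>R\<close>. The norm bound
    forces \<open>D\<close> to vanish there, so \<open>D\<close> can be divided by \<open>R\<close>
    from the right without loss.\<close>
  define N where "N = 1\<^sub>m n - ?X * R"
  have N: "N \<in> carrier_mat n n" unfolding N_def by (rule minus_carrier_mat[OF XR(1)])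
  have "R * N = R * 1\<^sub>m n - R * (?X * R)"
    unfolding N_def by (rule mult_minus_distrib_mat[OF R(1) one_carrier_mat XR(1)])
  then have RN: "R * N = 0\<^sub>m n n" using R by (simp only: RXR) auto
  have DN: "D * N = 0\<^sub>m n n"
  proof (rule mat_eq_zero_if_vnorm2)
    show "D * N \<in> carrier_mat n n" using D N by auto
    fix x :: "complex vec" assume x: "x \<in> carrier_vec n"
    have Nx: "N *\<^sub>v x \<in> carrier_vec n" using N x by auto
    have "R *\<^sub>v (N *\<^sub>v x) = 0\<^sub>v n"
      unfolding assoc_mult_mat_vec[OF R(1) N x, symmetric] RN by (rule zero_mult_mat_vec[OF x])
    then have "vnorm2 (D *\<^sub>v (N *\<^sub>v x)) \<le> 0" using DR[OF Nx] by (simp add: vnorm2_def)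
    then show "vnorm2 ((D * N) *\<^sub>v x) = 0"
      unfolding assoc_mult_mat_vec[OF D(1) N x] using vnorm2_nonneg[of "D *\<^sub>v (N *\<^sub>v x)"] by linarith
  qed
  have DXR: "D * (?X * R) = D"
  proof -
    have "D * 1\<^sub>m n - D * (?X * R) = 0\<^sub>m n n"
      using DN mult_minus_distrib_mat[OF D(1) one_carrier_mat XR(1)] by (simp only: N_def)
    then have *: "D - D * (?X * R) = 0\<^sub>m n n" using D(1) by simp
    show ?thesis
    proof (rule eq_matI)
      fix i j assume ij: "i < dim_row D" "j < dim_col D"
      have "(D - D * (?X * R)) $$ (i, j) = 0" unfolding * using ij D by auto
      moreover have "(D - D * (?X * R)) $$ (i, j) = D $$ (i, j) - (D * (?X * R)) $$ (i, j)"
        by (rule index_minus_mat) (use ij D XR in auto)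
      ultimately show "(D * (?X * R)) $$ (i, j) = D $$ (i, j)" by simp
    qed (use D XR in auto)
  qed
  define T where "T = D * ?X"
  have T: "T \<in> carrier_mat n n" using D p by (auto simp: T_def)
  have TR: "T * R = D" unfolding T_def assoc_mult_mat[OF D(1) p(1) R(1)] by (rule DXR)
  have BQ: "B * Q = 0\<^sub>m n n"
    using arg_cong[OF QB, of mat_adjoint] mat_adjoint_mult[OF Q(1) Bc(1)] by (simp add: Q Bc)
  have DQ: "D * Q = 0\<^sub>m n n"
  proof (rule mat_eq_zero_if_vnorm2)
    show "D * Q \<in> carrier_mat n n" using D Q by auto
    fix x :: "complex vec" assume x: "x \<in> carrier_vec n"
    have Qx: "Q *\<^sub>v x \<in> carrier_vec n" using Q x by auto
    have "B *\<^sub>v (Q *\<^sub>v x) = 0\<^sub>v n"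
      unfolding assoc_mult_mat_vec[OF Bc(1) Q(1) x, symmetric] BQ by (rule zero_mult_mat_vec[OF x])
    then show "vnorm2 ((D * Q) *\<^sub>v x) = 0"
      unfolding assoc_mult_mat_vec[OF D(1) Q(1) x] using Bquad[OF Qx] Qx by simp
  qed
  have QD: "Q * D = 0\<^sub>m n n"
    using arg_cong[OF DQ, of mat_adjoint] mat_adjoint_mult[OF D(1) Q(1)] by (simp add: Q D)
  have Ta: "mat_adjoint T = ?X * D" unfolding T_def mat_adjoint_mult[OF D(1) p(1)] D p ..
  have RTa: "R * mat_adjoint T = D"
  proof -
    have "mat_adjoint (D * (?X * R)) = (?X * R) * D" by (simp only: mat_adjoint_mult[OF D(1) XR(1)] XR D)
    then have "(?X * R) * D = D" by (simp only: DXR D)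
    then show ?thesis unfolding Ta assoc_mult_mat[OF R(1) p(1) D(1), symmetric] by (simp only: p)
  qed
  have Tac: "mat_adjoint T \<in> carrier_mat n n" using T by auto
  \<comment> \<open>As \<open>R * mat_adjoint T = D\<close> and \<open>Q * D = 0\<close>, the range
    of the adjoint of \<open>T\<close> lies in the kernel of \<open>Q * R\<close>, where
    \<open>P\<close> acts as the identity.\<close>
  have PT: "P * mat_adjoint T = mat_adjoint T"
  proof (rule mat_eq_if_mult_vec_eq)
    fix v :: "complex vec" assume v: "v \<in> carrier_vec n"
    have Tv: "mat_adjoint T *\<^sub>v v \<in> carrier_vec n" using mult_mat_vec_carrier[OF Tac v] .
    have "(Q * R) *\<^sub>v (mat_adjoint T *\<^sub>v v) = (Q * D) *\<^sub>v v"
      unfolding assoc_mult_mat_vec[OF Q(1) R(1) Tv] assoc_mult_mat_vec[OF R(1) Tac v, symmetric] RTa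
        assoc_mult_mat_vec[OF Q(1) D(1) v] ..
    then have "(Q * R) *\<^sub>v (mat_adjoint T *\<^sub>v v) = 0\<^sub>v n"
      unfolding QD using zero_mult_mat_vec[OF v] by simp
    from Pfix[OF Tv this] show "(P * mat_adjoint T) *\<^sub>v v = mat_adjoint T *\<^sub>v v"
      unfolding assoc_mult_mat_vec[OF P(1) Tac v] .
  qed (use P Tac in auto)
  have TP: "T * P = T"
    using arg_cong[OF PT, of mat_adjoint] mat_adjoint_mult[OF P(1) Tac] by (simp add: P)
  have contr: "vnorm2 (T *\<^sub>v x) \<le> vnorm2 x" if x: "x \<in> carrier_vec n" for x
  proof -
    have Xx: "?X *\<^sub>v x \<in> carrier_vec n" using p x by auto
    have "vnorm2 (T *\<^sub>v x) \<le> vnorm2 ((R * ?X) *\<^sub>v x)"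
      unfolding T_def assoc_mult_mat_vec[OF D(1) p(1) x] assoc_mult_mat_vec[OF R(1) p(1) x] by (rule DR[OF Xx])
    also have "\<dots> \<le> vnorm2 x"
      by (rule hermitian_projection_contraction[OF RX p(5) XRXR x])
    finally show ?thesis .
  qed
  show "short_mat n A V - B \<in> psd_mats n"
  proof (rule psd_matsI)
    show "short_mat n A V - B \<in> carrier_mat n n" using Bc psd_matsD(1)[OF Sp] by auto
    show "mat_adjoint (short_mat n A V - B) = short_mat n A V - B"
      using mat_adjoint_minus[OF psd_matsD(1)[OF Sp] Bc(1)] Bc psd_matsD(2)[OF Sp] by simp
    fix x :: "complex vec" assume x: "x \<in> carrier_vec n"
    have Rx: "R *\<^sub>v x \<in> carrier_vec n" using R x by auto
    have PRx: "P *\<^sub>v (R *\<^sub>v x) \<in> carrier_vec n" using P Rx by auto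
    have c: "B *\<^sub>v x \<in> carrier_vec n" "(R * P * R) *\<^sub>v x \<in> carrier_vec n" using Bc Sc x by (auto simp del: assoc_mult_mat_vec)
    \<comment> \<open>Because \<open>T\<close> can be applied after \<open>P\<close>, contractivity
      bounds the form of \<open>B\<close> by the form of \<open>R * P * R\<close> and not merely by
      that of \<open>A\<close>.\<close>
    have Dx: "D *\<^sub>v x = T *\<^sub>v (P *\<^sub>v (R *\<^sub>v x))"
      unfolding assoc_mult_mat_vec[OF T P(1) Rx, symmetric] TP assoc_mult_mat_vec[OF T R(1) x, symmetric] TR ..
    have "((R * P * R - B) *\<^sub>v x) \<bullet>c x = of_real (vnorm2 (P *\<^sub>v (R *\<^sub>v x))) - of_real (vnorm2 (D *\<^sub>v x))"
      unfolding minus_mult_distrib_mat_vec[OF Sc Bc(1) x] cscalar_prod_diff[OF c(2,1) x] Squad[OF x] Bquad[OF x] ..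
    then show "0 \<le> Re (((short_mat n A V - B) *\<^sub>v x) \<bullet>c x)"
      using contr[OF PRx] by (simp add: S Dx del: assoc_mult_mat_vec)
  qed
qed


section \<open>Concatenated vectors\<close>

lemma cscalar_prod_append:
  fixes u v w z :: "complex vec"
  assumes "u \<in> carrier_vec m" "v \<in> carrier_vec n" "w \<in> carrier_vec m" "z \<in> carrier_vec n"
  shows "(u @\<^sub>v v) \<bullet>c (w @\<^sub>v z) = u \<bullet>c w + v \<bullet>c z"
proof -
  have "conjugate (w @\<^sub>v z) = conjugate w @\<^sub>v conjugate z"
    using assms by (intro eq_vecI) auto
  then show ?thesis
    using scalar_prod_append[of u m v n "conjugate w" "conjugate z"] assms by simp
qed

lemma append_vec_assoc: "(u @\<^sub>v v) @\<^sub>v w = u @\<^sub>v (v @\<^sub>v w)"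
  by (rule eq_vecI) auto

lemma append_zero_vec: "0\<^sub>v m @\<^sub>v 0\<^sub>v n = 0\<^sub>v (m + n)"
  by (rule eq_vecI) auto

lemma append_eq_zero_iff:
  assumes "u \<in> carrier_vec m" "v \<in> carrier_vec n"
  shows "u @\<^sub>v v = 0\<^sub>v (m + n) \<longleftrightarrow> u = 0\<^sub>v m \<and> v = 0\<^sub>v n"
  unfolding append_zero_vec[symmetric] using assms by (intro append_vec_eq) auto

lemma zero_cscalar_prod: "x \<in> carrier_vec n \<Longrightarrow> 0\<^sub>v n \<bullet>c x = (0 :: complex)"
  by simp

lemma minus_zero_vec_eq:
  assumes "a \<in> carrier_vec n" "b \<in> carrier_vec n" "a - b = 0\<^sub>v n"
  shows "a = (b :: complex vec)"
proof (rule eq_vecI)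
  fix i assume i: "i < dim_vec b"
  then have "i < n" using carrier_vecD[OF assms(2)] by simp
  then have "(a - b) $ i = 0" unfolding assms(3) by simp
  then show "a $ i = b $ i" using i by simp
qed (use carrier_vecD[OF assms(1)] carrier_vecD[OF assms(2)] in simp)

section \<open>Schur complements\<close>

context
  fixes A B C :: "complex mat" and m q :: nat
  assumes A: "A \<in> carrier_mat m m" "mat_adjoint A = A"
    and B: "B \<in> carrier_mat m q"
    and C: "C \<in> carrier_mat q q" "mat_adjoint C = C"
begin

private abbreviation "F \<equiv> four_block_mat A B (mat_adjoint B) C"
private abbreviation "E \<equiv> C - mat_adjoint B * pinv A * B"

private lemma Fc: "F \<in> carrier_mat (m + q) (m + q)"
  using A C by auto

private lemma Fa: "mat_adjoint F = F"
  using A B C by (simp add: mat_adjoint_four_block[of _ m m _ q _ q])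

private lemmas X = hermitian_pinv[OF A]

private lemma Ba: "mat_adjoint B \<in> carrier_mat q m"
  using B by auto

private lemma Ec: "E \<in> carrier_mat q q"
  using B X(1) by (intro minus_carrier_mat) auto

private lemma Ea: "mat_adjoint E = E"
proof -
  have BX: "mat_adjoint B * pinv A \<in> carrier_mat q m" using B X(1) by auto
  have BXB: "mat_adjoint B * pinv A * B \<in> carrier_mat q q" using B X(1) by auto
  have "mat_adjoint (mat_adjoint B * pinv A * B) = mat_adjoint B * (pinv A * B)"
    unfolding mat_adjoint_mult[OF BX B] mat_adjoint_mult[OF Ba X(1)] by (simp add: X(4))
  also have "\<dots> = mat_adjoint B * pinv A * B" by (rule assoc_mult_mat[OF Ba X(1) B, symmetric])
  finally show ?thesis using mat_adjoint_minus[OF C(1) BXB] C(2) by simp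
qed

private lemma F_mult:
  assumes u: "u \<in> carrier_vec m" and x: "x \<in> carrier_vec q"
  shows "F *\<^sub>v (u @\<^sub>v x) = (A *\<^sub>v u + B *\<^sub>v x) @\<^sub>v (mat_adjoint B *\<^sub>v u + C *\<^sub>v x)"
  by (rule four_block_mat_mult_vec[OF A(1) B Ba C(1) u x])

text \<open>Completing the square. The hypothesis \<open>AXB\<close> says that the columns of
  \<open>B\<close> lie in the range of \<open>A\<close>; therefore \<open>w\<close> absorbs the
  mixed terms, and what remains is the form of the Schur complement \<open>E\<close>.\<close>

lemma schur_quadratic:
  assumes AXB: "A * pinv A * B = B" and u: "u \<in> carrier_vec m" and x: "x \<in> carrier_vec q"
  defines "w \<equiv> u + pinv A *\<^sub>v (B *\<^sub>v x)"
  shows "(F *\<^sub>v (u @\<^sub>v x)) \<bullet>c (u @\<^sub>v x) = (A *\<^sub>v w) \<bullet>c w + (E *\<^sub>v x) \<bullet>c x"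
    and "A *\<^sub>v w = A *\<^sub>v u + B *\<^sub>v x" and "w \<in> carrier_vec m"
proof -
  have Bx: "B *\<^sub>v x \<in> carrier_vec m" using B x by auto
  have XBx: "pinv A *\<^sub>v (B *\<^sub>v x) \<in> carrier_vec m" (is "?y \<in> _") using X(1) Bx by auto
  have Au: "A *\<^sub>v u \<in> carrier_vec m" using A u by auto
  have Cx: "C *\<^sub>v x \<in> carrier_vec q" using C x by auto
  have Bu: "mat_adjoint B *\<^sub>v u \<in> carrier_vec q" using Ba u by auto
  have BXBx: "mat_adjoint B *\<^sub>v ?y \<in> carrier_vec q" using Ba XBx by auto
  show w: "w \<in> carrier_vec m" using u XBx by (auto simp: w_def)
  have "A *\<^sub>v ?y = (A * pinv A * B) *\<^sub>v x"
    unfolding assoc_mult_mat_vec[OF mult_carrier_mat[OF A(1) X(1)] B x] assoc_mult_mat_vec[OF A(1) X(1) Bx] ..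
  then have AXBx: "A *\<^sub>v ?y = B *\<^sub>v x" by (simp only: AXB)
  show Aw: "A *\<^sub>v w = A *\<^sub>v u + B *\<^sub>v x"
    unfolding w_def mult_add_distrib_mat_vec[OF A(1) u XBx] AXBx ..
  have 1: "(A *\<^sub>v u) \<bullet>c ?y = (mat_adjoint B *\<^sub>v u) \<bullet>c x"
    using cscalar_prod_adjoint[OF A(1) u XBx] cscalar_prod_adjoint[OF Ba u x] by (simp only: A(2) AXBx mat_adjoint_adjoint)
  have 2: "(B *\<^sub>v x) \<bullet>c ?y = (mat_adjoint B *\<^sub>v ?y) \<bullet>c x"
  proof -
    have "(mat_adjoint B *\<^sub>v ?y) \<bullet>c x = ?y \<bullet>c (B *\<^sub>v x)"
      using cscalar_prod_adjoint[OF Ba XBx x] by simp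
    also have "\<dots> = (B *\<^sub>v x) \<bullet>c ?y"
      using cscalar_prod_adjoint[OF X(1) Bx Bx] by (simp only: X(4))
    finally show ?thesis ..
  qed
  have BXB: "mat_adjoint B * pinv A * B \<in> carrier_mat q q" using B X(1) by auto
  have "(mat_adjoint B * pinv A * B) *\<^sub>v x = mat_adjoint B *\<^sub>v ?y"
    unfolding assoc_mult_mat_vec[OF mult_carrier_mat[OF Ba X(1)] B x] assoc_mult_mat_vec[OF Ba X(1) Bx] ..
  then have Ex: "(E *\<^sub>v x) \<bullet>c x = (C *\<^sub>v x) \<bullet>c x - (mat_adjoint B *\<^sub>v ?y) \<bullet>c x"
    unfolding minus_mult_distrib_mat_vec[OF C(1) BXB x] using cscalar_prod_diff[OF Cx BXBx x] by simp
  have "(F *\<^sub>v (u @\<^sub>v x)) \<bullet>c (u @\<^sub>v x) =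
      (A *\<^sub>v u + B *\<^sub>v x) \<bullet>c u + (mat_adjoint B *\<^sub>v u + C *\<^sub>v x) \<bullet>c x"
    unfolding F_mult[OF u x] using Au Bx Bu Cx u x by (intro cscalar_prod_append) auto
  moreover have "(A *\<^sub>v w) \<bullet>c w = (A *\<^sub>v u + B *\<^sub>v x) \<bullet>c u + (A *\<^sub>v u + B *\<^sub>v x) \<bullet>c ?y"
    unfolding Aw using cscalar_prod_add(2)[OF u XBx, of "A *\<^sub>v u + B *\<^sub>v x"] Au Bx by (simp add: w_def)
  ultimately show "(F *\<^sub>v (u @\<^sub>v x)) \<bullet>c (u @\<^sub>v x) = (A *\<^sub>v w) \<bullet>c w + (E *\<^sub>v x) \<bullet>c x"
    unfolding cscalar_prod_add(1)[OF Au Bx u] cscalar_prod_add(1)[OF Au Bx XBx]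
      cscalar_prod_add(1)[OF Bu Cx x] 1 2 Ex by simp
qed

text \<open>A null vector of \<open>A\<close>, padded with zeros, makes the form of \<open>F\<close>
  vanish and so is a null vector of \<open>F\<close>. Hence the adjoint of \<open>B\<close> kills
  the kernel of \<open>A\<close>, which is the range condition in adjoint form. The choice of
  \<open>u\<close> that makes \<open>w = 0\<close> in \<open>schur_quadratic\<close> then leaves the
  form of \<open>E\<close> alone.\<close>

lemma schur_psdD:
  assumes F: "F \<in> psd_mats (m + q)"
  shows "A \<in> psd_mats m" "A * pinv A * B = B" "E \<in> psd_mats q"
proof -
  have Fu0: "F *\<^sub>v (u @\<^sub>v 0\<^sub>v q) = (A *\<^sub>v u) @\<^sub>v (mat_adjoint B *\<^sub>v u)" if u: "u \<in> carrier_vec m" for u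
    unfolding F_mult[OF u zero_carrier_vec]
    using mult_mat_vec_carrier[OF A(1) u] mult_mat_vec_carrier[OF Ba u]
    by (simp add: mult_mat_vec_zero[OF B] mult_mat_vec_zero[OF C(1)])
  have Fq: "(F *\<^sub>v (u @\<^sub>v 0\<^sub>v q)) \<bullet>c (u @\<^sub>v 0\<^sub>v q) = (A *\<^sub>v u) \<bullet>c u" if u: "u \<in> carrier_vec m" for u
    unfolding Fu0[OF u] using u A Ba cscalar_prod_append[of "A *\<^sub>v u" m "mat_adjoint B *\<^sub>v u" q u "0\<^sub>v q"] by auto
  show Ap: "A \<in> psd_mats m"
  proof (rule psd_matsI[OF A])
    fix u :: "complex vec" assume u: "u \<in> carrier_vec m"
    then have "u @\<^sub>v 0\<^sub>v q \<in> carrier_vec (m + q)" by auto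
    from psd_matsD(3)[OF F this] show "0 \<le> Re ((A *\<^sub>v u) \<bullet>c u)"
      unfolding Fq[OF u] by (simp add: less_eq_complex_def)
  qed
  have null: "mat_adjoint B *\<^sub>v u = 0\<^sub>v q" if u: "u \<in> carrier_vec m" and Au: "A *\<^sub>v u = 0\<^sub>v m" for u
  proof -
    have u0: "u @\<^sub>v 0\<^sub>v q \<in> carrier_vec (m + q)" using u by auto
    have "F *\<^sub>v (u @\<^sub>v 0\<^sub>v q) = 0\<^sub>v (m + q)"
      by (rule psd_null_vector[OF F u0]) (simp only: Fq[OF u] Au zero_cscalar_prod[OF u])
    then show ?thesis
      unfolding Fu0[OF u] using append_eq_zero_iff[of "A *\<^sub>v u" m "mat_adjoint B *\<^sub>v u" q] A Ba u by auto
  qed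
  have AX: "A * pinv A \<in> carrier_mat m m" using A X(1) by auto
  have XA: "pinv A * A \<in> carrier_mat m m" using A X(1) by auto
  have BAX: "mat_adjoint B = mat_adjoint B * (pinv A * A)"
  proof (rule mat_eq_if_mult_vec_eq)
    fix v :: "complex vec" assume v: "v \<in> carrier_vec m"
    let ?y = "(pinv A * A) *\<^sub>v v"
    have Xv: "?y \<in> carrier_vec m" using mult_mat_vec_carrier[OF XA v] .
    have Av: "A *\<^sub>v v \<in> carrier_vec m" using A v by auto
    have "A *\<^sub>v ?y = A *\<^sub>v v"
      unfolding assoc_mult_mat_vec[OF A(1) XA v, symmetric] assoc_mult_mat[OF A(1) X(1) A(1), symmetric] X(2) ..
    then have "A *\<^sub>v (v - ?y) = A *\<^sub>v v - A *\<^sub>v v"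
      unfolding mult_minus_distrib_mat_vec[OF A(1) v Xv] by (simp only:)
    then have "A *\<^sub>v (v - ?y) = 0\<^sub>v m" using minus_cancel_vec[OF Av] by (simp only:)
    then have "mat_adjoint B *\<^sub>v (v - ?y) = 0\<^sub>v q" using null[of "v - ?y"] v Xv by auto
    then have "mat_adjoint B *\<^sub>v v - mat_adjoint B *\<^sub>v ?y = 0\<^sub>v q"
      unfolding mult_minus_distrib_mat_vec[OF Ba v Xv] .
    then have "mat_adjoint B *\<^sub>v v = mat_adjoint B *\<^sub>v ?y"
      using mult_mat_vec_carrier[OF Ba v] mult_mat_vec_carrier[OF Ba Xv] minus_zero_vec_eq by blast
    then show "mat_adjoint B *\<^sub>v v = (mat_adjoint B * (pinv A * A)) *\<^sub>v v"
      unfolding assoc_mult_mat_vec[OF Ba XA v] .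
  qed (use Ba XA in auto)
  have "mat_adjoint (mat_adjoint B) = mat_adjoint (mat_adjoint B * (A * pinv A))"
    using arg_cong[OF BAX, of mat_adjoint] by (simp only: X(6))
  then show AXB: "A * pinv A * B = B"
    unfolding mat_adjoint_mult[OF Ba AX] X(5) by simp
  show "E \<in> psd_mats q"
  proof (rule psd_matsI[OF Ec Ea])
    fix x :: "complex vec" assume x: "x \<in> carrier_vec q"
    define y where "y = pinv A *\<^sub>v (B *\<^sub>v x)"
    have y: "y \<in> carrier_vec m" using X(1) B x by (auto simp: y_def)
    then have "- y + y = 0\<^sub>v m" by (intro eq_vecI) auto
    then have "(F *\<^sub>v ((- y) @\<^sub>v x)) \<bullet>c ((- y) @\<^sub>v x) = (E *\<^sub>v x) \<bullet>c x"
      using schur_quadratic(1)[OF AXB _ x, of "- y"] y mult_mat_vec_zero[OF A(1)] by (simp add: y_def[symmetric])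
    moreover have "(- y) @\<^sub>v x \<in> carrier_vec (m + q)" using y x by auto
    ultimately show "0 \<le> Re ((E *\<^sub>v x) \<bullet>c x)"
      using psd_matsD(3)[OF F, of "(- y) @\<^sub>v x"] by (simp add: less_eq_complex_def)
  qed
qed

lemma schur_psdI:
  assumes Ap: "A \<in> psd_mats m" and AXB: "A * pinv A * B = B" and Ep: "E \<in> psd_mats q"
  shows "F \<in> psd_mats (m + q)"
proof (rule psd_matsI[OF Fc Fa])
  fix v :: "complex vec" assume v: "v \<in> carrier_vec (m + q)"
  define u x where "u = vec_first v m" and "x = vec_last v q"
  have u: "u \<in> carrier_vec m" and x: "x \<in> carrier_vec q" and vux: "v = u @\<^sub>v x"
    using v by (auto simp: u_def x_def vec_first_last_append)
  note sq = schur_quadratic[OF AXB u x]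
  show "0 \<le> Re ((F *\<^sub>v v) \<bullet>c v)"
    using psd_matsD(3)[OF Ap sq(3)] psd_matsD(3)[OF Ep x] unfolding vux sq(1)
    by (simp add: less_eq_complex_def)
qed

text \<open>The completed square splits the form of \<open>F\<close> into two non-negative terms,
  which must vanish separately; \<open>psd_null_vector\<close> passes from forms to vectors.\<close>

lemma schur_kernel_iff:
  assumes F: "F \<in> psd_mats (m + q)" and u: "u \<in> carrier_vec m" and x: "x \<in> carrier_vec q"
  shows "F *\<^sub>v (u @\<^sub>v x) = 0\<^sub>v (m + q) \<longleftrightarrow> A *\<^sub>v u + B *\<^sub>v x = 0\<^sub>v m \<and> E *\<^sub>v x = 0\<^sub>v q"
proof -
  note d = schur_psdD[OF F]
  note sq = schur_quadratic[OF d(2) u x]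
  let ?w = "u + pinv A *\<^sub>v (B *\<^sub>v x)"
  have ux: "u @\<^sub>v x \<in> carrier_vec (m + q)" using u x by auto
  have p: "0 \<le> (A *\<^sub>v ?w) \<bullet>c ?w" "0 \<le> (E *\<^sub>v x) \<bullet>c x"
    using psd_matsD(3)[OF d(1) sq(3)] psd_matsD(3)[OF d(3) x] by auto
  show ?thesis
  proof
    assume "F *\<^sub>v (u @\<^sub>v x) = 0\<^sub>v (m + q)"
    then have "(A *\<^sub>v ?w) \<bullet>c ?w + (E *\<^sub>v x) \<bullet>c x = 0"
      unfolding sq(1)[symmetric] using ux by simp
    with p have "(A *\<^sub>v ?w) \<bullet>c ?w = 0" "(E *\<^sub>v x) \<bullet>c x = 0"
      by (auto simp: less_eq_complex_def complex_eq_iff)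
    then show "A *\<^sub>v u + B *\<^sub>v x = 0\<^sub>v m \<and> E *\<^sub>v x = 0\<^sub>v q"
      using psd_null_vector[OF d(1) sq(3)] psd_null_vector[OF d(3) x] sq(2) by simp
  next
    assume *: "A *\<^sub>v u + B *\<^sub>v x = 0\<^sub>v m \<and> E *\<^sub>v x = 0\<^sub>v q"
    have "(F *\<^sub>v (u @\<^sub>v x)) \<bullet>c (u @\<^sub>v x) = 0"
      unfolding sq(1) sq(2) using * zero_cscalar_prod[OF sq(3)] zero_cscalar_prod[OF x] by simp
    then show "F *\<^sub>v (u @\<^sub>v x) = 0\<^sub>v (m + q)" by (rule psd_null_vector[OF F ux])
  qed
qed

end

section \<open>Hermitian extension of a symmetric operator\<close>

text \<open>\<open>G\<close> sends \<open>X v\<close> to \<open>Y v\<close> and vanishes on the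
  orthogonal complement of the range of \<open>X\<close>. Its adjoint supplies the missing
  off-diagonal block, and \<open>K\<close>, the compression of \<open>G\<close> to the range of
  \<open>X\<close>, removes what is then counted twice. The symmetry of
  \<open>mat_adjoint X * Y\<close> makes \<open>K\<close> Hermitian and lets
  \<open>mat_adjoint G\<close> and \<open>K\<close> cancel on the range of \<open>X\<close>.\<close>

lemma hermitian_extension:
  fixes X Y :: "complex mat"
  assumes X: "X \<in> carrier_mat N p" and Y: "Y \<in> carrier_mat N p"
    and sym: "mat_adjoint (mat_adjoint X * Y) = mat_adjoint X * Y"
    and ker: "\<And>v. v \<in> carrier_vec p \<Longrightarrow> X *\<^sub>v v = 0\<^sub>v N \<Longrightarrow> Y *\<^sub>v v = 0\<^sub>v N"
  obtains M where "M \<in> carrier_mat N N" "mat_adjoint M = M" "M * X = Y"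
proof -
  define H where "H = mat_adjoint X * X"
  have Xa: "mat_adjoint X \<in> carrier_mat p N" and Ya: "mat_adjoint Y \<in> carrier_mat p N" using X Y by auto
  have H: "H \<in> carrier_mat p p" "mat_adjoint H = H"
    using X by (auto simp: H_def gram_adjoint)
  note p = hermitian_pinv[OF H]
  let ?Z = "pinv H"
  define S where "S = mat_adjoint X * Y"
  have S: "S \<in> carrier_mat p p" "mat_adjoint S = S" using Xa Y sym by (auto simp: S_def)
  have S': "mat_adjoint Y * X = S" using sym unfolding S_def mat_adjoint_mult[OF Xa Y] by simp
  have ZH: "?Z * H \<in> carrier_mat p p" using p H by auto
  have HZH: "H * (?Z * H) = H" unfolding assoc_mult_mat[OF H(1) p(1) H(1), symmetric] by (rule p(2))
  \<comment> \<open>\<open>v\<close> and its projection \<open>pinv H * H\<close> applied to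
    \<open>v\<close> differ by a vector in the kernel of \<open>H\<close>, that is of
    \<open>X\<close>; by \<open>ker\<close> this difference is invisible to
    \<open>Y\<close>.\<close>
  have kerZ: "Y *\<^sub>v v = Y *\<^sub>v ((?Z * H) *\<^sub>v v)" if v: "v \<in> carrier_vec p" for v
  proof -
    let ?k = "(?Z * H) *\<^sub>v v"
    have k: "?k \<in> carrier_vec p" using mult_mat_vec_carrier[OF ZH v] .
    have Hv: "H *\<^sub>v v \<in> carrier_vec p" using H v by auto
    have vk: "v - ?k \<in> carrier_vec p" using v k by auto
    have "H *\<^sub>v ?k = H *\<^sub>v v" unfolding assoc_mult_mat_vec[OF H(1) ZH v, symmetric] HZH ..
    then have "H *\<^sub>v (v - ?k) = H *\<^sub>v v - H *\<^sub>v v"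
      unfolding mult_minus_distrib_mat_vec[OF H(1) v k] by (simp only:)
    then have "H *\<^sub>v (v - ?k) = 0\<^sub>v p" using minus_cancel_vec[OF Hv] by (simp only:)
    then have "vnorm2 (X *\<^sub>v (v - ?k)) = 0"
      using gram_quadratic[OF X vk] zero_cscalar_prod[OF vk] unfolding H_def by simp
    moreover have "X *\<^sub>v (v - ?k) \<in> carrier_vec N" using X vk by auto
    ultimately have "X *\<^sub>v (v - ?k) = 0\<^sub>v N" by (simp only: vnorm2_eq_0)
    from ker[OF vk this] have "Y *\<^sub>v v - Y *\<^sub>v ?k = 0\<^sub>v N"
      unfolding mult_minus_distrib_mat_vec[OF Y v k] .
    then show ?thesis
      using minus_zero_vec_eq mult_mat_vec_carrier[OF Y v] mult_mat_vec_carrier[OF Y k] by blast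
  qed
  have YZH: "Y * (?Z * H) = Y"
  proof (rule mat_eq_if_mult_vec_eq)
    fix v :: "complex vec" assume v: "v \<in> carrier_vec p"
    show "(Y * (?Z * H)) *\<^sub>v v = Y *\<^sub>v v"
      unfolding assoc_mult_mat_vec[OF Y ZH v] kerZ[OF v, symmetric] ..
  qed (use Y ZH in auto)
  have YZ: "Y * ?Z \<in> carrier_mat N p" using Y p by auto
  have XZ: "X * ?Z \<in> carrier_mat N p" using X p by auto
  define G where "G = Y * ?Z * mat_adjoint X"
  have G: "G \<in> carrier_mat N N" using YZ Xa by (auto simp: G_def)
  have Ga: "mat_adjoint G = X * (?Z * mat_adjoint Y)"
    unfolding G_def mat_adjoint_mult[OF YZ Xa] mat_adjoint_mult[OF Y p(1)] p(4) mat_adjoint_adjoint ..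
  have ZYa: "?Z * mat_adjoint Y \<in> carrier_mat p N" using p Ya by auto
  have Gac: "mat_adjoint G \<in> carrier_mat N N" using G by auto
  have ZS: "?Z * S \<in> carrier_mat p p" and SZ: "S * ?Z \<in> carrier_mat p p" using p S by auto
  define K where "K = X * (?Z * S * ?Z) * mat_adjoint X"
  have ZSZ: "?Z * S * ?Z \<in> carrier_mat p p" using ZS p by auto
  have XZSZ: "X * (?Z * S * ?Z) \<in> carrier_mat N p" using X ZSZ by auto
  have K: "K \<in> carrier_mat N N" using XZSZ Xa by (auto simp: K_def)
  have "mat_adjoint (?Z * S * ?Z) = ?Z * (S * ?Z)"
    unfolding mat_adjoint_mult[OF ZS p(1)] mat_adjoint_mult[OF p(1) S(1)] p(4) S(2) ..
  then have ZSZa: "mat_adjoint (?Z * S * ?Z) = ?Z * S * ?Z"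
    using assoc_mult_mat[OF p(1) S(1) p(1)] by (simp only:)
  have Ka: "mat_adjoint K = K"
    unfolding K_def mat_adjoint_mult[OF XZSZ Xa] mat_adjoint_mult[OF X ZSZ] ZSZa mat_adjoint_adjoint
    by (rule assoc_mult_mat[OF X ZSZ Xa, symmetric])
  have GX: "G * X = Y"
    unfolding G_def assoc_mult_mat[OF YZ Xa X] H_def[symmetric] assoc_mult_mat[OF Y p(1) H(1)] by (rule YZH)
  have GaX: "mat_adjoint G * X = X * (?Z * S)"
    unfolding Ga assoc_mult_mat[OF X ZYa X] assoc_mult_mat[OF p(1) Ya X] S' ..
  have SZH: "S * (?Z * H) = S"
    unfolding S_def assoc_mult_mat[OF Xa Y ZH] YZH ..
  have KX: "K * X = X * (?Z * S)"
    unfolding K_def assoc_mult_mat[OF XZSZ Xa X] H_def[symmetric] assoc_mult_mat[OF X ZSZ H(1)]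
      assoc_mult_mat[OF ZS p(1) H(1)] assoc_mult_mat[OF p(1) S(1) ZH] SZH ..
  define M where "M = G + (mat_adjoint G - K)"
  have GK: "mat_adjoint G - K \<in> carrier_mat N N" using K by (rule minus_carrier_mat)
  have M: "M \<in> carrier_mat N N" using G GK by (auto simp: M_def)
  have "mat_adjoint M = mat_adjoint G + (G - K)"
    unfolding M_def mat_adjoint_plus[OF G GK] mat_adjoint_minus[OF Gac K] Ka mat_adjoint_adjoint ..
  also have "\<dots> = M" unfolding M_def using G Gac K by (intro eq_matI) auto
  finally have Ma: "mat_adjoint M = M" .
  have XZS: "X * (?Z * S) \<in> carrier_mat N p" using X ZS by auto
  have "M * X = Y + (X * (?Z * S) - X * (?Z * S))"
    unfolding M_def add_mult_distrib_mat[OF G GK X] minus_mult_distrib_mat[OF Gac K X] GX GaX KX ..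
  also have "\<dots> = Y" using Y XZS by (intro eq_matI) (auto simp del: index_mult_mat(1))
  finally have "M * X = Y" .
  with that M Ma show ?thesis by blast
qed

section \<open>Block Hankel matrices\<close>

definition hblk :: "nat \<Rightarrow> (nat \<Rightarrow> complex mat) \<Rightarrow> nat \<Rightarrow> nat \<Rightarrow> nat \<Rightarrow> complex mat" where
  "hblk q s a r c = mat (r * q) (c * q) (\<lambda>(i, j). s (a + i div q + j div q) $$ (i mod q, j mod q))"

lemma sum_lessThan_add: "(\<Sum>j<m + n. f j) = (\<Sum>j<m. f j) + (\<Sum>j<n. f (m + j))"
  for f :: "nat \<Rightarrow> 'a :: comm_monoid_add"
  by (induction n) (auto simp: add.assoc)

lemma hblk_carrier [simp]: "hblk q s a r c \<in> carrier_mat (r * q) (c * q)"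
  by (simp add: hblk_def)

lemma dim_hblk [simp]: "dim_row (hblk q s a r c) = r * q" "dim_col (hblk q s a r c) = c * q"
  by (simp_all add: hblk_def)

lemma index_hblk:
  "i < r * q \<Longrightarrow> j < c * q \<Longrightarrow>
    hblk q s a r c $$ (i, j) = s (a + i div q + j div q) $$ (i mod q, j mod q)"
  by (simp add: hblk_def)

lemma hblk_mult_carrier [simp]: "hblk q s a r c *\<^sub>v X \<in> carrier_vec (r * q)"
  by (rule carrier_vecI) simp

text \<open>The bound states without subtraction that \<open>j\<close> is at most
  \<open>a + (r - 1) + (c - 1)\<close>, the largest index in the window.\<close>

lemma hblk_cong:
  assumes "\<And>j. j + 2 \<le> a + r + c \<Longrightarrow> s j = t j"
  shows "hblk q s a r c = hblk q t a r c"
proof (rule eq_matI)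
  fix i j assume "i < dim_row (hblk q t a r c)" "j < dim_col (hblk q t a r c)"
  then have ij: "i < r * q" "j < c * q" by auto
  then have "i div q < r" "j div q < c" by (auto simp: less_mult_imp_div_less)
  then have "s (a + i div q + j div q) = t (a + i div q + j div q)" by (intro assms) auto
  then show "hblk q s a r c $$ (i, j) = hblk q t a r c $$ (i, j)" using ij by (simp add: index_hblk)
qed auto

lemma hblk_adjoint:
  assumes herm: "\<And>j. j + 2 \<le> a + r + c \<Longrightarrow> s j \<in> carrier_mat q q \<and> mat_adjoint (s j) = s j"
  shows "mat_adjoint (hblk q s a r c) = hblk q s a c r"
proof (rule eq_matI)
  fix i j assume "i < dim_row (hblk q s a c r)" "j < dim_col (hblk q s a c r)"
  then have ij: "i < c * q" "j < r * q" by auto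
  then have q: "q > 0" by (cases q) auto
  have "i div q < c" "j div q < r" using ij by (auto simp: less_mult_imp_div_less)
  then have h: "s (a + j div q + i div q) \<in> carrier_mat q q"
    "mat_adjoint (s (a + j div q + i div q)) = s (a + j div q + i div q)"
    using herm[of "a + j div q + i div q"] by auto
  have "cnj (s (a + j div q + i div q) $$ (j mod q, i mod q)) = s (a + j div q + i div q) $$ (i mod q, j mod q)"
    using index_mat_adjoint[of "i mod q" "s (a + j div q + i div q)" "j mod q"] h q by simp
  then show "mat_adjoint (hblk q s a r c) $$ (i, j) = hblk q s a c r $$ (i, j)"
    using ij by (simp add: index_hblk ac_simps)
qed auto

lemma hblk_rows:
  assumes X: "X \<in> carrier_vec (c * q)"
  shows "hblk q s a (r + k) c *\<^sub>v X = (hblk q s a r c *\<^sub>v X) @\<^sub>v (hblk q s (a + r) k c *\<^sub>v X)"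
proof (rule eq_vecI)
  fix i assume "i < dim_vec ((hblk q s a r c *\<^sub>v X) @\<^sub>v (hblk q s (a + r) k c *\<^sub>v X))"
  then have i: "i < r * q + k * q" by simp
  have c: "(hblk q s b l c *\<^sub>v X) $ m = (\<Sum>j<c*q. s (b + m div q + j div q) $$ (m mod q, j mod q) * X $ j)"
    if "m < l * q" for b l m
    unfolding index_mult_mat_vec_sum[OF hblk_carrier X that] using that by (intro sum.cong) (auto simp: index_hblk)
  show "(hblk q s a (r + k) c *\<^sub>v X) $ i = ((hblk q s a r c *\<^sub>v X) @\<^sub>v (hblk q s (a + r) k c *\<^sub>v X)) $ i"
  proof (cases "i < r * q")
    case True
    then show ?thesis using i by (simp add: c add_mult_distrib del: index_mult_mat_vec)
  next
    case False
    then obtain l where l: "i = l + r * q" using le_Suc_ex[of "r * q" i] by (auto simp: add.commute)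
    then have lk: "l < k * q" using i by simp
    then have q: "q > 0" by (cases q) auto
    have "i < (r + k) * q" using i by (simp add: add_mult_distrib)
    then have "(hblk q s a (r + k) c *\<^sub>v X) $ i = (hblk q s (a + r) k c *\<^sub>v X) $ l"
      unfolding c[OF \<open>i < (r + k) * q\<close>] c[OF lk] using q by (simp add: l ac_simps)
    then show ?thesis using l lk by (simp del: index_mult_mat_vec)
  qed
qed (simp add: add_mult_distrib)

lemma hblk_cols:
  assumes X: "X \<in> carrier_vec (c * q)" and Y: "Y \<in> carrier_vec (k * q)"
  shows "hblk q s a r (c + k) *\<^sub>v (X @\<^sub>v Y) = hblk q s a r c *\<^sub>v X + hblk q s (a + c) r k *\<^sub>v Y"
proof (rule eq_vecI)
  fix i assume "i < dim_vec (hblk q s a r c *\<^sub>v X + hblk q s (a + c) r k *\<^sub>v Y)"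
  then have i: "i < r * q" by simp
  have XY: "X @\<^sub>v Y \<in> carrier_vec ((c + k) * q)" using X Y by (simp add: add_mult_distrib)
  have dX: "dim_vec X = c * q" and dY: "dim_vec Y = k * q" using X Y by auto
  let ?f = "\<lambda>j. s (a + i div q + j div q) $$ (i mod q, j mod q)"
  have "(hblk q s a r (c + k) *\<^sub>v (X @\<^sub>v Y)) $ i = (\<Sum>j<c*q + k*q. ?f j * (X @\<^sub>v Y) $ j)"
    unfolding index_mult_mat_vec_sum[OF hblk_carrier XY i]
    using i by (intro sum.cong) (auto simp: index_hblk add_mult_distrib)
  also have "\<dots> = (\<Sum>j<c*q. ?f j * (X @\<^sub>v Y) $ j) + (\<Sum>j<k*q. ?f (c*q + j) * (X @\<^sub>v Y) $ (c*q + j))"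
    by (rule sum_lessThan_add)
  also have "(\<Sum>j<c*q. ?f j * (X @\<^sub>v Y) $ j) = (hblk q s a r c *\<^sub>v X) $ i"
    unfolding index_mult_mat_vec_sum[OF hblk_carrier X i]
    using i dX dY by (intro sum.cong) (auto simp: index_hblk)
  also have "(\<Sum>j<k*q. ?f (c*q + j) * (X @\<^sub>v Y) $ (c*q + j)) = (hblk q s (a + c) r k *\<^sub>v Y) $ i"
    unfolding index_mult_mat_vec_sum[OF hblk_carrier Y i]
  proof (intro sum.cong refl)
    fix j assume j: "j \<in> {..<k*q}"
    then have q: "q > 0" by (cases q) auto
    then show "?f (c*q + j) * (X @\<^sub>v Y) $ (c*q + j) = hblk q s (a + c) r k $$ (i, j) * Y $ j"
      using i j dX dY by (simp add: index_hblk ac_simps)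
  qed
  finally show "(hblk q s a r (c + k) *\<^sub>v (X @\<^sub>v Y)) $ i =
      (hblk q s a r c *\<^sub>v X + hblk q s (a + c) r k *\<^sub>v Y) $ i" using i by (simp del: index_mult_mat_vec)
qed simp

lemma hblk_four_block:
  assumes s: "s (2 * n) \<in> carrier_mat q q"
  shows "hblk q s 0 (n + 1) (n + 1) =
    four_block_mat (hblk q s 0 n n) (hblk q s n n 1) (hblk q s n 1 n) (s (2 * n))" (is "_ = ?F")
proof (rule eq_matI)
  fix i j assume "i < dim_row ?F" "j < dim_col ?F"
  then have i: "i < n * q + q" and j: "j < n * q + q" using s by auto
  then have q: "q > 0" by (cases q) auto
  have ij: "i < (n + 1) * q" "j < (n + 1) * q" using i j by auto
  have d: "k div q = n" "k mod q = k - n * q" "k - n * q < q"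
    if k: "k < n * q + q" "\<not> k < n * q" for k
  proof -
    obtain l where "k = l + n * q" using k(2) le_Suc_ex[of "n * q" k] by (auto simp: add.commute)
    with k q show "k div q = n" "k mod q = k - n * q" "k - n * q < q" by auto
  qed
  show "hblk q s 0 (n + 1) (n + 1) $$ (i, j) = ?F $$ (i, j)"
    using i j s d[OF i] d[OF j] unfolding index_hblk[OF ij]
    by (cases "i < n * q"; cases "j < n * q") (auto simp: index_hblk ac_simps mult_2)
qed (use s in auto)

lemma block_hankel_hblk: "block_hankel q s n = hblk q s 0 (n + 1) (n + 1)"
  by (simp add: block_hankel_def hblk_def)

text \<open>For \<open>n = 0\<close> the product runs over an empty index range and is zero, in
  agreement with the separate clause of \<open>Theta\<close>.\<close>

lemma Theta_hblk:
  assumes "hblk q s 0 n n \<in> psd_mats (n * q)"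
  shows "Theta q s n = hblk q s n 1 n * pinv (hblk q s 0 n n) * hblk q s n n 1"
proof (cases "n = 0")
  case True
  have "pinv (hblk q s 0 n n) \<in> carrier_mat (n * q) (n * q)"
    using hermitian_pinv(1)[OF psd_matsD(1,2)[OF assms]] .
  then show ?thesis
    using True by (auto simp: Theta_def scalar_prod_def intro!: eq_matI)
next
  case False
  have "block_column q s n = hblk q s n n 1" "block_row q s n = hblk q s n 1 n"
    by (auto simp: block_column_def block_row_def hblk_def intro!: cong_mat)
  with False show ?thesis by (simp add: Theta_def block_hankel_hblk)
qed


section \<open>Hermitian entries, null vectors and the block shift\<close>

lemma block_index_less: "k < r \<Longrightarrow> i < q \<Longrightarrow> k * q + i < r * (q :: nat)"
  using mult_right_mono[of "k + 1" r q] by simp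

lemma index_hblk_block:
  assumes "k < r" "l < c" "i < q" "j < q"
  shows "hblk q s a r c $$ (k * q + i, l * q + j) = s (a + k + l) $$ (i, j)"
  using assms by (simp add: index_hblk block_index_less)

lemma hankel_entry_hermitian:
  assumes H: "hblk q s 0 (n + 1) (n + 1) \<in> psd_mats ((n + 1) * q)"
    and s: "s j \<in> carrier_mat q q" and j: "j \<le> 2 * n"
  shows "mat_adjoint (s j) = s j"
proof (rule eq_matI)
  fix a b assume "a < dim_row (s j)" "b < dim_col (s j)"
  then have ab: "a < q" "b < q" using s by auto
  \<comment> \<open>A block position in H_n that carries \<open>s j\<close>: both coordinates are at
    most \<open>n\<close>. The transposed position carries the same entry, so symmetry of H_n
    becomes symmetry of \<open>s j\<close>.\<close>
  define k l where "k = min j n" and "l = j - k"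
  have kl: "k < n + 1" "l < n + 1" "k + l = j" using j by (auto simp: k_def l_def)
  note 1 = index_hblk_block[OF kl(1,2) ab, of s 0] and 2 = index_hblk_block[OF kl(2,1) ab(2,1), of s 0]
  have "mat_adjoint (hblk q s 0 (n + 1) (n + 1)) $$ (k * q + a, l * q + b) =
      cnj (hblk q s 0 (n + 1) (n + 1) $$ (l * q + b, k * q + a))"
    using block_index_less[OF kl(1) ab(1)] block_index_less[OF kl(2) ab(2)]
    by (intro index_mat_adjoint) auto
  then have "s j $$ (a, b) = cnj (s j $$ (b, a))"
    unfolding psd_matsD(2)[OF H] 1 2 using kl(3) by (simp add: add.commute)
  then show "mat_adjoint (s j) $$ (a, b) = s j $$ (a, b)" using s ab by simp
qed (use s in auto)

text \<open>Padded with zeros, \<open>X\<close> gives the large matrix the same vanishing form as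
  the leading block, so all further block rows annihilate it too.\<close>

lemma hankel_leading_null:
  assumes H: "hblk q s 0 (n + k) (n + k) \<in> psd_mats ((n + k) * q)"
    and X: "X \<in> carrier_vec (n * q)" and null: "hblk q s 0 n n *\<^sub>v X = 0\<^sub>v (n * q)"
  shows "hblk q s 0 (n + k) n *\<^sub>v X = 0\<^sub>v ((n + k) * q)"
proof -
  let ?Z = "X @\<^sub>v 0\<^sub>v (k * q)"
  have Z: "?Z \<in> carrier_vec ((n + k) * q)" using X by (simp add: add_mult_distrib)
  have HZ: "hblk q s 0 (n + k) (n + k) *\<^sub>v ?Z = hblk q s 0 (n + k) n *\<^sub>v X"
    unfolding hblk_cols[OF X zero_carrier_vec] mult_mat_vec_zero[OF hblk_carrier]
    by (rule right_zero_vec[OF hblk_mult_carrier])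
  have "(hblk q s 0 (n + k) (n + k) *\<^sub>v ?Z) \<bullet>c ?Z = 0"
    unfolding HZ hblk_rows[OF X] null
    using X by (subst cscalar_prod_append[of _ "n * q" _ "k * q"]) auto
  from psd_null_vector[OF H Z this] show ?thesis by (simp only: HZ)
qed

text \<open>The first window is H_(n-1). The second one is H_n without its first block column, so
  its product with \<open>X\<close> is H_n applied to (0, X), and indices beyond
  \<open>2 * n\<close> do not occur.\<close>

definition shift_null :: "nat \<Rightarrow> (nat \<Rightarrow> complex mat) \<Rightarrow> nat \<Rightarrow> bool" where
  "shift_null q s n \<longleftrightarrow> (\<forall>X\<in>carrier_vec (n * q).
     hblk q s 0 n n *\<^sub>v X = 0\<^sub>v (n * q) \<longrightarrow> hblk q s 1 (n + 1) n *\<^sub>v X = 0\<^sub>v ((n + 1) * q))"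

text \<open>In H_(n+1) the null vector is annihilated by all block rows; without the first of them
  these rows form the window with offset 1.\<close>

lemma shift_null_if_extension:
  assumes H: "hblk q s 0 (n + 2) (n + 2) \<in> psd_mats ((n + 2) * q)"
  shows "shift_null q s n"
  unfolding shift_null_def
proof (intro ballI impI)
  fix X :: "complex vec" assume X: "X \<in> carrier_vec (n * q)" and null: "hblk q s 0 n n *\<^sub>v X = 0\<^sub>v (n * q)"
  have "hblk q s 0 (1 + (n + 1)) n *\<^sub>v X = 0\<^sub>v ((n + 2) * q)"
    using hankel_leading_null[OF H X null] by simp
  then have "(hblk q s 0 1 n *\<^sub>v X) @\<^sub>v (hblk q s (0 + 1) (n + 1) n *\<^sub>v X) = 0\<^sub>v (1 * q + (n + 1) * q)"
    unfolding hblk_rows[OF X] by (simp add: algebra_simps)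
  then show "hblk q s 1 (n + 1) n *\<^sub>v X = 0\<^sub>v ((n + 1) * q)"
    unfolding append_eq_zero_iff[OF hblk_mult_carrier hblk_mult_carrier] by simp
qed

text \<open>With \<open>R = \<surd>H\<^sub>n\<close>, the block shift on the columns of \<open>R\<close> extends to a Hermitian matrix
  \<open>M\<close>, so that the block columns of \<open>R\<close> are \<open>M\<^sup>k R\<^sub>0\<close> and \<open>s\<^sub>j = R\<^sub>0\<^sup>* M\<^sup>j R\<^sub>0\<close>; the numbers \<open>d i\<close> are the
  eigenvalues of \<open>M\<close>.\<close>
lemma moment_representation:
  assumes H: "hblk q s 0 (n + 1) (n + 1) \<in> psd_mats ((n + 1) * q)"
    and s: "\<forall>j\<le>2 * n. s j \<in> carrier_mat q q"
    and sn: "shift_null q s n"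
  obtains N :: nat and C d where "\<And>j a b. j \<le> 2 * n \<Longrightarrow> a < q \<Longrightarrow> b < q \<Longrightarrow>
    s j $$ (a, b) = (\<Sum>i<N. cnj (C i a) * complex_of_real (d i) ^ j * C i b)"
proof -
  let ?H = "hblk q s 0 (n + 1) (n + 1)"
  define N where "N = (n + 1) * q"
  have H: "?H \<in> psd_mats N" using assms(1) by (simp only: N_def)
  have herm: "mat_adjoint (s j) = s j" if "j \<le> 2 * n" for j
    using hankel_entry_hermitian[OF assms(1) s[rule_format, OF that] that] .
  define R where "R = psd_sqrt N ?H"
  have Rp: "R \<in> psd_mats N" and RR: "R * R = ?H" using psd_sqrt[OF H] by (simp_all add: R_def)
  note R = psd_matsD(1,2)[OF Rp]
  have RRe: "(\<Sum>k<N. cnj (R $$ (k, i)) * R $$ (k, j)) = ?H $$ (i, j)" if ij: "i < N" "j < N" for i j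
  proof -
    have "(\<Sum>k<N. cnj (R $$ (k, i)) * R $$ (k, j)) = (mat_adjoint R * R) $$ (i, j)"
      unfolding index_mult_mat_sum[OF mat_adjoint_carrier[OF R(1)] R(1) ij]
      using R(1) ij by (intro sum.cong) auto
    then show ?thesis by (simp only: R RR)
  qed
  \<comment> \<open>\<open>X\<close> holds the first \<open>n\<close> block columns of
    \<open>R\<close> and \<open>Y\<close> the last \<open>n\<close>; the block shift sends the
    columns of \<open>X\<close> to those of \<open>Y\<close>. The Gram products of \<open>X\<close>
    and \<open>Y\<close> are the windows with offsets 0, 1 and 2.\<close>
  define X where "X = mat N (n * q) (\<lambda>(i, j). R $$ (i, j))"
  define Y where "Y = mat N (n * q) (\<lambda>(i, j). R $$ (i, q + j))"
  have X: "X \<in> carrier_mat N (n * q)" and Y: "Y \<in> carrier_mat N (n * q)" by (auto simp: X_def Y_def)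
  note Xa = mat_adjoint_carrier[OF X] and Ya = mat_adjoint_carrier[OF Y]
  have nN: "j < N" "q + j < N" if "j < n * q" for j using that by (auto simp: N_def)
  have He: "?H $$ (i, j) = s (i div q + j div q) $$ (i mod q, j mod q)" if "i < N" "j < N" for i j
    using that by (simp add: index_hblk N_def)
  have XX: "mat_adjoint X * X = hblk q s 0 n n"
  proof (rule eq_matI)
    fix i j assume "i < dim_row (hblk q s 0 n n)" "j < dim_col (hblk q s 0 n n)"
    then have ij: "i < n * q" "j < n * q" by auto
    have "(mat_adjoint X * X) $$ (i, j) = (\<Sum>k<N. cnj (R $$ (k, i)) * R $$ (k, j))"
      unfolding index_mult_mat_sum[OF Xa X ij] using ij X nN by (intro sum.cong) (auto simp: X_def)
    then show "(mat_adjoint X * X) $$ (i, j) = hblk q s 0 n n $$ (i, j)"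
      using ij nN by (simp add: RRe He index_hblk)
  qed (use X in auto)
  have XY: "mat_adjoint X * Y = hblk q s 1 n n"
  proof (rule eq_matI)
    fix i j assume "i < dim_row (hblk q s 1 n n)" "j < dim_col (hblk q s 1 n n)"
    then have ij: "i < n * q" "j < n * q" by auto
    then have q: "q > 0" by (cases q) auto
    have "(mat_adjoint X * Y) $$ (i, j) = (\<Sum>k<N. cnj (R $$ (k, i)) * R $$ (k, q + j))"
      unfolding index_mult_mat_sum[OF Xa Y ij] using ij X nN by (intro sum.cong) (auto simp: X_def Y_def)
    then show "(mat_adjoint X * Y) $$ (i, j) = hblk q s 1 n n $$ (i, j)"
      using ij nN q by (simp add: RRe He index_hblk)
  qed (use X Y in auto)
  have YY: "mat_adjoint Y * Y = hblk q s 2 n n"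
  proof (rule eq_matI)
    fix i j assume "i < dim_row (hblk q s 2 n n)" "j < dim_col (hblk q s 2 n n)"
    then have ij: "i < n * q" "j < n * q" by auto
    then have q: "q > 0" by (cases q) auto
    have "(mat_adjoint Y * Y) $$ (i, j) = (\<Sum>k<N. cnj (R $$ (k, q + i)) * R $$ (k, q + j))"
      unfolding index_mult_mat_sum[OF Ya Y ij] using ij Y nN by (intro sum.cong) (auto simp: Y_def)
    then show "(mat_adjoint Y * Y) $$ (i, j) = hblk q s 2 n n $$ (i, j)"
      using ij nN q by (simp add: RRe He index_hblk)
  qed (use Y in auto)
  have sym: "mat_adjoint (mat_adjoint X * Y) = mat_adjoint X * Y"
    unfolding XY using herm s by (intro hblk_adjoint) auto
  \<comment> \<open>The Gram matrix of \<open>Y\<close> is the window with offset 2, which is the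
    part of the window in \<open>shift_null\<close> below its first block row. So shift-nullity is
    precisely what makes the shift well defined on the range of \<open>X\<close>.\<close>
  have ker: "Y *\<^sub>v v = 0\<^sub>v N" if v: "v \<in> carrier_vec (n * q)" and Xv: "X *\<^sub>v v = 0\<^sub>v N" for v
  proof -
    have "hblk q s 0 n n *\<^sub>v v = 0\<^sub>v (n * q)"
      unfolding XX[symmetric] assoc_mult_mat_vec[OF Xa X v] Xv by (rule mult_mat_vec_zero[OF Xa])
    then have "hblk q s 1 (1 + n) n *\<^sub>v v = 0\<^sub>v (1 * q + n * q)"
      using sn v by (auto simp: shift_null_def)
    then have "hblk q s 2 n n *\<^sub>v v = 0\<^sub>v (n * q)"
      unfolding hblk_rows[OF v] append_eq_zero_iff[OF hblk_mult_carrier hblk_mult_carrier]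
      by (simp add: numeral_2_eq_2)
    then have "vnorm2 (Y *\<^sub>v v) = 0"
      using gram_quadratic[OF Y v] zero_cscalar_prod[OF v] unfolding YY by simp
    then show ?thesis using vnorm2_eq_0[of "Y *\<^sub>v v" N] mult_mat_vec_carrier[OF Y v] by simp
  qed
  obtain M where M: "M \<in> carrier_mat N N" "mat_adjoint M = M" and MX: "M * X = Y"
    using hermitian_extension[OF X Y sym ker] by blast
  obtain U d where U: "U \<in> carrier_mat N N" "mat_adjoint U * U = 1\<^sub>m N" "U * mat_adjoint U = 1\<^sub>m N"
    and MU: "M = U * real_diag N d * mat_adjoint U"
    using hermitian_spectral[OF M] by blast
  note Ua = mat_adjoint_carrier[OF U(1)]
  have UD: "U * real_diag N d \<in> carrier_mat N N" using U by auto
  have UX: "mat_adjoint U * X \<in> carrier_mat N (n * q)" using Ua X by auto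
  have "mat_adjoint U * Y = mat_adjoint U * (U * (real_diag N d * (mat_adjoint U * X)))"
    unfolding MX[symmetric] MU assoc_mult_mat[OF UD Ua X] assoc_mult_mat[OF U(1) real_diag_carrier UX] ..
  also have "\<dots> = real_diag N d * (mat_adjoint U * X)"
    unfolding assoc_mult_mat[OF Ua U(1) mult_carrier_mat[OF real_diag_carrier UX], symmetric] U(2)
    by (rule left_mult_one_mat) (rule mult_carrier_mat[OF real_diag_carrier UX])
  finally have UY: "mat_adjoint U * Y = real_diag N d * (mat_adjoint U * X)" .
  \<comment> \<open>In the eigenbasis of \<open>M\<close> the block shift of the columns is
    multiplication of row \<open>i\<close> by \<open>d i\<close>.\<close>
  define T where "T = mat_adjoint U * R"
  have T: "T \<in> carrier_mat N N" using Ua R by (auto simp: T_def)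
  have TX: "(mat_adjoint U * X) $$ (i, j) = T $$ (i, j)" if "i < N" "j < n * q" for i j
    unfolding T_def index_mult_mat_sum[OF Ua X that] index_mult_mat_sum[OF Ua R(1) that(1) nN(1)[OF that(2)]]
    using that by (intro sum.cong) (auto simp: X_def)
  have TY: "(mat_adjoint U * Y) $$ (i, j) = T $$ (i, q + j)" if "i < N" "j < n * q" for i j
    unfolding T_def index_mult_mat_sum[OF Ua Y that] index_mult_mat_sum[OF Ua R(1) that(1) nN(2)[OF that(2)]]
    using that by (intro sum.cong) (auto simp: Y_def)
  have step: "T $$ (i, q + j) = complex_of_real (d i) * T $$ (i, j)" if ij: "i < N" "j < n * q" for i j
  proof -
    have "T $$ (i, q + j) = (\<Sum>k<N. real_diag N d $$ (i, k) * (mat_adjoint U * X) $$ (k, j))"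
      unfolding TY[OF ij, symmetric] UY by (rule index_mult_mat_sum[OF real_diag_carrier UX ij])
    also have "\<dots> = (\<Sum>k<N. if k = i then complex_of_real (d i) * T $$ (i, j) else 0)"
      using ij TX by (intro sum.cong) auto
    finally show ?thesis using ij by simp
  qed
  have pow: "T $$ (i, k * q + a) = complex_of_real (d i) ^ k * T $$ (i, a)"
    if "i < N" "a < q" "k \<le> n" for i a k
    using that(3)
  proof (induction k)
    case (Suc k)
    then have "k * q + a < n * q" using block_index_less that(2) by simp
    with step[OF that(1), of "k * q + a"] Suc show ?case by (simp add: ac_simps)
  qed simp
  have TT: "mat_adjoint T * T = ?H"
  proof -
    have "mat_adjoint T = R * U"
      unfolding T_def mat_adjoint_mult[OF Ua R(1)] R mat_adjoint_adjoint ..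
    then have "mat_adjoint T * T = R * (U * (mat_adjoint U * R))"
      unfolding T_def by (simp only: assoc_mult_mat[OF R(1) U(1) mult_carrier_mat[OF Ua R(1)]])
    also have "\<dots> = R * R"
      unfolding assoc_mult_mat[OF U(1) Ua R(1), symmetric] U(3) left_mult_one_mat[OF R(1)] ..
    finally show ?thesis by (simp only: RR)
  qed
  show ?thesis
  proof (rule that[where N = N and C = "\<lambda>i a. T $$ (i, a)" and d = d])
    fix j a b assume j: "j \<le> 2 * n" and ab: "a < q" "b < q"
    define k l where "k = min j n" and "l = j - k"
    have kl: "k < n + 1" "l < n + 1" "k + l = j" using j by (auto simp: k_def l_def)
    note 1 = index_hblk_block[OF kl(1,2) ab, of s 0]
    have b: "k * q + a < N" "l * q + b < N"
      unfolding N_def using kl ab by (intro block_index_less; simp)+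
    have "s j $$ (a, b) = (mat_adjoint T * T) $$ (k * q + a, l * q + b)"
      unfolding TT 1 using kl by simp
    also have "\<dots> = (\<Sum>i<N. cnj (T $$ (i, k * q + a)) * T $$ (i, l * q + b))"
      unfolding index_mult_mat_sum[OF mat_adjoint_carrier[OF T] T b] using T b by (intro sum.cong) auto
    also have "\<dots> = (\<Sum>i<N. cnj (T $$ (i, a)) * complex_of_real (d i) ^ j * T $$ (i, b))"
    proof (intro sum.cong refl)
      fix i assume "i \<in> {..<N}"
      then show "cnj (T $$ (i, k * q + a)) * T $$ (i, l * q + b) =
          cnj (T $$ (i, a)) * complex_of_real (d i) ^ j * T $$ (i, b)"
        using pow[of i a k] pow[of i b l] kl ab by (simp add: power_add[symmetric] ac_simps)
    qed
    finally show "s j $$ (a, b) = (\<Sum>i<N. cnj (T $$ (i, a)) * complex_of_real (d i) ^ j * T $$ (i, b))" .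
  qed
qed

section \<open>The Schur complements of a block Hankel matrix\<close>

text \<open>The entries being Hermitian, the block row in \<open>Theta\<close> is the adjoint of the
  block column; so \<open>Lmat\<close> is the Schur complement of the corner
  \<open>s (2 * n)\<close> in H_n.\<close>

lemma hankel_schur:
  assumes H: "hblk q s 0 (n + 1) (n + 1) \<in> psd_mats ((n + 1) * q)"
    and s: "\<forall>j\<le>2 * n. s j \<in> carrier_mat q q"
  shows "hblk q s 0 n n \<in> psd_mats (n * q)"
    "hblk q s 0 n n * pinv (hblk q s 0 n n) * hblk q s n n 1 = hblk q s n n 1"
    "Lmat q s n \<in> psd_mats q"
    "\<And>u x. u \<in> carrier_vec (n * q) \<Longrightarrow> x \<in> carrier_vec q \<Longrightarrow>
      hblk q s 0 (n + 1) (n + 1) *\<^sub>v (u @\<^sub>v x) = 0\<^sub>v ((n + 1) * q) \<longleftrightarrow>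
      hblk q s 0 n n *\<^sub>v u + hblk q s n n 1 *\<^sub>v x = 0\<^sub>v (n * q) \<and> Lmat q s n *\<^sub>v x = 0\<^sub>v q"
    "Theta q s n \<in> carrier_mat q q" "mat_adjoint (Theta q s n) = Theta q s n"
proof -
  have herm: "s j \<in> carrier_mat q q \<and> mat_adjoint (s j) = s j" if "j \<le> 2 * n" for j
    using hankel_entry_hermitian[OF H s[rule_format, OF that] that] s[rule_format, OF that] by simp
  let ?A = "hblk q s 0 n n" and ?B = "hblk q s n n 1"
  have A: "?A \<in> carrier_mat (n * q) (n * q)" "mat_adjoint ?A = ?A"
    using herm by (auto intro!: hblk_adjoint)
  have B: "?B \<in> carrier_mat (n * q) q" using hblk_carrier[of q s n n 1] by simp
  have Ba: "mat_adjoint ?B = hblk q s n 1 n" using herm by (intro hblk_adjoint) auto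
  have C: "s (2 * n) \<in> carrier_mat q q" "mat_adjoint (s (2 * n)) = s (2 * n)" using herm by auto
  have HF: "hblk q s 0 (n + 1) (n + 1) = four_block_mat ?A ?B (mat_adjoint ?B) (s (2 * n))"
    unfolding Ba using C(1) by (rule hblk_four_block)
  have eq: "(n + 1) * q = n * q + q" by simp
  have F: "four_block_mat ?A ?B (mat_adjoint ?B) (s (2 * n)) \<in> psd_mats (n * q + q)"
    using H unfolding HF eq .
  note d = schur_psdD[OF A B C F]
  show "?A \<in> psd_mats (n * q)" "?A * pinv ?A * ?B = ?B" by (rule d)+
  have T: "Theta q s n = mat_adjoint ?B * pinv ?A * ?B"
    unfolding Theta_hblk[OF d(1)] Ba ..
  then have L: "Lmat q s n = s (2 * n) - mat_adjoint ?B * pinv ?A * ?B" by (simp add: Lmat_def)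
  show Lp: "Lmat q s n \<in> psd_mats q" unfolding L by (rule d(3))
  show "hblk q s 0 (n + 1) (n + 1) *\<^sub>v (u @\<^sub>v x) = 0\<^sub>v ((n + 1) * q) \<longleftrightarrow>
      ?A *\<^sub>v u + ?B *\<^sub>v x = 0\<^sub>v (n * q) \<and> Lmat q s n *\<^sub>v x = 0\<^sub>v q"
    if "u \<in> carrier_vec (n * q)" "x \<in> carrier_vec q" for u x
    unfolding HF eq L by (rule schur_kernel_iff[OF A B C F that])
  show Tc: "Theta q s n \<in> carrier_mat q q"
    unfolding T using hermitian_pinv(1)[OF A] B by auto
  show "mat_adjoint (Theta q s n) = Theta q s n"
  proof -
    note X = hermitian_pinv(1,4)[OF A] and Bac = mat_adjoint_carrier[OF B]
    show ?thesis
      unfolding T mat_adjoint_mult[OF mult_carrier_mat[OF Bac X(1)] B] mat_adjoint_mult[OF Bac X(1)] X(2) mat_adjoint_adjoint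
      by (rule assoc_mult_mat[OF Bac X(1) B, symmetric])
  qed
qed

text \<open>The block row and column end with index \<open>2 * n - 1\<close>, and H_(n-1) ends with
  \<open>2 * n - 2\<close>. Hence a change of the last entry of a sequence moves only the Schur
  complement.\<close>

lemma Theta_cong:
  assumes "\<And>j. j < 2 * n \<Longrightarrow> s j = t j"
  shows "Theta q s n = Theta q t n"
proof (cases "n = 0")
  case False
  have "block_row q s n = block_row q t n"
    unfolding block_row_def
  proof (rule cong_mat; clarsimp)
    fix j assume "j < n * q"
    then have "j div q < n" by (simp add: less_mult_imp_div_less)
    then show "s (n + j div q) $$ (i, j mod q) = t (n + j div q) $$ (i, j mod q)" for i
      using assms[of "n + j div q"] by simp
  qed
  moreover have "block_column q s n = block_column q t n"
    unfolding block_column_def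
  proof (rule cong_mat; clarsimp)
    fix j assume "j < n * q"
    then have "j div q < n" by (simp add: less_mult_imp_div_less)
    then show "s (n + j div q) $$ (j mod q, i) = t (n + j div q) $$ (j mod q, i)" for i
      using assms[of "n + j div q"] by simp
  qed
  moreover have "block_hankel q s (n - 1) = block_hankel q t (n - 1)"
    unfolding block_hankel_hblk using False by (intro hblk_cong assms) auto
  ultimately show ?thesis by (simp add: Theta_def)
qed (simp add: Theta_def)

text \<open>The leading block and the range condition do not involve the last entry and are
  inherited from \<open>s\<close>; the Schur criterion then admits every non-negative Hermitian
  complement.\<close>

lemma hankel_replace_last:
  assumes H: "hblk q s 0 (n + 1) (n + 1) \<in> psd_mats ((n + 1) * q)"
    and s: "\<forall>j\<le>2 * n. s j \<in> carrier_mat q q"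
    and L: "L \<in> psd_mats q"
  shows "hblk q (s(2 * n := Theta q s n + L)) 0 (n + 1) (n + 1) \<in> psd_mats ((n + 1) * q)"
    "Lmat q (s(2 * n := Theta q s n + L)) n = L"
proof -
  let ?t = "s(2 * n := Theta q s n + L)"
  note h = hankel_schur[OF H s]
  note Lc = psd_matsD(1,2)[OF L]
  have herm: "s j \<in> carrier_mat q q \<and> mat_adjoint (s j) = s j" if "j \<le> 2 * n" for j
    using hankel_entry_hermitian[OF H s[rule_format, OF that] that] s[rule_format, OF that] by simp
  let ?A = "hblk q s 0 n n" and ?B = "hblk q s n n 1"
  have A: "?A \<in> carrier_mat (n * q) (n * q)" "mat_adjoint ?A = ?A"
    using herm by (auto intro!: hblk_adjoint)
  have B: "?B \<in> carrier_mat (n * q) q" using hblk_carrier[of q s n n 1] by simp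
  have Ba: "mat_adjoint ?B = hblk q s n 1 n" using herm by (intro hblk_adjoint) auto
  have C: "Theta q s n + L \<in> carrier_mat q q" "mat_adjoint (Theta q s n + L) = Theta q s n + L"
    using h(5,6) Lc by (auto simp: mat_adjoint_plus[of _ q q])
  have T: "Theta q s n = mat_adjoint ?B * pinv ?A * ?B"
    unfolding Theta_hblk[OF h(1)] Ba ..
  have TL: "(Theta q s n + L) - Theta q s n = L"
    using h(5) Lc by (intro eq_matI) auto
  have "four_block_mat ?A ?B (mat_adjoint ?B) (Theta q s n + L) \<in> psd_mats (n * q + q)"
    using schur_psdI[OF A B C h(1,2)] L unfolding T[symmetric] TL by blast
  moreover have "hblk q ?t 0 (n + 1) (n + 1) =
      four_block_mat (hblk q ?t 0 n n) (hblk q ?t n n 1) (hblk q ?t n 1 n) (?t (2 * n))"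
    using C by (intro hblk_four_block) simp
  moreover have "hblk q ?t 0 n n = ?A" "hblk q ?t n n 1 = ?B" "hblk q ?t n 1 n = mat_adjoint ?B"
    unfolding Ba by (rule hblk_cong; simp)+
  ultimately show "hblk q ?t 0 (n + 1) (n + 1) \<in> psd_mats ((n + 1) * q)"
    by (simp add: add.commute)
  have "Theta q ?t n = Theta q s n" by (rule Theta_cong) simp
  then show "Lmat q ?t n = L" by (simp add: Lmat_def TL)
qed

lemma hblk_shift:
  assumes X: "X \<in> carrier_vec (n * q)"
  shows "hblk q s 0 (n + 1) (n + 1) *\<^sub>v (0\<^sub>v q @\<^sub>v X) = hblk q s 1 (n + 1) n *\<^sub>v X"
proof -
  have z: "0\<^sub>v q \<in> carrier_vec (1 * q)" by simp
  have "hblk q s 0 (n + 1) (1 + n) *\<^sub>v (0\<^sub>v q @\<^sub>v X) =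
      hblk q s 0 (n + 1) 1 *\<^sub>v 0\<^sub>v (1 * q) + hblk q s (0 + 1) (n + 1) n *\<^sub>v X"
    using hblk_cols[OF z X] by simp
  also have "\<dots> = hblk q s 1 (n + 1) n *\<^sub>v X"
    unfolding mult_mat_vec_zero[OF hblk_carrier]
    using left_zero_vec[OF hblk_mult_carrier[of q s 1 "n + 1" n X]] by simp
  finally show ?thesis by (simp only: add.commute[of 1])
qed

text \<open>A null vector (u, x) of H_n has L_n x = 0, and every such x occurs. Its shift (0, u, x)
  is null for H_(n+1) exactly if L_(n+1) x = 0, since all other conditions follow from the Hankel
  structure.\<close>

lemma shift_null_iff_Lmat_kernel:
  assumes H: "hblk q s 0 (n + 2) (n + 2) \<in> psd_mats ((n + 2) * q)"
    and s: "\<forall>j\<le>2 * (n + 1). s j \<in> carrier_mat q q"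
  shows "shift_null q s (n + 1) \<longleftrightarrow>
    (\<forall>x\<in>carrier_vec q. Lmat q s n *\<^sub>v x = 0\<^sub>v q \<longrightarrow> Lmat q s (n + 1) *\<^sub>v x = 0\<^sub>v q)"
proof -
  have e: "n + 2 = (n + 1) + 1" by simp
  have H': "hblk q s 0 ((n + 1) + 1) ((n + 1) + 1) \<in> psd_mats (((n + 1) + 1) * q)" using H unfolding e .
  note h1 = hankel_schur[OF H' s]
  have s': "\<forall>j\<le>2 * n. s j \<in> carrier_mat q q" using s by auto
  note h0 = hankel_schur[OF h1(1) s']
  note shift = hblk_shift[of _ "n + 1" q s]
  show ?thesis
  proof (intro iffI ballI impI)
    fix x :: "complex vec"
    assume sn: "shift_null q s (n + 1)" and x: "x \<in> carrier_vec q" and Lx: "Lmat q s n *\<^sub>v x = 0\<^sub>v q"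
    let ?A = "hblk q s 0 n n" and ?B = "hblk q s n n 1"
    note p = hermitian_pinv[OF psd_matsD(1,2)[OF h0(1)]]
    have B: "?B \<in> carrier_mat (n * q) q" using hblk_carrier[of q s n n 1] by simp
    have A: "?A \<in> carrier_mat (n * q) (n * q)" by simp
    \<comment> \<open>The range condition makes (-y, x) a null vector of H_n above the given
      \<open>x\<close>.\<close>
    define y where "y = pinv ?A *\<^sub>v (?B *\<^sub>v x)"
    have Bx: "?B *\<^sub>v x \<in> carrier_vec (n * q)" using B x by auto
    have y: "y \<in> carrier_vec (n * q)" using p(1) Bx by (auto simp: y_def)
    have Ay: "?A *\<^sub>v y = ?B *\<^sub>v x"
      unfolding y_def assoc_mult_mat_vec[OF A p(1) Bx, symmetric]
        assoc_mult_mat_vec[OF mult_carrier_mat[OF A p(1)] B x, symmetric] h0(2) ..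
    have uy: "- y \<in> carrier_vec (n * q)" using y by auto
    have "?A *\<^sub>v (- y) = - (?B *\<^sub>v x)"
    proof -
      have "- y = 0\<^sub>v (n * q) - y" using y by (intro eq_vecI) auto
      then have "?A *\<^sub>v (- y) = ?A *\<^sub>v 0\<^sub>v (n * q) - ?A *\<^sub>v y"
        using mult_minus_distrib_mat_vec[OF A zero_carrier_vec y] by simp
      also have "\<dots> = - (?B *\<^sub>v x)"
        unfolding mult_mat_vec_zero[OF A] Ay using Bx carrier_vecD[OF Bx] by (intro eq_vecI) auto
      finally show ?thesis .
    qed
    then have "?A *\<^sub>v (- y) + ?B *\<^sub>v x = 0\<^sub>v (n * q)" using Bx by (simp add: uminus_l_inv_vec)
    then have "hblk q s 0 (n + 1) (n + 1) *\<^sub>v ((- y) @\<^sub>v x) = 0\<^sub>v ((n + 1) * q)"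
      unfolding h0(4)[OF uy x] using Lx by simp
    moreover have X: "(- y) @\<^sub>v x \<in> carrier_vec ((n + 1) * q)" using carrier_vecD[OF y] carrier_vecD[OF x] by (intro carrier_vecI) simp
    ultimately have "hblk q s 1 (n + 1 + 1) (n + 1) *\<^sub>v ((- y) @\<^sub>v x) = 0\<^sub>v ((n + 1 + 1) * q)"
      using sn by (auto simp: shift_null_def)
    then have "hblk q s 0 (n + 1 + 1) (n + 1 + 1) *\<^sub>v ((0\<^sub>v q @\<^sub>v (- y)) @\<^sub>v x) = 0\<^sub>v ((n + 1 + 1) * q)"
      unfolding append_vec_assoc shift[OF X] .
    moreover have "0\<^sub>v q @\<^sub>v (- y) \<in> carrier_vec ((n + 1) * q)" using y by simp
    ultimately show "Lmat q s (n + 1) *\<^sub>v x = 0\<^sub>v q" using h1(4)[OF _ x] by blast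
  next
    assume ker: "\<forall>x\<in>carrier_vec q. Lmat q s n *\<^sub>v x = 0\<^sub>v q \<longrightarrow> Lmat q s (n + 1) *\<^sub>v x = 0\<^sub>v q"
    show "shift_null q s (n + 1)"
      unfolding shift_null_def
    proof (intro ballI impI)
      fix X :: "complex vec" assume X: "X \<in> carrier_vec ((n + 1) * q)"
        and null: "hblk q s 0 (n + 1) (n + 1) *\<^sub>v X = 0\<^sub>v ((n + 1) * q)"
      define u x where "u = vec_first X (n * q)" and "x = vec_last X q"
      have u: "u \<in> carrier_vec (n * q)" and x: "x \<in> carrier_vec q" and Xux: "X = u @\<^sub>v x"
        using X by (auto simp: u_def x_def vec_first_last_append add.commute)
      have "Lmat q s n *\<^sub>v x = 0\<^sub>v q" using null unfolding Xux h0(4)[OF u x] by simp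
      then have L: "Lmat q s (n + 1) *\<^sub>v x = 0\<^sub>v q" using ker x by blast
      \<comment> \<open>All block rows but the last of H_(n+1) (0, X) = 0 come for free: a null
        vector of H_n is annihilated by one further block row, and the shift drops the first. Only
        the last row uses \<open>ker\<close>.\<close>
      have "hblk q s 0 (1 + (n + 1)) (n + 1) *\<^sub>v X = 0\<^sub>v (1 * q + (n + 1) * q)"
        using hankel_leading_null[OF H' X null] by simp
      then have 1: "hblk q s 1 (n + 1) (n + 1) *\<^sub>v X = 0\<^sub>v ((n + 1) * q)"
        unfolding hblk_rows[OF X, of s 0 1 "n + 1"] append_eq_zero_iff[OF hblk_mult_carrier hblk_mult_carrier] by simp
      have u0: "0\<^sub>v q @\<^sub>v u \<in> carrier_vec ((n + 1) * q)" using u by simp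
      have x1: "x \<in> carrier_vec (1 * q)" using x by simp
      have z: "0\<^sub>v q \<in> carrier_vec (1 * q)" by simp
      have "hblk q s 0 (n + 1) (n + 1) *\<^sub>v (0\<^sub>v q @\<^sub>v u) + hblk q s (n + 1) (n + 1) 1 *\<^sub>v x =
          hblk q s 0 (n + 1) ((n + 1) + 1) *\<^sub>v ((0\<^sub>v q @\<^sub>v u) @\<^sub>v x)"
        using hblk_cols[OF u0 x1, of s 0 "n + 1"] by simp
      also have "\<dots> = hblk q s 0 (n + 1) (1 + (n + 1)) *\<^sub>v (0\<^sub>v q @\<^sub>v X)"
        unfolding append_vec_assoc Xux by (simp only: add.commute)
      also have "\<dots> = hblk q s 0 (n + 1) 1 *\<^sub>v 0\<^sub>v (1 * q) + hblk q s (0 + 1) (n + 1) (n + 1) *\<^sub>v X"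
        using hblk_cols[OF z X] by simp
      also have "\<dots> = 0\<^sub>v ((n + 1) * q)"
        unfolding mult_mat_vec_zero[OF hblk_carrier] using 1 by simp
      finally have "hblk q s 0 (n + 1 + 1) (n + 1 + 1) *\<^sub>v ((0\<^sub>v q @\<^sub>v u) @\<^sub>v x) = 0\<^sub>v ((n + 1 + 1) * q)"
        unfolding h1(4)[OF u0 x] using L by simp
      then show "hblk q s 1 (n + 1 + 1) (n + 1) *\<^sub>v X = 0\<^sub>v ((n + 1 + 1) * q)"
        unfolding append_vec_assoc Xux[symmetric] shift[OF X] .
    qed
  qed
qed


section \<open>Densities of matrix measures\<close>

lemma emeasure_of_set_function:
  fixes f :: "real set \<Rightarrow> real"
  assumes nonneg: "\<And>A. A \<in> sets borel \<Longrightarrow> 0 \<le> f A"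
    and add: "\<And>A :: nat \<Rightarrow> real set. range A \<subseteq> sets borel \<Longrightarrow> disjoint_family A \<Longrightarrow>
      (\<lambda>k. f (A k)) sums f (\<Union>k. A k)"
    and A: "A \<in> sets borel"
  shows "emeasure (measure_of UNIV (sets borel) (\<lambda>A. ennreal (f A))) A = ennreal (f A)"
proof (rule emeasure_measure_of_sigma[OF _ _ _ A])
  show "sigma_algebra UNIV (sets (borel :: real measure))"
    using sets.sigma_algebra_axioms[of "borel :: real measure"] by simp
  \<comment> \<open>Additivity along a constant sequence of empty sets: a constant series converges
    only if its terms vanish.\<close>
  have "(\<lambda>k. f ((\<lambda>_. {}) k)) sums f (\<Union>k :: nat. (\<lambda>_. {}) k)"
    by (rule add) (auto simp: disjoint_family_on_def)
  then have "f {} = 0" using sums_summable summable_const_iff by fastforce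
  then show "positive (sets borel) (\<lambda>A. ennreal (f A))" by (simp add: positive_def)
  show "countably_additive (sets borel) (\<lambda>A. ennreal (f A))"
  proof (rule countably_additiveI)
    fix B :: "nat \<Rightarrow> real set"
    assume B: "range B \<subseteq> sets borel" "disjoint_family B"
    show "(\<Sum>i. ennreal (f (B i))) = ennreal (f (\<Union>i. B i))"
      using B nonneg by (intro suminf_ennreal_eq add) auto
  qed
qed

text \<open>Radon-Nikodym for a real set function, which is made a measure first; the density is
  replaced by a real function, so that later integrals are Bochner integrals.\<close>

lemma set_function_density:
  fixes M :: "real measure" and f :: "real set \<Rightarrow> real"
  assumes M: "finite_measure M" and sets: "sets M = sets borel"
    and nonneg: "\<And>A. A \<in> sets borel \<Longrightarrow> 0 \<le> f A"
    and add: "\<And>A :: nat \<Rightarrow> real set. range A \<subseteq> sets borel \<Longrightarrow> disjoint_family A \<Longrightarrow>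
      (\<lambda>k. f (A k)) sums f (\<Union>k. A k)"
    and ac: "\<And>A. A \<in> sets borel \<Longrightarrow> emeasure M A = 0 \<Longrightarrow> f A = 0"
  obtains g :: "real \<Rightarrow> real" where "integrable M g" "\<And>A. A \<in> sets borel \<Longrightarrow> f A = (LINT x:A|M. g x)"
proof -
  interpret finite_measure M by fact
  define N where "N = measure_of UNIV (sets borel) (\<lambda>A. ennreal (f A))"
  have N: "emeasure N A = ennreal (f A)" if "A \<in> sets borel" for A
    unfolding N_def by (rule emeasure_of_set_function[OF nonneg add that])
  have setsN: "sets N = sets borel"
    unfolding N_def using sets.sets_measure_of_eq[of "borel :: real measure"] by simp
  have spaceN: "space N = UNIV" using sets_eq_imp_space_eq[OF setsN] by simp
  have finN: "finite_measure N" by (rule finite_measureI) (simp add: spaceN N)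
  have "absolutely_continuous M N"
    unfolding absolutely_continuous_def
    using N ac by (auto simp: null_sets_def sets setsN)
  from real_RN_deriv[OF finN this] obtain g where g: "g \<in> borel_measurable M"
    and RN: "AE x in M. RN_deriv M N x = ennreal (g x)" and g0: "\<And>x. 0 \<le> g x"
    using sets setsN by metis
  have "density M (RN_deriv M N) = N"
    using \<open>absolutely_continuous M N\<close> setsN sets by (intro density_RN_deriv) auto
  moreover have "density M (RN_deriv M N) = density M (\<lambda>x. ennreal (g x))"
    using RN g by (intro density_cong) auto
  ultimately have dens: "density M (\<lambda>x. ennreal (g x)) = N" by simp
  have nn: "(\<integral>\<^sup>+x. ennreal (indicator A x *\<^sub>R g x) \<partial>M) = ennreal (f A)" if A: "A \<in> sets borel" for A
  proof -
    have "ennreal (f A) = emeasure (density M (\<lambda>x. ennreal (g x))) A" by (simp add: dens N A)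
    also have "\<dots> = (\<integral>\<^sup>+x. ennreal (g x) * indicator A x \<partial>M)"
      using g A sets by (intro emeasure_density) auto
    also have "\<dots> = (\<integral>\<^sup>+x. ennreal (indicator A x *\<^sub>R g x) \<partial>M)"
      by (intro nn_integral_cong) (auto simp: indicator_def)
    finally show ?thesis ..
  qed
  have int: "integrable M g"
    using nn[of UNIV] g g0 by (intro integrableI_nonneg) auto
  show ?thesis
  proof (rule that[OF int])
    fix A :: "real set" assume A: "A \<in> sets borel"
    have "integrable M (\<lambda>x. indicator A x *\<^sub>R g x)"
      using int A sets by (intro integrable_mult_indicator) auto
    then have "(\<integral>\<^sup>+x. ennreal (indicator A x *\<^sub>R g x) \<partial>M) = ennreal (LINT x|M. indicator A x *\<^sub>R g x)"
      using g0 by (intro nn_integral_eq_integral) auto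
    then have "ennreal (f A) = ennreal (LINT x:A|M. g x)"
      unfolding nn[OF A] set_lebesgue_integral_def .
    moreover have "0 \<le> (LINT x:A|M. g x)"
      using g0 by (auto simp: set_lebesgue_integral_def)
    ultimately show "f A = (LINT x:A|M. g x)" using nonneg[OF A] by simp
  qed
qed

lemma AE_nonneg_if_set_integral_nonneg:
  fixes f :: "'a \<Rightarrow> real"
  assumes f: "integrable M f" and nonneg: "\<And>A. A \<in> sets M \<Longrightarrow> 0 \<le> (LINT x:A|M. f x)"
  shows "AE x in M. 0 \<le> f x"
proof -
  define A where "A = {x \<in> space M. f x < 0}"
  have [measurable]: "f \<in> borel_measurable M" using f by auto
  have A: "A \<in> sets M" unfolding A_def by measurable
  let ?g = "\<lambda>x. - (indicator A x *\<^sub>R f x)"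
  have g: "integrable M ?g" using integrable_mult_indicator[OF A f] by auto
  have g0: "0 \<le> ?g x" for x by (auto simp: A_def indicator_def)
  have "integral\<^sup>L M ?g = - (LINT x:A|M. f x)" by (simp add: set_lebesgue_integral_def)
  moreover have "0 \<le> integral\<^sup>L M ?g" using g0 by (intro integral_nonneg_AE) auto
  ultimately have "integral\<^sup>L M ?g = 0" using nonneg[OF A] by simp
  then have "AE x in M. ?g x = 0" using integral_nonneg_eq_0_iff_AE[OF g] g0 by auto
  then show ?thesis using AE_space by eventually_elim (auto simp: A_def indicator_def split: if_splits)
qed

lemma AE_zero_if_set_integral_zero:
  fixes f :: "'a \<Rightarrow> complex"
  assumes f: "integrable M f" and zero: "\<And>A. A \<in> sets M \<Longrightarrow> (LINT x:A|M. f x) = 0"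
  shows "AE x in M. f x = 0"
proof -
  have i: "integrable M (\<lambda>x. indicator A x *\<^sub>R f x)" if "A \<in> sets M" for A
    by (rule integrable_mult_indicator[OF that f])
  have r: "(LINT x:A|M. Re (f x)) = 0" "(LINT x:A|M. Im (f x)) = 0" if "A \<in> sets M" for A
    using integral_Re[OF i[OF that]] integral_Im[OF i[OF that]] zero[OF that]
    by (simp_all add: set_lebesgue_integral_def)
  have "AE x in M. 0 \<le> Re (f x)" "AE x in M. 0 \<le> - Re (f x)"
    "AE x in M. 0 \<le> Im (f x)" "AE x in M. 0 \<le> - Im (f x)"
    using f r by (intro AE_nonneg_if_set_integral_nonneg; simp add: set_lebesgue_integral_def)+
  then show ?thesis by eventually_elim (auto simp: complex_eq_iff)
qed

text \<open>\<open>A\<close> is the Gram matrix of the columns of its square root, and its trace is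
  the sum of all squared moduli of entries of that root. The bound makes every entry of a matrix
  measure absolutely continuous with respect to the trace measure.\<close>

lemma psd_entry_le_trace:
  assumes A: "A \<in> psd_mats q" and ij: "i < q" "j < q"
  shows "cmod (A $$ (i, j)) \<le> Re (\<Sum>k<q. A $$ (k, k))"
proof -
  let ?R = "psd_sqrt q A"
  note R = psd_matsD(1,2)[OF psd_sqrt(1)[OF A]]
  have e: "A $$ (a, b) = (\<Sum>k<q. cnj (?R $$ (k, a)) * ?R $$ (k, b))" if "a < q" "b < q" for a b
  proof -
    have "A $$ (a, b) = (mat_adjoint ?R * ?R) $$ (a, b)" by (simp only: R psd_sqrt(2)[OF A])
    also have "\<dots> = (\<Sum>k<q. cnj (?R $$ (k, a)) * ?R $$ (k, b))"
      unfolding index_mult_mat_sum[OF mat_adjoint_carrier[OF R(1)] R(1) that]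
      using R(1) that by (intro sum.cong) auto
    finally show ?thesis .
  qed
  have "cmod (A $$ (i, j)) \<le> (\<Sum>k<q. cmod (?R $$ (k, i)) * cmod (?R $$ (k, j)))"
    unfolding e[OF ij] by (rule order.trans[OF norm_sum]) (simp add: norm_mult)
  also have "\<dots> \<le> (\<Sum>k<q. \<Sum>l<q. (cmod (?R $$ (k, l)))\<^sup>2)"
  proof (rule sum_mono)
    fix k assume "k \<in> {..<q}"
    let ?f = "\<lambda>l. (cmod (?R $$ (k, l)))\<^sup>2"
    have "?f l \<le> (\<Sum>l<q. ?f l)" if "l < q" for l using that by (intro member_le_sum) auto
    then have "?f i \<le> (\<Sum>l<q. ?f l)" "?f j \<le> (\<Sum>l<q. ?f l)" using ij by auto
    moreover have "2 * (cmod (?R $$ (k, i)) * cmod (?R $$ (k, j))) \<le> ?f i + ?f j"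
      using sum_squares_bound[of "cmod (?R $$ (k, i))" "cmod (?R $$ (k, j))"] by simp
    ultimately show "cmod (?R $$ (k, i)) * cmod (?R $$ (k, j)) \<le> (\<Sum>l<q. ?f l)" by linarith
  qed
  also have "\<dots> = (\<Sum>l<q. \<Sum>k<q. (cmod (?R $$ (k, l)))\<^sup>2)" by (rule sum.swap)
  also have "\<dots> = Re (\<Sum>l<q. A $$ (l, l))"
  proof -
    have "Re (cnj z * z) = (cmod z)\<^sup>2" for z by (subst cmod_power2) (simp add: power2_eq_square)
    then show ?thesis unfolding Re_sum by (intro sum.cong refl) (simp only: e lessThan_iff Re_sum)
  qed
  finally show ?thesis .
qed

text \<open>The form at a vector given by its coordinate function: no dimension has to be tracked,
  and the dependence on each entry of \<open>A\<close> is visible for integration.\<close>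

definition qform :: "nat \<Rightarrow> complex mat \<Rightarrow> (nat \<Rightarrow> complex) \<Rightarrow> complex" where
  "qform q A v = (\<Sum>i<q. \<Sum>j<q. A $$ (i, j) * (v j * cnj (v i)))"

lemma qform_eq:
  assumes A: "A \<in> carrier_mat q q" and x: "x \<in> carrier_vec q"
  shows "(A *\<^sub>v x) \<bullet>c x = qform q A (\<lambda>i. x $ i)"
  unfolding cscalar_prod_sum[OF mult_mat_vec_carrier[OF A x] x] qform_def
  by (intro sum.cong refl) (simp only: index_mult_mat_vec_sum[OF A x] lessThan_iff sum_distrib_right mult.assoc)

lemma qform_psd_nonneg:
  assumes A: "A \<in> psd_mats q"
  shows "0 \<le> Re (qform q A v)"
proof -
  have "qform q A v = (A *\<^sub>v vec q v) \<bullet>c vec q v"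
    unfolding qform_eq[OF psd_matsD(1)[OF A] vec_carrier] qform_def by (intro sum.cong) auto
  then show ?thesis using psd_matsD(3)[OF A, of "vec q v"] by (simp add: less_eq_complex_def)
qed

lemma psd_integral_carrier: "psd_integral q \<sigma> f \<in> carrier_mat q q"
  by (simp add: psd_integral_def)

lemma sum_block_index: "(\<Sum>i<r * q. f i) = (\<Sum>k<r. \<Sum>b<q. f (k * q + b))"
  for f :: "nat \<Rightarrow> 'a :: comm_monoid_add"
  by (induction r) (simp_all add: sum_lessThan_add add.commute[of q])

section \<open>The trace measure and its density\<close>

context
  fixes q :: nat and \<sigma> :: "real set \<Rightarrow> complex mat"
  assumes \<sigma>: "\<sigma> \<in> psd_measures q"
begin

private abbreviation "\<tau> \<equiv> trace_measure q \<sigma>"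
private abbreviation "tr A \<equiv> Re (\<Sum>i<q. \<sigma> A $$ (i, i))"

lemma psd_measure_psd: "A \<in> sets borel \<Longrightarrow> \<sigma> A \<in> psd_mats q"
  using \<sigma> by (auto simp: psd_measures_def)

private lemma entry_sums:
  assumes "range A \<subseteq> sets borel" "disjoint_family (A :: nat \<Rightarrow> real set)" "i < q" "j < q"
  shows "(\<lambda>k. \<sigma> (A k) $$ (i, j)) sums (\<sigma> (\<Union>k. A k) $$ (i, j))"
  using \<sigma> assms by (auto simp: psd_measures_def)

private lemma tr_sums:
  assumes "range A \<subseteq> sets borel" "disjoint_family (A :: nat \<Rightarrow> real set)"
  shows "(\<lambda>k. tr (A k)) sums tr (\<Union>k. A k)"
  using assms by (intro sums_Re sums_sum entry_sums) auto

private lemma tr_nonneg: "A \<in> sets borel \<Longrightarrow> 0 \<le> tr A"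
  using psd_entry_le_trace[OF psd_measure_psd, of A 0 0] by (cases "q = 0") (auto intro: order.trans[OF norm_ge_zero])

lemma sets_trace_measure [simp, measurable_cong]: "sets \<tau> = sets borel"
  unfolding trace_measure_def using sets.sets_measure_of_eq[of "borel :: real measure"] by simp

lemma space_trace_measure [simp]: "space \<tau> = UNIV"
  using sets_eq_imp_space_eq[OF sets_trace_measure] by simp

lemma emeasure_trace_measure:
  assumes "A \<in> sets borel"
  shows "emeasure \<tau> A = ennreal (tr A)"
  unfolding trace_measure_def by (rule emeasure_of_set_function[OF tr_nonneg tr_sums assms])

lemma finite_trace_measure: "finite_measure \<tau>"
  by (rule finite_measureI) (simp add: emeasure_trace_measure)

lemma measure_trace_measure: "A \<in> sets borel \<Longrightarrow> measure \<tau> A = tr A"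
  using emeasure_trace_measure[of A] tr_nonneg[of A] by (simp add: measure_def)

text \<open>The Radon-Nikodym theorem is applied to the non-negative set functions \<open>tr + Re \<sigma>\<^sub>i\<^sub>j\<close> and
  \<open>tr + Im \<sigma>\<^sub>i\<^sub>j\<close>.\<close>
private lemma part_density:
  assumes ij: "i < q" "j < q"
    and part: "\<And>z. \<bar>p z\<bar> \<le> cmod z" "\<And>f z. f sums z \<Longrightarrow> (\<lambda>k. p (f k)) sums p z"
  shows "\<exists>g. integrable \<tau> g \<and> (\<forall>A\<in>sets borel. p (\<sigma> A $$ (i, j)) = (LINT x:A|\<tau>. g x))"
proof -
  interpret finite_measure \<tau> by (rule finite_trace_measure)
  have bound: "\<bar>p (\<sigma> A $$ (i, j))\<bar> \<le> tr A" if "A \<in> sets borel" for A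
    using part(1) psd_entry_le_trace[OF psd_measure_psd[OF that] ij] by (rule order.trans)
  obtain g where g: "integrable \<tau> g"
    and gA: "\<And>A. A \<in> sets borel \<Longrightarrow> tr A + p (\<sigma> A $$ (i, j)) = (LINT x:A|\<tau>. g x)"
  proof (rule set_function_density[OF finite_trace_measure sets_trace_measure, where f = "\<lambda>A. tr A + p (\<sigma> A $$ (i, j))"])
    show "0 \<le> tr A + p (\<sigma> A $$ (i, j))" if "A \<in> sets borel" for A using bound[OF that] by linarith
    show "(\<lambda>k. tr (A k) + p (\<sigma> (A k) $$ (i, j))) sums (tr (\<Union>k. A k) + p (\<sigma> (\<Union>k. A k) $$ (i, j)))"
      if "range A \<subseteq> sets borel" "disjoint_family A" for A :: "nat \<Rightarrow> real set"
      using that ij by (intro sums_add tr_sums part entry_sums)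
    show "tr A + p (\<sigma> A $$ (i, j)) = 0" if "A \<in> sets borel" "emeasure \<tau> A = 0" for A
      using bound[OF that(1)] tr_nonneg[OF that(1)] that emeasure_trace_measure[OF that(1)] by simp
  qed (use that in blast)
  show ?thesis
  \<comment> \<open>\<open>g\<close> is a density of the trace plus the chosen part; the trace
    itself has density 1.\<close>
  proof (intro exI[of _ "\<lambda>x. g x - 1"] conjI ballI)
    show "integrable \<tau> (\<lambda>x. g x - 1)" using g by simp
    fix A :: "real set" assume A: "A \<in> sets borel"
    have "(LINT x:A|\<tau>. g x - 1) = (LINT x:A|\<tau>. g x) - (LINT x:A|\<tau>. 1)"
    proof (rule set_integral_diff(2))
      show "set_integrable \<tau> A g" unfolding set_integrable_def
        using A g by (intro integrable_mult_indicator) auto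
      show "set_integrable \<tau> A (\<lambda>_. 1 :: real)" unfolding set_integrable_def
        using A by (intro integrable_mult_indicator) auto
    qed
    also have "(LINT x:A|\<tau>. 1) = tr A"
      using A measure_trace_measure[OF A] by (simp add: set_lebesgue_integral_def)
    finally show "p (\<sigma> A $$ (i, j)) = (LINT x:A|\<tau>. g x - 1)" using gA[OF A] by simp
  qed
qed

text \<open>Existence, assembled from real and imaginary parts, justifies the choice in
  \<open>trace_density\<close>; everything later uses the density through this property
  only.\<close>

lemma is_trace_density_trace_density: "is_trace_density q \<sigma> (trace_density q \<sigma>)"
proof -
  have "\<exists>g. i < q \<longrightarrow> j < q \<longrightarrow> integrable \<tau> g \<and> (\<forall>A\<in>sets borel. Re (\<sigma> A $$ (i, j)) = (LINT x:A|\<tau>. g x))" for i j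
    using part_density[of i j Re] abs_Re_le_cmod sums_Re by blast
  then obtain gr where gr: "\<And>i j. i < q \<Longrightarrow> j < q \<Longrightarrow> integrable \<tau> (gr i j)"
    "\<And>i j A. i < q \<Longrightarrow> j < q \<Longrightarrow> A \<in> sets borel \<Longrightarrow> Re (\<sigma> A $$ (i, j)) = (LINT x:A|\<tau>. gr i j x)"
    by metis
  have "\<exists>g. i < q \<longrightarrow> j < q \<longrightarrow> integrable \<tau> g \<and> (\<forall>A\<in>sets borel. Im (\<sigma> A $$ (i, j)) = (LINT x:A|\<tau>. g x))" for i j
    using part_density[of i j Im] abs_Im_le_cmod sums_Im by blast
  then obtain gi where gi: "\<And>i j. i < q \<Longrightarrow> j < q \<Longrightarrow> integrable \<tau> (gi i j)"
    "\<And>i j A. i < q \<Longrightarrow> j < q \<Longrightarrow> A \<in> sets borel \<Longrightarrow> Im (\<sigma> A $$ (i, j)) = (LINT x:A|\<tau>. gi i j x)"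
    by metis
  define D where "D x = mat q q (\<lambda>(i, j). complex_of_real (gr i j x) + \<i> * complex_of_real (gi i j x))" for x
  have "is_trace_density q \<sigma> D"
    unfolding is_trace_density_def
  proof (intro conjI allI impI ballI)
    show "D x \<in> carrier_mat q q" for x by (simp add: D_def)
    fix i j assume ij: "i < q" "j < q"
    have D: "D x $$ (i, j) = complex_of_real (gr i j x) + \<i> * complex_of_real (gi i j x)" for x
      using ij by (simp add: D_def)
    show "integrable \<tau> (\<lambda>x. D x $$ (i, j))" unfolding D using gr(1)[OF ij] gi(1)[OF ij] by simp
    fix A :: "real set" assume A: "A \<in> sets borel"
    let ?r = "\<lambda>x. indicator A x *\<^sub>R gr i j x" and ?i = "\<lambda>x. indicator A x *\<^sub>R gi i j x"
    have int: "integrable \<tau> ?r" "integrable \<tau> ?i"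
      using A gr(1)[OF ij] gi(1)[OF ij] by (auto intro!: integrable_mult_indicator simp del: real_scaleR_def)
    have "(LINT x:A|\<tau>. D x $$ (i, j)) = (LINT x|\<tau>. complex_of_real (?r x) + \<i> * complex_of_real (?i x))"
      unfolding set_lebesgue_integral_def D by (intro Bochner_Integration.integral_cong) (auto simp: scaleR_conv_of_real algebra_simps)
    also have "\<dots> = (LINT x|\<tau>. complex_of_real (?r x)) + (LINT x|\<tau>. \<i> * complex_of_real (?i x))"
      using int by (intro Bochner_Integration.integral_add integrable_mult_right integrable_of_real)
    also have "\<dots> = complex_of_real (integral\<^sup>L \<tau> ?r) + \<i> * complex_of_real (integral\<^sup>L \<tau> ?i)"
      unfolding integral_mult_right_zero integral_complex_of_real ..
    also have "\<dots> = \<sigma> A $$ (i, j)"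
      using gr(2)[OF ij A] gi(2)[OF ij A] by (simp add: set_lebesgue_integral_def complex_eq_iff)
    finally show "\<sigma> A $$ (i, j) = (LINT x:A|\<tau>. D x $$ (i, j))" ..
  qed
  then show ?thesis unfolding trace_density_def by (rule someI[where P = "is_trace_density q \<sigma>"])
qed

private abbreviation "D \<equiv> trace_density q \<sigma>"

lemma trace_density_integrable:
  assumes "i < q" "j < q"
  shows "integrable \<tau> (\<lambda>x. D x $$ (i, j))"
  using is_trace_density_trace_density assms by (auto simp: is_trace_density_def)

lemma set_integral_trace_density:
  assumes "i < q" "j < q" "A \<in> sets borel"
  shows "(LINT x:A|\<tau>. D x $$ (i, j)) = \<sigma> A $$ (i, j)"
  using is_trace_density_trace_density assms by (auto simp: is_trace_density_def)

lemma trace_density_hermitian_AE: "AE x in \<tau>. \<forall>i<q. \<forall>j<q. D x $$ (i, j) = cnj (D x $$ (j, i))"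
proof -
  have "AE x in \<tau>. D x $$ (i, j) = cnj (D x $$ (j, i))" if ij: "i < q" "j < q" for i j
  proof -
    note int = trace_density_integrable[OF ij] trace_density_integrable[OF ij(2,1)]
    have "AE x in \<tau>. D x $$ (i, j) - cnj (D x $$ (j, i)) = 0"
    proof (rule AE_zero_if_set_integral_zero)
      show "integrable \<tau> (\<lambda>x. D x $$ (i, j) - cnj (D x $$ (j, i)))" using int by simp
      fix A assume "A \<in> sets \<tau>"
      then have A: "A \<in> sets borel" by simp
      have ia: "integrable \<tau> (\<lambda>x. indicator A x *\<^sub>R D x $$ (a, b))" if "a < q" "b < q" for a b
        using A trace_density_integrable[OF that] by (intro integrable_mult_indicator) auto
      have "(LINT x:A|\<tau>. D x $$ (i, j) - cnj (D x $$ (j, i))) =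
          (LINT x|\<tau>. indicator A x *\<^sub>R D x $$ (i, j) - cnj (indicator A x *\<^sub>R D x $$ (j, i)))"
        unfolding set_lebesgue_integral_def by (intro Bochner_Integration.integral_cong) (auto simp: scaleR_diff_right)
      also have "\<dots> = (LINT x:A|\<tau>. D x $$ (i, j)) - cnj (LINT x:A|\<tau>. D x $$ (j, i))"
        unfolding set_lebesgue_integral_def Bochner_Integration.integral_cnj[symmetric]
        using ia[OF ij] ia[OF ij(2,1)]
        by (intro Bochner_Integration.integral_diff integrable_cnj)
      also have "\<dots> = \<sigma> A $$ (i, j) - cnj (\<sigma> A $$ (j, i))"
        using ij A by (simp add: set_integral_trace_density)
      also have "\<dots> = 0"
        using index_mat_adjoint[of i "\<sigma> A" j] psd_matsD[OF psd_measure_psd[OF A]] ij by auto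
      finally show "(LINT x:A|\<tau>. D x $$ (i, j) - cnj (D x $$ (j, i))) = 0" .
    qed
    then show ?thesis by simp
  qed
  then show ?thesis by (simp add: AE_all_countable)
qed

text \<open>The integral over a Borel set of the form of the density is the form of the measure of
  that set, hence non-negative. The exceptional null set may still depend on
  \<open>v\<close>.\<close>

private lemma qform_nonneg_AE_single: "AE x in \<tau>. 0 \<le> Re (qform q (D x) v)"
proof (rule AE_nonneg_if_set_integral_nonneg)
  have i: "integrable \<tau> (\<lambda>x. qform q (D x) v)"
    unfolding qform_def
    by (intro Bochner_Integration.integrable_sum integrable_mult_left trace_density_integrable) auto
  then show "integrable \<tau> (\<lambda>x. Re (qform q (D x) v))" by simp
  fix A assume "A \<in> sets \<tau>"
  then have A: "A \<in> sets borel" by simp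
  have ia: "integrable \<tau> (\<lambda>x. indicator A x *\<^sub>R D x $$ (a, b))" if "a < q" "b < q" for a b
    using A trace_density_integrable[OF that] by (intro integrable_mult_indicator) auto
  have "(LINT x:A|\<tau>. Re (qform q (D x) v)) = (LINT x|\<tau>. Re (indicator A x *\<^sub>R qform q (D x) v))"
    by (simp add: set_lebesgue_integral_def)
  also have "\<dots> = Re (LINT x|\<tau>. indicator A x *\<^sub>R qform q (D x) v)"
    using A i by (intro integral_Re integrable_mult_indicator) auto
  also have "(LINT x|\<tau>. indicator A x *\<^sub>R qform q (D x) v) =
      (LINT x|\<tau>. (\<Sum>i<q. \<Sum>j<q. (indicator A x *\<^sub>R D x $$ (i, j)) * (v j * cnj (v i))))"
    unfolding qform_def by (intro Bochner_Integration.integral_cong refl) (simp add: scaleR_sum_right)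
  also have "\<dots> = (\<Sum>i<q. \<Sum>j<q. (LINT x|\<tau>. indicator A x *\<^sub>R D x $$ (i, j)) * (v j * cnj (v i)))"
    by (intro has_bochner_integral_integral_eq has_bochner_integral_sum has_bochner_integral_mult_left
        has_bochner_integral_integrable ia) auto
  also have "\<dots> = qform q (\<sigma> A) v"
    unfolding qform_def using A set_integral_trace_density by (simp add: set_lebesgue_integral_def)
  finally show "0 \<le> (LINT x:A|\<tau>. Re (qform q (D x) v))"
    using qform_psd_nonneg[OF psd_measure_psd[OF A]] by simp
qed

text \<open>The exceptional null set must not depend on the vector; it is taken for a countable dense set
  of vectors.\<close>
lemma qform_trace_density_nonneg_AE: "AE x in \<tau>. \<forall>v. 0 \<le> Re (qform q (D x) v)"
proof -
  obtain Q :: "complex set" where Q: "countable Q" and dense: "\<And>X. open X \<Longrightarrow> X \<noteq> {} \<Longrightarrow> \<exists>d\<in>Q. d \<in> X"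
    using countable_dense_setE by blast
  \<comment> \<open>Extensional functions on a finite index set form a countable set;
    \<open>qform\<close> reads only coordinates below \<open>q\<close>.\<close>
  define VQ where "VQ = ({..<q} \<rightarrow>\<^sub>E Q)"
  have VQ: "countable VQ" unfolding VQ_def using Q by (intro countable_PiE) auto
  have "AE x in \<tau>. \<forall>v\<in>VQ. 0 \<le> Re (qform q (D x) v)"
    using VQ qform_nonneg_AE_single by (simp add: AE_ball_countable)
  then show ?thesis
  proof eventually_elim
    fix x assume nonneg: "\<forall>v\<in>VQ. 0 \<le> Re (qform q (D x) v)"
    show "\<forall>v. 0 \<le> Re (qform q (D x) v)"
    proof
      fix v :: "nat \<Rightarrow> complex"
      have "\<exists>d\<in>Q. d \<in> ball (v i) (1 / (real k + 1))" for i k by (rule dense) auto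
      then have "\<exists>w. \<forall>i k. w i k \<in> Q \<and> dist (v i) (w i k) < 1 / (real k + 1)"
        unfolding mem_ball by metis
      then obtain w where wQ: "\<And>i k. w i k \<in> Q" and w: "\<And>i k. dist (v i) (w i k) < 1 / (real k + 1)"
        by blast
      have lim: "(\<lambda>k. w i k) \<longlonglongrightarrow> v i" for i
      proof (rule metric_LIMSEQ_I)
        fix e :: real assume "e > 0"
        then obtain k0 where k0: "inverse (real (Suc k0)) < e" using reals_Archimedean by blast
        have "dist (w i k) (v i) < e" if "k \<ge> k0" for k
        proof -
          have "1 / (real k + 1) \<le> inverse (real (Suc k0))" using that by (simp add: field_simps)
          then show ?thesis using w[of i k] k0 by (simp add: dist_commute)
        qed
        then show "\<exists>k0. \<forall>k\<ge>k0. dist (w i k) (v i) < e" by blast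
      qed
      have "(\<lambda>k. Re (qform q (D x) (\<lambda>i. w i k))) \<longlonglongrightarrow> Re (qform q (D x) v)"
        unfolding qform_def by (intro tendsto_intros lim)
      moreover have "0 \<le> Re (qform q (D x) (\<lambda>i. w i k))" for k
      proof -
        have "(\<lambda>i\<in>{..<q}. w i k) \<in> VQ" using wQ by (auto simp: VQ_def)
        moreover have "qform q (D x) (\<lambda>i\<in>{..<q}. w i k) = qform q (D x) (\<lambda>i. w i k)"
          unfolding qform_def by (intro sum.cong) auto
        ultimately show ?thesis using nonneg by metis
      qed
      ultimately show "0 \<le> Re (qform q (D x) v)" by (intro LIMSEQ_le_const) auto
    qed
  qed
qed

section \<open>Moments of matrix measures\<close>

context
  fixes m :: nat
  assumes int2m: "psd_integrable q \<sigma> (\<lambda>x. x ^ (2 * m))"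
begin

private abbreviation "t \<equiv> \<lambda>k. psd_integral q \<sigma> (\<lambda>x. x ^ k)"

text \<open>The modulus of \<open>x ^ k\<close> is at most \<open>1 + x ^ (2 * m)\<close>, and the
  density is integrable both by itself and against the highest power.\<close>

lemma moment_integrable:
  assumes "k \<le> 2 * m" "i < q" "j < q"
  shows "integrable \<tau> (\<lambda>x. x ^ k *\<^sub>R D x $$ (i, j))"
proof (rule Bochner_Integration.integrable_bound)
  have 1: "integrable \<tau> (\<lambda>x. x ^ (2 * m) *\<^sub>R D x $$ (i, j))"
    using int2m assms by (auto simp: psd_integrable_def)
  note 2 = trace_density_integrable[OF assms(2,3)]
  show "integrable \<tau> (\<lambda>x. norm (D x $$ (i, j)) + norm (x ^ (2 * m) *\<^sub>R D x $$ (i, j)))"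
    using integrable_norm[OF 1] integrable_norm[OF 2] by (rule Bochner_Integration.integrable_add[rotated])
  have [measurable]: "(\<lambda>x. D x $$ (i, j)) \<in> borel_measurable \<tau>" using 2 by auto
  show "(\<lambda>x. x ^ k *\<^sub>R D x $$ (i, j)) \<in> borel_measurable \<tau>" by measurable
  have b: "\<bar>x\<bar> ^ k \<le> 1 + x ^ (2 * m)" for x :: real
  proof (cases "\<bar>x\<bar> \<le> 1")
    case True
    then have "\<bar>x\<bar> ^ k \<le> 1" by (simp add: power_le_one)
    then show ?thesis by (simp add: add_increasing2)
  next
    case False
    then have "\<bar>x\<bar> ^ k \<le> \<bar>x\<bar> ^ (2 * m)" using assms(1) by (intro power_increasing) auto
    also have "\<bar>x\<bar> ^ (2 * m) = x ^ (2 * m)" by (simp add: power_even_abs)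
    finally show ?thesis by simp
  qed
  have "norm (x ^ k *\<^sub>R D x $$ (i, j)) \<le> norm (norm (D x $$ (i, j)) + norm (x ^ (2 * m) *\<^sub>R D x $$ (i, j)))" for x
    using mult_right_mono[OF b[of x], of "norm (D x $$ (i, j))"] by (simp add: power_abs power_even_abs algebra_simps)
  then show "AE x in \<tau>. norm (x ^ k *\<^sub>R D x $$ (i, j)) \<le>
      norm (norm (D x $$ (i, j)) + norm (x ^ (2 * m) *\<^sub>R D x $$ (i, j)))" by simp
qed

lemma moment_entry:
  assumes "i < q" "j < q"
  shows "t k $$ (i, j) = (LINT x|\<tau>. x ^ k *\<^sub>R D x $$ (i, j))"
  using assms by (simp add: psd_integral_def)

lemma moment_hermitian:
  assumes k: "k \<le> 2 * m"
  shows "mat_adjoint (t k) = t k"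
proof (rule eq_matI)
  fix i j assume "i < dim_row (t k)" "j < dim_col (t k)"
  then have ij: "i < q" "j < q" using psd_integral_carrier[of q \<sigma> "\<lambda>x. x ^ k"] by auto
  note mi = moment_integrable[OF k ij] moment_integrable[OF k ij(2,1)]
  have "cnj (t k $$ (j, i)) = (LINT x|\<tau>. cnj (x ^ k *\<^sub>R D x $$ (j, i)))"
    unfolding moment_entry[OF ij(2,1)] by (rule integral_cnj[symmetric])
  also have "\<dots> = (LINT x|\<tau>. x ^ k *\<^sub>R D x $$ (i, j))"
  proof (rule integral_cong_AE)
    show "AE x in \<tau>. cnj (x ^ k *\<^sub>R D x $$ (j, i)) = x ^ k *\<^sub>R D x $$ (i, j)"
      using trace_density_hermitian_AE
    proof eventually_elim
      fix x assume "\<forall>i<q. \<forall>j<q. D x $$ (i, j) = cnj (D x $$ (j, i))"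
      with ij have "D x $$ (i, j) = cnj (D x $$ (j, i))" by blast
      then show "cnj (x ^ k *\<^sub>R D x $$ (j, i)) = x ^ k *\<^sub>R D x $$ (i, j)" by simp
    qed
  qed (rule borel_measurable_integrable[OF integrable_cnj[OF mi(2)]], rule borel_measurable_integrable[OF mi(1)])
  finally have "cnj (t k $$ (j, i)) = t k $$ (i, j)" unfolding moment_entry[OF ij] .
  moreover have "mat_adjoint (t k) $$ (i, j) = cnj (t k $$ (j, i))"
    using ij psd_integral_carrier[of q \<sigma> "\<lambda>x. x ^ k"] by (intro index_mat_adjoint) auto
  ultimately show "mat_adjoint (t k) $$ (i, j) = t k $$ (i, j)" by simp
qed (use psd_integral_carrier[of q \<sigma> "\<lambda>x. x ^ k"] in auto)

text \<open>The quadratic form of a block Hankel matrix of moments at \<open>X\<close> is the integral of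
  \<open>\<lambda>\<^sup>a p\<^sup>* d\<sigma> p\<close> for the vector polynomial \<open>p\<close> with the block coefficients of \<open>X\<close>.\<close>
lemma moment_quadratic:
  assumes r: "a + 2 * r \<le> 2 * m + 2" and X: "X \<in> carrier_vec (r * q)"
  defines "p \<equiv> \<lambda>x b. \<Sum>k<r. complex_of_real x ^ k * X $ (k * q + b)"
  shows "integrable \<tau> (\<lambda>x. x ^ a *\<^sub>R qform q (D x) (p x))"
    "(hblk q t a r r *\<^sub>v X) \<bullet>c X = (LINT x|\<tau>. x ^ a *\<^sub>R qform q (D x) (p x))"
proof -
  let ?F = "\<lambda>k b l c x. (x ^ (a + k + l) *\<^sub>R D x $$ (b, c)) * (X $ (l * q + c) * cnj (X $ (k * q + b)))"
  \<comment> \<open>The highest power that occurs is \<open>a + 2 * (r - 1)\<close>; the hypothesis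
    \<open>r\<close> keeps it within \<open>2 * m\<close>.\<close>
  have F: "integrable \<tau> (?F k b l c)" if "k < r" "b < q" "l < r" "c < q" for k b l c
    using that r by (intro integrable_mult_left moment_integrable) auto
  have eq: "x ^ a *\<^sub>R qform q (D x) (p x) = (\<Sum>k<r. \<Sum>b<q. \<Sum>l<r. \<Sum>c<q. ?F k b l c x)" for x
  proof -
    have "x ^ a *\<^sub>R qform q (D x) (p x) =
        (\<Sum>b<q. \<Sum>c<q. \<Sum>l<r. \<Sum>k<r. ?F k b l c x)"
      unfolding qform_def scaleR_sum_right
    proof (intro sum.cong refl)
      fix b c
      have "p x c * cnj (p x b) =
          (\<Sum>l<r. \<Sum>k<r. (complex_of_real x ^ l * X $ (l * q + c)) * cnj (complex_of_real x ^ k * X $ (k * q + b)))"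
        unfolding p_def cnj_sum sum_product ..
      then show "x ^ a *\<^sub>R (D x $$ (b, c) * (p x c * cnj (p x b))) = (\<Sum>l<r. \<Sum>k<r. ?F k b l c x)"
        by (simp add: sum_distrib_left scaleR_conv_of_real power_add mult_ac)
    qed
    also have "\<dots> = (\<Sum>b<q. \<Sum>k<r. \<Sum>l<r. \<Sum>c<q. ?F k b l c x)"
    proof (rule sum.cong[OF refl])
      fix b
      have "(\<Sum>c<q. \<Sum>l<r. \<Sum>k<r. ?F k b l c x) = (\<Sum>l<r. \<Sum>c<q. \<Sum>k<r. ?F k b l c x)" by (rule sum.swap)
      also have "\<dots> = (\<Sum>l<r. \<Sum>k<r. \<Sum>c<q. ?F k b l c x)"
        by (rule sum.cong[OF refl]) (rule sum.swap)
      also have "\<dots> = (\<Sum>k<r. \<Sum>l<r. \<Sum>c<q. ?F k b l c x)" by (rule sum.swap)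
      finally show "(\<Sum>c<q. \<Sum>l<r. \<Sum>k<r. ?F k b l c x) = (\<Sum>k<r. \<Sum>l<r. \<Sum>c<q. ?F k b l c x)" .
    qed
    also have "\<dots> = (\<Sum>k<r. \<Sum>b<q. \<Sum>l<r. \<Sum>c<q. ?F k b l c x)" by (rule sum.swap)
    finally show ?thesis .
  qed
  show "integrable \<tau> (\<lambda>x. x ^ a *\<^sub>R qform q (D x) (p x))"
    unfolding eq using F by (intro Bochner_Integration.integrable_sum) auto
  have "(LINT x|\<tau>. x ^ a *\<^sub>R qform q (D x) (p x)) = (\<Sum>k<r. \<Sum>b<q. \<Sum>l<r. \<Sum>c<q. LINT x|\<tau>. ?F k b l c x)"
    unfolding eq
    by (intro has_bochner_integral_integral_eq has_bochner_integral_sum has_bochner_integral_integrable F) auto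
  also have "\<dots> = (\<Sum>k<r. \<Sum>b<q. \<Sum>l<r. \<Sum>c<q. hblk q t a r r $$ (k * q + b, l * q + c) * (X $ (l * q + c) * cnj (X $ (k * q + b))))"
    by (intro sum.cong refl) (simp add: index_hblk_block moment_entry del: mult_scaleR_left)
  also have "\<dots> = (hblk q t a r r *\<^sub>v X) \<bullet>c X"
  proof -
    have "(hblk q t a r r *\<^sub>v X) \<bullet>c X = (\<Sum>i<r * q. \<Sum>j<r * q. hblk q t a r r $$ (i, j) * (X $ j * cnj (X $ i)))"
      unfolding qform_eq[OF hblk_carrier X] qform_def ..
    then show ?thesis unfolding sum_block_index ..
  qed
  finally show "(hblk q t a r r *\<^sub>v X) \<bullet>c X = (LINT x|\<tau>. x ^ a *\<^sub>R qform q (D x) (p x))" ..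
qed

lemma moment_hankel_psd: "hblk q t 0 (m + 1) (m + 1) \<in> psd_mats ((m + 1) * q)"
proof (rule psd_matsI)
  show "mat_adjoint (hblk q t 0 (m + 1) (m + 1)) = hblk q t 0 (m + 1) (m + 1)"
    using moment_hermitian psd_integral_carrier by (intro hblk_adjoint) auto
  fix X :: "complex vec" assume X: "X \<in> carrier_vec ((m + 1) * q)"
  have r: "0 + 2 * (m + 1) \<le> 2 * m + 2" by simp
  note mq = moment_quadratic[OF r X]
  show "0 \<le> Re ((hblk q t 0 (m + 1) (m + 1) *\<^sub>v X) \<bullet>c X)"
    unfolding mq(2) integral_Re[OF mq(1), symmetric]
    by (rule integral_nonneg_AE) (use qform_trace_density_nonneg_AE in \<open>eventually_elim, simp\<close>)
qed (rule hblk_carrier)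

lemma moment_shift_null: "shift_null q t m"
  unfolding shift_null_def
proof (intro ballI impI)
  fix X :: "complex vec" assume X: "X \<in> carrier_vec (m * q)" and null: "hblk q t 0 m m *\<^sub>v X = 0\<^sub>v (m * q)"
  have r: "0 + 2 * m \<le> 2 * m + 2" "2 + 2 * m \<le> 2 * m + 2" by simp_all
  let ?p = "\<lambda>x b. \<Sum>k<m. complex_of_real x ^ k * X $ (k * q + b)"
  note m0 = moment_quadratic[OF r(1) X] and m2 = moment_quadratic[OF r(2) X]
  have i0: "integrable \<tau> (\<lambda>x. Re (x ^ 0 *\<^sub>R qform q (D x) (?p x)))" using m0(1) by (rule integrable_Re)
  have "(LINT x|\<tau>. Re (x ^ 0 *\<^sub>R qform q (D x) (?p x))) = 0"
    unfolding integral_Re[OF m0(1)] m0(2)[symmetric] null using zero_cscalar_prod[OF X] by simp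
  moreover have "AE x in \<tau>. 0 \<le> Re (x ^ 0 *\<^sub>R qform q (D x) (?p x))"
    using qform_trace_density_nonneg_AE by eventually_elim simp
  ultimately have "AE x in \<tau>. Re (x ^ 0 *\<^sub>R qform q (D x) (?p x)) = 0"
    using integral_nonneg_eq_0_iff_AE[OF i0] by simp
  \<comment> \<open>The integrand for offset 2 is \<open>x ^ 2\<close> times the one for offset 0,
    so it vanishes almost everywhere too.\<close>
  then have "AE x in \<tau>. Re (x ^ 2 *\<^sub>R qform q (D x) (?p x)) = 0" by eventually_elim simp
  then have "(LINT x|\<tau>. Re (x ^ 2 *\<^sub>R qform q (D x) (?p x))) = 0" by (rule integral_eq_zero_AE)
  then have Re0: "Re ((hblk q t 2 m m *\<^sub>v X) \<bullet>c X) = 0"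
    unfolding m2(2) integral_Re[OF m2(1)] .
  \<comment> \<open>The form of H_m at (0, X) is the form of the window with offset 2 at
    \<open>X\<close>, the squared norm of the shifted polynomial. Only its real part is known to
    vanish so far; positivity of H_m rules out an imaginary part.\<close>
  let ?Y = "0\<^sub>v q @\<^sub>v X"
  have Y: "?Y \<in> carrier_vec ((m + 1) * q)" using X by simp
  have z: "0\<^sub>v q \<in> carrier_vec (1 * q)" by simp
  have "hblk q t 1 (1 + m) m *\<^sub>v X = (hblk q t 1 1 m *\<^sub>v X) @\<^sub>v (hblk q t 2 m m *\<^sub>v X)"
    using hblk_rows[OF X, of t 1 1 m] by (simp add: numeral_2_eq_2)
  then have HY: "hblk q t 0 (m + 1) (m + 1) *\<^sub>v ?Y = (hblk q t 1 1 m *\<^sub>v X) @\<^sub>v (hblk q t 2 m m *\<^sub>v X)"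
    unfolding hblk_shift[OF X] by simp
  have "(hblk q t 0 (m + 1) (m + 1) *\<^sub>v ?Y) \<bullet>c ?Y = (hblk q t 1 1 m *\<^sub>v X) \<bullet>c 0\<^sub>v q + (hblk q t 2 m m *\<^sub>v X) \<bullet>c X"
    unfolding HY by (rule cscalar_prod_append[OF hblk_mult_carrier hblk_mult_carrier z X])
  moreover have "(hblk q t 1 1 m *\<^sub>v X) \<bullet>c 0\<^sub>v q = 0"
    using hblk_mult_carrier[of q t 1 1 m X] by simp
  ultimately have "(hblk q t 0 (m + 1) (m + 1) *\<^sub>v ?Y) \<bullet>c ?Y = 0"
    using psd_matsD(3)[OF moment_hankel_psd Y] Re0 by (simp add: less_eq_complex_def complex_eq_iff)
  from psd_null_vector[OF moment_hankel_psd Y this]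
  show "hblk q t 1 (m + 1) m *\<^sub>v X = 0\<^sub>v ((m + 1) * q)" unfolding hblk_shift[OF X] .
qed

end

end


section \<open>Finitely atomic matrix measures\<close>

text \<open>An atom at \<open>d i\<close> carries the rank-one weight built from the row
  \<open>C i\<close>. The points \<open>d i\<close> may coincide, so the sum runs over indices and
  not over points. The restriction to Borel sets fits the extensional functions in
  \<open>psd_measures\<close>.\<close>

definition atomic_measure ::
    "nat \<Rightarrow> nat \<Rightarrow> (nat \<Rightarrow> real) \<Rightarrow> (nat \<Rightarrow> nat \<Rightarrow> complex) \<Rightarrow> real set \<Rightarrow> complex mat" where
  "atomic_measure q N d C = (\<lambda>A\<in>sets borel.
     mat q q (\<lambda>(a, b). \<Sum>i<N. if d i \<in> A then cnj (C i a) * C i b else 0))"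

lemma atomic_measure_entry:
  "A \<in> sets borel \<Longrightarrow> a < q \<Longrightarrow> b < q \<Longrightarrow>
    atomic_measure q N d C A $$ (a, b) = (\<Sum>i<N. if d i \<in> A then cnj (C i a) * C i b else 0)"
  by (simp add: atomic_measure_def)

lemma atomic_measure_psd:
  assumes A: "A \<in> sets borel"
  shows "atomic_measure q N d C A \<in> psd_mats q"
proof (rule psd_matsI)
  let ?S = "atomic_measure q N d C A"
  show c: "?S \<in> carrier_mat q q" using A by (simp add: atomic_measure_def)
  show "mat_adjoint ?S = ?S"
  proof (rule eq_matI)
    fix i j assume "i < dim_row ?S" "j < dim_col ?S"
    then have ij: "i < q" "j < q" using c by auto
    have "mat_adjoint ?S $$ (i, j) = cnj (?S $$ (j, i))"
      using ij c by (intro index_mat_adjoint) auto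
    also have "\<dots> = ?S $$ (i, j)"
      unfolding atomic_measure_entry[OF A ij] atomic_measure_entry[OF A ij(2,1)] cnj_sum
      by (intro sum.cong) auto
    finally show "mat_adjoint ?S $$ (i, j) = ?S $$ (i, j)" .
  qed (use c in auto)
  fix x :: "complex vec" assume x: "x \<in> carrier_vec q"
  have "(?S *\<^sub>v x) \<bullet>c x = (\<Sum>a<q. \<Sum>b<q. \<Sum>i<N. if d i \<in> A then (C i b * x $ b) * cnj (C i a * x $ a) else 0)"
    unfolding qform_eq[OF c x] qform_def
  proof (intro sum.cong refl)
    fix a b assume "a \<in> {..<q}" "b \<in> {..<q}"
    then have "?S $$ (a, b) * (x $ b * cnj (x $ a)) =
        (\<Sum>i<N. (if d i \<in> A then cnj (C i a) * C i b else 0) * (x $ b * cnj (x $ a)))"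
      by (simp only: atomic_measure_entry[OF A] lessThan_iff sum_distrib_right)
    also have "\<dots> = (\<Sum>i<N. if d i \<in> A then (C i b * x $ b) * cnj (C i a * x $ a) else 0)"
      by (intro sum.cong) (auto simp: mult_ac)
    finally show "?S $$ (a, b) * (x $ b * cnj (x $ a)) =
        (\<Sum>i<N. if d i \<in> A then (C i b * x $ b) * cnj (C i a * x $ a) else 0)" .
  qed
  also have "\<dots> = (\<Sum>i<N. \<Sum>a<q. \<Sum>b<q. if d i \<in> A then (C i b * x $ b) * cnj (C i a * x $ a) else 0)"
    by (simp only: sum.swap[of _ "{..<N}"])
  also have "\<dots> = (\<Sum>i<N. if d i \<in> A then (\<Sum>b<q. C i b * x $ b) * cnj (\<Sum>a<q. C i a * x $ a) else 0)"
  proof (rule sum.cong[OF refl])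
    fix i
    have "(\<Sum>a<q. \<Sum>b<q. (C i b * x $ b) * cnj (C i a * x $ a)) = (\<Sum>b<q. C i b * x $ b) * cnj (\<Sum>a<q. C i a * x $ a)"
      unfolding cnj_sum sum_product by (rule sum.swap)
    then show "(\<Sum>a<q. \<Sum>b<q. if d i \<in> A then (C i b * x $ b) * cnj (C i a * x $ a) else 0) =
      (if d i \<in> A then (\<Sum>b<q. C i b * x $ b) * cnj (\<Sum>a<q. C i a * x $ a) else 0)" by simp
  qed
  finally have e: "(?S *\<^sub>v x) \<bullet>c x =
      (\<Sum>i<N. if d i \<in> A then (\<Sum>b<q. C i b * x $ b) * cnj (\<Sum>a<q. C i a * x $ a) else 0)" .
  have nn: "0 \<le> Re (z * cnj z)" for z by (simp add: complex_mult_cnj)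
  show "0 \<le> Re ((?S *\<^sub>v x) \<bullet>c x)"
    unfolding e Re_sum
  proof (rule sum_nonneg)
    show "0 \<le> Re (if d i \<in> A then (\<Sum>b<q. C i b * x $ b) * cnj (\<Sum>a<q. C i a * x $ a) else 0)" for i
      by (cases "d i \<in> A") (simp_all only: if_True if_False nn zero_complex.sel order_refl)
  qed
qed

lemma atomic_measure_psd_measures: "atomic_measure q N d C \<in> psd_measures q"
  unfolding psd_measures_def
proof (intro CollectI conjI allI impI)
  show "atomic_measure q N d C \<in> sets borel \<rightarrow>\<^sub>E psd_mats q"
    using atomic_measure_psd by (auto simp: atomic_measure_def PiE_iff extensional_def)
  fix A :: "nat \<Rightarrow> real set" and a b
  assume A: "range A \<subseteq> sets borel" "disjoint_family A" and ab: "a < q" "b < q"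
  have "(\<lambda>k. if d i \<in> A k then cnj (C i a) * C i b else 0) sums
      (if d i \<in> (\<Union>k. A k) then cnj (C i a) * C i b else 0)" for i
  proof (cases "d i \<in> (\<Union>k. A k)")
    case True
    then obtain k0 where k0: "d i \<in> A k0" by blast
    then have "d i \<in> A k \<longleftrightarrow> k = k0" for k
      using A(2) by (auto simp: disjoint_family_on_def)
    then show ?thesis using True sums_single[of k0 "\<lambda>_. cnj (C i a) * C i b"] by simp
  qed auto
  then have "(\<lambda>k. \<Sum>i<N. if d i \<in> A k then cnj (C i a) * C i b else 0) sums
      (\<Sum>i<N. if d i \<in> (\<Union>k. A k) then cnj (C i a) * C i b else 0)"
    by (intro sums_sum)
  moreover have "A k \<in> sets borel" for k using A by auto
  moreover have "(\<Union>k. A k) \<in> sets borel" using A by auto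
  ultimately show "(\<lambda>k. atomic_measure q N d C (A k) $$ (a, b)) sums
      (atomic_measure q N d C (\<Union>k. A k) $$ (a, b))"
    by (simp add: atomic_measure_entry ab)
qed

text \<open>The trace density needs no explicit form: the trace measure is concentrated on finitely
  many points, and at such a point \<open>y\<close> its mass times the density at \<open>y\<close>
  is the value of the matrix measure on \<open>{y}\<close>.\<close>

lemma atomic_measure_integral:
  fixes f :: "real \<Rightarrow> real"
  assumes f [measurable]: "f \<in> borel_measurable borel"
  shows "psd_integrable q (atomic_measure q N d C) f"
    "a < q \<Longrightarrow> b < q \<Longrightarrow> psd_integral q (atomic_measure q N d C) f $$ (a, b) =
      (\<Sum>i<N. cnj (C i a) * complex_of_real (f (d i)) * C i b)"
proof -
  let ?\<sigma> = "atomic_measure q N d C"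
  let ?\<tau> = "trace_measure q ?\<sigma>" and ?D = "trace_density q ?\<sigma>"
  note \<sigma> = atomic_measure_psd_measures[of q N d C]
  interpret finite_measure ?\<tau> by (rule finite_trace_measure[OF \<sigma>])
  \<comment> \<open>As an image, \<open>F\<close> lists coinciding \<open>d i\<close> once; the
    double sum over points and indices below regroups their weights.\<close>
  define F where "F = d ` {..<N}"
  have F: "finite F" by (simp add: F_def)
  have Fb: "- F \<in> sets borel" using F by (intro borel_open) (simp add: finite_imp_closed open_Compl)
  have "?\<sigma> (- F) $$ (i, i) = 0" if "i < q" for i
    unfolding atomic_measure_entry[OF Fb that that] by (intro sum.neutral) (auto simp: F_def)
  then have "emeasure ?\<tau> (- F) = 0"
    unfolding emeasure_trace_measure[OF \<sigma> Fb] by simp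
  then have AEF: "AE x in ?\<tau>. x \<in> F"
    using Fb by (intro AE_I[of _ _ "- F"]) (auto simp: sets_trace_measure[OF \<sigma>])
  have *: "has_bochner_integral ?\<tau> (\<lambda>x. f x *\<^sub>R ?D x $$ (a, b))
      (\<Sum>i<N. cnj (C i a) * complex_of_real (f (d i)) * C i b)" if ab: "a < q" "b < q" for a b
  proof -
    have [measurable]: "(\<lambda>x. ?D x $$ (a, b)) \<in> borel_measurable ?\<tau>"
      using trace_density_integrable[OF \<sigma> ab] by auto
    have [measurable_cong]: "sets ?\<tau> = sets borel" by (rule sets_trace_measure[OF \<sigma>])
    have hb: "has_bochner_integral ?\<tau> (\<lambda>x. indicator {y} x *\<^sub>R c) (measure ?\<tau> {y} *\<^sub>R c)" for y and c :: complex
      by (rule has_bochner_integral_indicator) (simp_all add: sets_trace_measure[OF \<sigma>] less_top[symmetric])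
    have atom: "measure ?\<tau> {y} *\<^sub>R ?D y $$ (a, b) = ?\<sigma> {y} $$ (a, b)" for y
    proof -
      have "?\<sigma> {y} $$ (a, b) = (LINT x|?\<tau>. indicator {y} x *\<^sub>R ?D x $$ (a, b))"
        using set_integral_trace_density[OF \<sigma> ab, of "{y}"] by (simp add: set_lebesgue_integral_def)
      also have "\<dots> = (LINT x|?\<tau>. indicator {y} x *\<^sub>R ?D y $$ (a, b))"
        by (intro Bochner_Integration.integral_cong) (auto simp: indicator_def)
      also have "\<dots> = measure ?\<tau> {y} *\<^sub>R ?D y $$ (a, b)"
        by (rule has_bochner_integral_integral_eq[OF hb])
      finally show ?thesis ..
    qed
    let ?g = "\<lambda>x. \<Sum>y\<in>F. indicator {y} x *\<^sub>R (f y *\<^sub>R ?D y $$ (a, b))"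
    have g: "has_bochner_integral ?\<tau> ?g
        (\<Sum>y\<in>F. measure ?\<tau> {y} *\<^sub>R (f y *\<^sub>R ?D y $$ (a, b)))"
      by (intro has_bochner_integral_sum hb)
    have sum: "(\<Sum>y\<in>F. measure ?\<tau> {y} *\<^sub>R (f y *\<^sub>R ?D y $$ (a, b))) =
        (\<Sum>i<N. cnj (C i a) * complex_of_real (f (d i)) * C i b)"
    proof -
      have "(\<Sum>y\<in>F. measure ?\<tau> {y} *\<^sub>R (f y *\<^sub>R ?D y $$ (a, b))) = (\<Sum>y\<in>F. f y *\<^sub>R ?\<sigma> {y} $$ (a, b))"
        by (intro sum.cong refl) (simp only: scaleR_left_commute[of "measure _ _"] atom)
      also have "\<dots> = (\<Sum>y\<in>F. \<Sum>i<N. if d i = y then f y *\<^sub>R (cnj (C i a) * C i b) else 0)"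
        using ab by (intro sum.cong refl) (auto simp: atomic_measure_entry scaleR_sum_right intro!: sum.cong)
      also have "\<dots> = (\<Sum>i<N. \<Sum>y\<in>F. if d i = y then f y *\<^sub>R (cnj (C i a) * C i b) else 0)"
        by (rule sum.swap)
      also have "\<dots> = (\<Sum>i<N. cnj (C i a) * complex_of_real (f (d i)) * C i b)"
        using F by (intro sum.cong refl) (auto simp: F_def scaleR_conv_of_real)
      finally show ?thesis .
    qed
    have AE: "AE x in ?\<tau>. ?g x = f x *\<^sub>R ?D x $$ (a, b)"
      using AEF
    proof eventually_elim
      fix x assume x: "x \<in> F"
      have "?g x = (\<Sum>y\<in>F. if y = x then f x *\<^sub>R ?D x $$ (a, b) else 0)"
        by (intro sum.cong) (auto simp: indicator_def)
      then show "?g x = f x *\<^sub>R ?D x $$ (a, b)" using F x by simp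
    qed
    have meas: "(\<lambda>x. f x *\<^sub>R ?D x $$ (a, b)) \<in> borel_measurable ?\<tau>" by measurable
    have gi: "integrable ?\<tau> ?g" using g by (rule integrable.intros)
    have "integrable ?\<tau> (\<lambda>x. f x *\<^sub>R ?D x $$ (a, b))"
      by (rule integrable_cong_AE_imp[OF gi meas]) (use AE in eventually_elim, simp)
    moreover have "(LINT x|?\<tau>. f x *\<^sub>R ?D x $$ (a, b)) = integral\<^sup>L ?\<tau> ?g"
      by (rule integral_cong_AE[OF meas borel_measurable_integrable[OF gi]]) (use AE in eventually_elim, simp)
    ultimately show ?thesis
      unfolding has_bochner_integral_iff has_bochner_integral_integral_eq[OF g] sum by simp
  qed
  show "psd_integrable q ?\<sigma> f"
    unfolding psd_integrable_def using * by (auto simp: has_bochner_integral_iff)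
  show "psd_integral q ?\<sigma> f $$ (a, b) = (\<Sum>i<N. cnj (C i a) * complex_of_real (f (d i)) * C i b)"
    if ab: "a < q" "b < q"
    using has_bochner_integral_integral_eq[OF *[OF ab]] ab by (simp add: psd_integral_def)
qed

section \<open>Extendable sequences\<close>

text \<open>Integrability is stated for every \<open>k\<close> because the moments of order
  \<open>2 * n + 1\<close> and \<open>2 * n + 2\<close> of the same measure provide the
  extension.\<close>

lemma truncated_moment_problem:
  assumes H: "hblk q s 0 (n + 1) (n + 1) \<in> psd_mats ((n + 1) * q)"
    and s: "\<forall>j\<le>2 * n. s j \<in> carrier_mat q q"
    and sn: "shift_null q s n"
  obtains \<sigma> where "\<sigma> \<in> psd_measures q" "\<And>k. psd_integrable q \<sigma> (\<lambda>x. x ^ k)"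
    "\<And>j. j \<le> 2 * n \<Longrightarrow> psd_integral q \<sigma> (\<lambda>x. x ^ j) = s j"
proof -
  obtain N :: nat and C d where rep: "\<And>j a b. j \<le> 2 * n \<Longrightarrow> a < q \<Longrightarrow> b < q \<Longrightarrow>
    s j $$ (a, b) = (\<Sum>i<N. cnj (C i a) * complex_of_real (d i) ^ j * C i b)"
    by (rule moment_representation[OF H s sn]) (rule that)
  let ?\<sigma> = "atomic_measure q N d C"
  show ?thesis
  proof (rule that)
    show "?\<sigma> \<in> psd_measures q" by (rule atomic_measure_psd_measures)
    show "psd_integrable q ?\<sigma> (\<lambda>x. x ^ k)" for k by (rule atomic_measure_integral) simp
    fix j assume j: "j \<le> 2 * n"
    show "psd_integral q ?\<sigma> (\<lambda>x. x ^ j) = s j"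
    proof (rule eq_matI)
      fix a b assume "a < dim_row (s j)" "b < dim_col (s j)"
      then have "a < q" "b < q" using s j by auto
      then show "psd_integral q ?\<sigma> (\<lambda>x. x ^ j) $$ (a, b) = s j $$ (a, b)"
        using rep[OF j] by (subst atomic_measure_integral(2)) auto
    qed (use s j in \<open>auto simp: psd_integral_def\<close>)
  qed
qed

lemma hankel_nonneg_iff:
  "s \<in> hankel_nonneg q n \<longleftrightarrow>
    s \<in> {..2 * n} \<rightarrow>\<^sub>E carrier_mat q q \<and> hblk q s 0 (n + 1) (n + 1) \<in> psd_mats ((n + 1) * q)"
  by (auto simp: hankel_nonneg_def block_hankel_hblk)

lemma shift_null_cong:
  assumes "\<And>j. j \<le> 2 * n \<Longrightarrow> s j = t j"
  shows "shift_null q s n = shift_null q t n"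
proof -
  have "hblk q s 0 n n = hblk q t 0 n n" "hblk q s 1 (n + 1) n = hblk q t 1 (n + 1) n"
    using assms by (intro hblk_cong; simp)+
  then show ?thesis by (simp add: shift_null_def)
qed

text \<open>Extendability becomes a condition on the sequence itself, which can be compared with the
  kernels of its Schur complements.\<close>

lemma hankel_nonneg_ext_iff:
  "s \<in> hankel_nonneg_ext q n \<longleftrightarrow> s \<in> hankel_nonneg q n \<and> shift_null q s n"
proof
  assume "s \<in> hankel_nonneg_ext q n"
  then obtain A B where s: "s \<in> {..2 * n} \<rightarrow>\<^sub>E carrier_mat q q"
    and AB: "s(2 * n + 1 := A, 2 * n + 2 := B) \<in> hankel_nonneg q (n + 1)" (is "?s \<in> _")
    by (auto simp: hankel_nonneg_ext_def)
  from AB have H: "hblk q ?s 0 ((n + 1) + 1) ((n + 1) + 1) \<in> psd_mats (((n + 1) + 1) * q)"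
    and "?s \<in> {..2 * (n + 1)} \<rightarrow>\<^sub>E carrier_mat q q"
    by (simp_all only: hankel_nonneg_iff)
  from PiE_mem[OF this(2)] have c: "\<forall>j\<le>2 * (n + 1). ?s j \<in> carrier_mat q q" by blast
  have same: "?s j = s j" if "j \<le> 2 * n" for j using that by auto
  have "hblk q ?s 0 (n + 1) (n + 1) = hblk q s 0 (n + 1) (n + 1)"
    using same by (intro hblk_cong) auto
  then have "s \<in> hankel_nonneg q n"
    using hankel_schur(1)[OF H c] s by (simp only: hankel_nonneg_iff)
  moreover have "shift_null q ?s n"
    by (rule shift_null_if_extension) (use H in \<open>simp add: numeral_2_eq_2\<close>)
  then have "shift_null q s n" using shift_null_cong[of n ?s s q, OF same] by simp
  ultimately show "s \<in> hankel_nonneg q n \<and> shift_null q s n" by blast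
next
  assume *: "s \<in> hankel_nonneg q n \<and> shift_null q s n"
  then have s: "s \<in> {..2 * n} \<rightarrow>\<^sub>E carrier_mat q q"
    and H: "hblk q s 0 (n + 1) (n + 1) \<in> psd_mats ((n + 1) * q)" and sn: "shift_null q s n"
    by (simp_all only: hankel_nonneg_iff)
  have c: "\<forall>j\<le>2 * n. s j \<in> carrier_mat q q" using s by auto
  obtain \<sigma> where \<sigma>: "\<sigma> \<in> psd_measures q" "\<And>k. psd_integrable q \<sigma> (\<lambda>x. x ^ k)"
    and mom: "\<And>j. j \<le> 2 * n \<Longrightarrow> psd_integral q \<sigma> (\<lambda>x. x ^ j) = s j"
    by (rule truncated_moment_problem[OF H c sn]) (rule that)
  let ?t = "\<lambda>k. psd_integral q \<sigma> (\<lambda>x. x ^ k)"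
  define A where "A = ?t (2 * n + 1)"
  define B where "B = ?t (2 * n + 2)"
  let ?s = "s(2 * n + 1 := A, 2 * n + 2 := B)"
  have AB: "A \<in> carrier_mat q q" "B \<in> carrier_mat q q" by (simp_all add: A_def B_def psd_integral_def)
  have same: "?t j = ?s j" if j: "j \<le> 2 * n + 2" for j
  proof -
    consider "j \<le> 2 * n" | "j = 2 * n + 1" | "j = 2 * n + 2" using j by linarith
    then show ?thesis using mom[of j] by cases (auto simp: A_def B_def)
  qed
  have "hblk q ?t 0 (n + 1 + 1) (n + 1 + 1) = hblk q ?s 0 (n + 1 + 1) (n + 1 + 1)"
    using same by (intro hblk_cong) auto
  then have "hblk q ?s 0 (n + 1 + 1) (n + 1 + 1) \<in> psd_mats ((n + 1 + 1) * q)"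
    using moment_hankel_psd[OF \<sigma>(1) \<sigma>(2), of "n + 1"] by (simp only:)
  moreover have "?s \<in> {..2 * (n + 1)} \<rightarrow>\<^sub>E carrier_mat q q"
    using s AB by (auto simp: PiE_iff extensional_def)
  ultimately have "?s \<in> hankel_nonneg q (n + 1)" by (simp only: hankel_nonneg_iff)
  then show "s \<in> hankel_nonneg_ext q n"
    using s AB unfolding hankel_nonneg_ext_def by blast
qed

section \<open>The matrix order and column spaces as kernels\<close>

lemma psd_mats_add:
  assumes A: "A \<in> psd_mats n" and B: "B \<in> psd_mats n"
  shows "A + B \<in> psd_mats n"
proof (rule psd_matsI)
  note Ac = psd_matsD[OF A] and Bc = psd_matsD[OF B]
  show "A + B \<in> carrier_mat n n" using Bc by auto
  show "mat_adjoint (A + B) = A + B" using mat_adjoint_plus[OF Ac(1) Bc(1)] Ac Bc by simp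
  fix x :: "complex vec" assume x: "x \<in> carrier_vec n"
  have "((A + B) *\<^sub>v x) \<bullet>c x = (A *\<^sub>v x) \<bullet>c x + (B *\<^sub>v x) \<bullet>c x"
    unfolding add_mult_distrib_mat_vec[OF Ac(1) Bc(1) x]
    by (rule cscalar_prod_add(1)[OF _ _ x]) (use Ac Bc x in auto)
  then show "0 \<le> Re (((A + B) *\<^sub>v x) \<bullet>c x)"
    using Ac(3)[OF x] Bc(3)[OF x] by (simp add: less_eq_complex_def)
qed

lemma psd_mats_antisym:
  assumes A: "A \<in> carrier_mat n n" and B: "B \<in> carrier_mat n n"
    and AB: "A - B \<in> psd_mats n" and BA: "B - A \<in> psd_mats n"
  shows "A = B"
proof (rule mat_eq_if_mult_vec_eq[OF A B])
  fix x :: "complex vec" assume x: "x \<in> carrier_vec n"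
  have Ax: "A *\<^sub>v x \<in> carrier_vec n" and Bx: "B *\<^sub>v x \<in> carrier_vec n" using A B x by auto
  have e: "((A - B) *\<^sub>v x) \<bullet>c x = (A *\<^sub>v x) \<bullet>c x - (B *\<^sub>v x) \<bullet>c x"
    "((B - A) *\<^sub>v x) \<bullet>c x = (B *\<^sub>v x) \<bullet>c x - (A *\<^sub>v x) \<bullet>c x"
    unfolding minus_mult_distrib_mat_vec[OF A B x] minus_mult_distrib_mat_vec[OF B A x]
      cscalar_prod_diff[OF Ax Bx x] cscalar_prod_diff[OF Bx Ax x] by simp_all
  have "((A - B) *\<^sub>v x) \<bullet>c x = 0"
    using psd_matsD(3)[OF AB x] psd_matsD(3)[OF BA x] unfolding e
    by (simp add: less_eq_complex_def complex_eq_iff)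
  from psd_null_vector[OF AB x this] show "A *\<^sub>v x = B *\<^sub>v x"
    unfolding minus_mult_distrib_mat_vec[OF A B x] by (rule minus_zero_vec_eq[OF Ax Bx])
qed

lemma psd_mats_zero: "0\<^sub>m n n \<in> psd_mats n"
  by (rule psd_matsI) (simp_all add: zero_mult_mat_vec)

text \<open>For Hermitian \<open>L\<close>, \<open>Q\<close> is the orthogonal projection onto the
  kernel of \<open>L\<close>, the complement of its column space. Taking adjoints turns
  \<open>Q * B = 0\<close> into \<open>B * Q = 0\<close>, which says that \<open>B\<close> vanishes
  on that kernel. This links the hypotheses of \<open>short_mat_properties\<close> to
  shift-nullity.\<close>

lemma range_annihilator:
  fixes L :: "complex mat"
  assumes L: "L \<in> carrier_mat q q" "mat_adjoint L = L"
  defines "Q \<equiv> 1\<^sub>m q - L * pinv L"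
  shows "Q \<in> carrier_mat q q" "mat_adjoint Q = Q"
    "vec_space.col_space q L = {y \<in> carrier_vec q. Q *\<^sub>v y = 0\<^sub>v q}"
    "\<And>B. B \<in> carrier_mat q q \<Longrightarrow> mat_adjoint B = B \<Longrightarrow>
      Q * B = 0\<^sub>m q q \<longleftrightarrow> (\<forall>x\<in>carrier_vec q. L *\<^sub>v x = 0\<^sub>v q \<longrightarrow> B *\<^sub>v x = 0\<^sub>v q)"
proof -
  note p = hermitian_pinv[OF L]
  have K: "L * pinv L \<in> carrier_mat q q" using L p by auto
  show Q: "Q \<in> carrier_mat q q" unfolding Q_def by (rule minus_carrier_mat[OF K])
  show Qa: "mat_adjoint Q = Q"
    unfolding Q_def mat_adjoint_minus[OF one_carrier_mat K] p(5) mat_adjoint_one ..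
  have Qv: "Q *\<^sub>v x = x - L *\<^sub>v (pinv L *\<^sub>v x)" if x: "x \<in> carrier_vec q" for x
    unfolding Q_def minus_mult_distrib_mat_vec[OF one_carrier_mat K x] assoc_mult_mat_vec[OF L(1) p(1) x]
    using x by simp
  have LXL: "L *\<^sub>v (pinv L *\<^sub>v (L *\<^sub>v x)) = L *\<^sub>v x" if x: "x \<in> carrier_vec q" for x
  proof -
    have Lx: "L *\<^sub>v x \<in> carrier_vec q" using L x by auto
    show ?thesis
      unfolding assoc_mult_mat_vec[OF L(1) p(1) Lx, symmetric] assoc_mult_mat_vec[OF K L(1) x, symmetric] p(2) ..
  qed
  have "vec_space.col_space q L = {y \<in> carrier_vec q. \<exists>x\<in>carrier_vec q. L *\<^sub>v x = y}"
    using vec_space.col_space_eq[OF L(1)] L(1) by simp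
  also have "\<dots> = {y \<in> carrier_vec q. Q *\<^sub>v y = 0\<^sub>v q}"
  proof (intro Collect_cong conj_cong refl iffI)
    fix y :: "complex vec" assume y: "y \<in> carrier_vec q"
    { assume "\<exists>x\<in>carrier_vec q. L *\<^sub>v x = y"
      then obtain x where x: "x \<in> carrier_vec q" and yx: "y = L *\<^sub>v x" by blast
      have "Q *\<^sub>v y = y - y" using Qv[OF y] LXL[OF x] by (simp only: yx)
      then show "Q *\<^sub>v y = 0\<^sub>v q" using minus_cancel_vec[OF y] by simp }
    { assume "Q *\<^sub>v y = 0\<^sub>v q"
      then have 0: "y - L *\<^sub>v (pinv L *\<^sub>v y) = 0\<^sub>v q" unfolding Qv[OF y] .
      have Xy: "pinv L *\<^sub>v y \<in> carrier_vec q" using mult_mat_vec_carrier[OF p(1) y] .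
      have "y = L *\<^sub>v (pinv L *\<^sub>v y)"
        by (rule minus_zero_vec_eq[OF y mult_mat_vec_carrier[OF L(1) Xy] 0])
      then show "\<exists>x\<in>carrier_vec q. L *\<^sub>v x = y" using Xy by metis }
  qed
  finally show "vec_space.col_space q L = {y \<in> carrier_vec q. Q *\<^sub>v y = 0\<^sub>v q}" .
  fix B :: "complex mat" assume B: "B \<in> carrier_mat q q" "mat_adjoint B = B"
  have QB: "Q * B = 0\<^sub>m q q \<longleftrightarrow> B * Q = 0\<^sub>m q q"
    using mat_adjoint_mult[OF Q B(1)] mat_adjoint_mult[OF B(1) Q] mat_adjoint_zero[of q q]
    by (metis B(2) Qa)
  show "Q * B = 0\<^sub>m q q \<longleftrightarrow> (\<forall>x\<in>carrier_vec q. L *\<^sub>v x = 0\<^sub>v q \<longrightarrow> B *\<^sub>v x = 0\<^sub>v q)"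
    unfolding QB
  proof (intro iffI ballI impI)
    fix x :: "complex vec" assume BQ: "B * Q = 0\<^sub>m q q" and x: "x \<in> carrier_vec q" and Lx: "L *\<^sub>v x = 0\<^sub>v q"
    have "L *\<^sub>v (pinv L *\<^sub>v x) = 0\<^sub>v q"
      unfolding assoc_mult_mat_vec[OF L(1) p(1) x, symmetric] p(6)[symmetric] assoc_mult_mat_vec[OF p(1) L(1) x] Lx
      by (rule mult_mat_vec_zero[OF p(1)])
    then have "Q *\<^sub>v x = x" using Qv[OF x] x by simp
    then have "B *\<^sub>v x = (B * Q) *\<^sub>v x" unfolding assoc_mult_mat_vec[OF B(1) Q x] by simp
    then show "B *\<^sub>v x = 0\<^sub>v q" unfolding BQ using zero_mult_mat_vec[OF x] by simp
  next
    assume ker: "\<forall>x\<in>carrier_vec q. L *\<^sub>v x = 0\<^sub>v q \<longrightarrow> B *\<^sub>v x = 0\<^sub>v q"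
    show "B * Q = 0\<^sub>m q q"
    proof (rule mat_eq_if_mult_vec_eq)
      fix x :: "complex vec" assume x: "x \<in> carrier_vec q"
      have Qx: "Q *\<^sub>v x \<in> carrier_vec q" using Q x by auto
      have Lx: "L *\<^sub>v x \<in> carrier_vec q" using L x by auto
      have Kx: "L *\<^sub>v (pinv L *\<^sub>v x) \<in> carrier_vec q"
        using mult_mat_vec_carrier[OF L(1) mult_mat_vec_carrier[OF p(1) x]] .
      have "L *\<^sub>v (pinv L *\<^sub>v x) = pinv L *\<^sub>v (L *\<^sub>v x)"
        unfolding assoc_mult_mat_vec[OF L(1) p(1) x, symmetric] p(6)[symmetric] assoc_mult_mat_vec[OF p(1) L(1) x] ..
      then have "L *\<^sub>v (L *\<^sub>v (pinv L *\<^sub>v x)) = L *\<^sub>v x" using LXL[OF x] by simp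
      then have "L *\<^sub>v (Q *\<^sub>v x) = L *\<^sub>v x - L *\<^sub>v x"
        unfolding Qv[OF x] mult_minus_distrib_mat_vec[OF L(1) x Kx] by simp
      then have "L *\<^sub>v (Q *\<^sub>v x) = 0\<^sub>v q" using minus_cancel_vec[OF Lx] by simp
      then show "(B * Q) *\<^sub>v x = 0\<^sub>m q q *\<^sub>v x"
        unfolding assoc_mult_mat_vec[OF B(1) Q x] using ker Qx zero_mult_mat_vec[OF x] by auto
    qed (use B Q in auto)
  qed
qed

section \<open>Replacing the last entry by \<open>Xi\<close>\<close>

lemma moment_solutionsD:
  assumes "\<sigma> \<in> moment_solutions q n s"
  shows "\<sigma> \<in> psd_measures q" "psd_integrable q \<sigma> (\<lambda>x. x ^ (2 * n))"
    "s (2 * n) - psd_integral q \<sigma> (\<lambda>x. x ^ (2 * n)) \<in> psd_mats q"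
    "\<And>j. j < 2 * n \<Longrightarrow> psd_integral q \<sigma> (\<lambda>x. x ^ j) = s j"
  using assms by (auto simp: moment_solutions_def)

text \<open>The index is \<open>n + 1\<close> so that a preceding Schur complement exists. A
  solution for \<open>t\<close> is one for \<open>s\<close> merely because \<open>S\<close> is below
  \<open>L\<close>; the converse is the maximality of \<open>S\<close>.\<close>

lemma Xi_Suc_properties:
  assumes s: "s \<in> hankel_nonneg q (n + 1)"
  defines "t \<equiv> s(2 * (n + 1) := Xi q s (n + 1))"
  shows "t \<in> hankel_nonneg_ext q (n + 1)" "moment_solutions q (n + 1) t = moment_solutions q (n + 1) s"
proof -
  let ?m = "n + 1"
  have sc: "s \<in> {..2 * ?m} \<rightarrow>\<^sub>E carrier_mat q q"
    and H: "hblk q s 0 (?m + 1) (?m + 1) \<in> psd_mats ((?m + 1) * q)"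
    using s by (simp_all only: hankel_nonneg_iff)
  have c: "\<forall>j\<le>2 * ?m. s j \<in> carrier_mat q q" and c': "\<forall>j\<le>2 * n. s j \<in> carrier_mat q q" using sc by auto
  note h = hankel_schur[OF H c]
  note h' = hankel_schur[OF h(1) c']
  define L where "L = Lmat q s ?m"
  define L' where "L' = Lmat q s n"
  define V where "V = vec_space.col_space q L'"
  have Lp: "L \<in> psd_mats q" using h(3) by (simp only: L_def)
  have L': "L' \<in> carrier_mat q q" "mat_adjoint L' = L'"
    using psd_matsD[OF h'(3)] by (simp_all only: L'_def)
  define Q where "Q = 1\<^sub>m q - L' * pinv L'"
  note r = range_annihilator[OF L', folded Q_def, folded V_def]
  define S where "S = short_mat q L V"
  note sh = short_mat_properties[OF Lp r(1-3), folded S_def]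
  note Sc = psd_matsD(1,2)[OF sh(1)] and Lc = psd_matsD(1,2)[OF Lp]
  have Xi: "Xi q s ?m = Theta q s ?m + S" by (simp add: Xi_def S_def L_def V_def L'_def)
  have t: "t = s(2 * ?m := Theta q s ?m + S)" by (simp only: t_def Xi)
  note rl = hankel_replace_last[OF H c sh(1), folded t]
  have tc: "t \<in> {..2 * ?m} \<rightarrow>\<^sub>E carrier_mat q q"
    using sc h(5) Sc unfolding t by (auto simp: PiE_iff extensional_def)
  have tc': "\<forall>j\<le>2 * ?m. t j \<in> carrier_mat q q" using tc by auto
  \<comment> \<open>The preceding complement involves indices up to \<open>2 * n\<close> only, so it
    is the same for \<open>s\<close>, for \<open>t\<close> and for the moments of any
    solution.\<close>
  have Lm: "Lmat q u n = L'" if "\<And>j. j < 2 * ?m \<Longrightarrow> u j = s j" for u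
  proof -
    have "Theta q u n = Theta q s n" using that by (intro Theta_cong) auto
    moreover have "u (2 * n) = s (2 * n)" using that by auto
    ultimately show ?thesis by (simp add: Lmat_def L'_def)
  qed
  have e2: "n + 2 = ?m + 1" by simp
  have Ht: "hblk q t 0 (n + 2) (n + 2) \<in> psd_mats ((n + 2) * q)" unfolding e2 by (rule rl(1))
  have "Lmat q t n = L'" by (rule Lm) (simp add: t)
  then have "shift_null q t ?m"
    unfolding shift_null_iff_Lmat_kernel[OF Ht tc'] rl(2) using r(4)[OF Sc] sh(3) by simp
  then show ext: "t \<in> hankel_nonneg_ext q ?m"
    unfolding hankel_nonneg_ext_iff hankel_nonneg_iff using tc rl(1) by simp
  have sL: "s (2 * ?m) = Theta q s ?m + L"
    unfolding L_def Lmat_def using c h(5) by (intro eq_matI) auto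
  have s2c: "s (2 * ?m) \<in> carrier_mat q q" using c by simp
  have t2c: "t (2 * ?m) \<in> carrier_mat q q" using tc' by simp
  have t2: "t (2 * ?m) = Theta q s ?m + S" by (simp add: t)
  have same: "t j = s j" if "j < 2 * ?m" for j using that by (simp add: t)
  show "moment_solutions q ?m t = moment_solutions q ?m s"
  proof (intro subset_antisym subsetI)
    fix \<sigma> assume \<sigma>: "\<sigma> \<in> moment_solutions q ?m t"
    note d = moment_solutionsD[OF \<sigma>]
    let ?I = "psd_integral q \<sigma> (\<lambda>x. x ^ (2 * ?m))"
    have Ic: "?I \<in> carrier_mat q q" by (simp add: psd_integral_def)
    have "s (2 * ?m) - ?I = (L - S) + (t (2 * ?m) - ?I)"
      unfolding sL t2 using h(5) Sc Lc Ic by (intro eq_matI) auto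
    then have "s (2 * ?m) - ?I \<in> psd_mats q" using psd_mats_add[OF sh(2) d(3)] by (simp only:)
    then show "\<sigma> \<in> moment_solutions q ?m s"
      unfolding moment_solutions_def using d(1,2,4) same by simp
  next
    fix \<sigma> assume \<sigma>: "\<sigma> \<in> moment_solutions q ?m s"
    note d = moment_solutionsD[OF \<sigma>]
    let ?I = "\<lambda>k. psd_integral q \<sigma> (\<lambda>x. x ^ k)"
    have Ic: "?I k \<in> carrier_mat q q" for k by (simp add: psd_integral_def)
    have HI: "hblk q ?I 0 (n + 2) (n + 2) \<in> psd_mats ((n + 2) * q)"
      unfolding e2 by (rule moment_hankel_psd[OF d(1,2)])
    have HI': "hblk q ?I 0 (?m + 1) (?m + 1) \<in> psd_mats ((?m + 1) * q)"
      by (rule moment_hankel_psd[OF d(1,2)])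
    have Ic': "\<forall>j\<le>2 * ?m. ?I j \<in> carrier_mat q q" using Ic by simp
    \<comment> \<open>\<open>Theta\<close> is common to \<open>s\<close>, \<open>t\<close> and the
      moments of the solution. Subtracting it from their last entries leaves \<open>L\<close>,
      \<open>S\<close> and \<open>B\<close>, so the comparison with \<open>t\<close> is the
      comparison of \<open>S\<close> with the competitor \<open>B\<close>.\<close>
    define B where "B = Lmat q ?I ?m"
    have Bp: "B \<in> psd_mats q" unfolding B_def by (rule hankel_schur(3)[OF HI' Ic'])
    note Bc = psd_matsD(1,2)[OF Bp]
    have "Theta q ?I ?m = Theta q s ?m" using d(4) by (intro Theta_cong) auto
    then have BI: "B = ?I (2 * ?m) - Theta q s ?m" by (simp only: B_def Lmat_def)
    have "Lmat q ?I n = L'" using d(4) by (rule Lm)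
    then have "\<forall>x\<in>carrier_vec q. L' *\<^sub>v x = 0\<^sub>v q \<longrightarrow> B *\<^sub>v x = 0\<^sub>v q"
      using moment_shift_null[OF d(1,2)]
      unfolding shift_null_iff_Lmat_kernel[OF HI Ic'] B_def by simp
    then have "Q * B = 0\<^sub>m q q" by (simp only: r(4)[OF Bc])
    moreover have "L - B = s (2 * ?m) - ?I (2 * ?m)"
      unfolding L_def Lmat_def BI using s2c Ic[of "2 * ?m"] h(5) by (intro eq_matI) auto
    then have "L - B \<in> psd_mats q" using d(3) by (simp only:)
    ultimately have "S - B \<in> psd_mats q" using sh(4)[OF Bp] by blast
    moreover have "t (2 * ?m) - ?I (2 * ?m) = S - B"
      unfolding t2 BI using Sc Ic[of "2 * ?m"] h(5) by (intro eq_matI) auto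
    ultimately have "t (2 * ?m) - ?I (2 * ?m) \<in> psd_mats q" by (simp only:)
    then show "\<sigma> \<in> moment_solutions q ?m t"
      unfolding moment_solutions_def using d(1,2,4) same by simp
  qed
qed

lemma Xi_properties:
  assumes s: "s \<in> hankel_nonneg q n"
  shows "s(2 * n := Xi q s n) \<in> hankel_nonneg_ext q n"
    "moment_solutions q n (s(2 * n := Xi q s n)) = moment_solutions q n s"
proof -
  have "s(2 * n := Xi q s n) \<in> hankel_nonneg_ext q n \<and>
    moment_solutions q n (s(2 * n := Xi q s n)) = moment_solutions q n s"
  proof (cases n)
    case 0
    have e: "s(2 * n := Xi q s n) = s" by (simp add: 0 Xi_def)
    \<comment> \<open>For \<open>n = 0\<close> the shifted window has no columns and its product
      with any vector is zero.\<close>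
    have "shift_null q s 0"
      unfolding shift_null_def by (auto simp: scalar_prod_def intro!: eq_vecI)
    then show ?thesis unfolding e hankel_nonneg_ext_iff using s 0 by simp
  next
    case (Suc m)
    then show ?thesis using Xi_Suc_properties[of s q m] s by simp
  qed
  then show "s(2 * n := Xi q s n) \<in> hankel_nonneg_ext q n"
    "moment_solutions q n (s(2 * n := Xi q s n)) = moment_solutions q n s" by blast+
qed

text \<open>A measure that represents \<open>s\<close> exactly solves the problem for
  \<open>s\<close> with defect zero; as a solution for \<open>t\<close> it compares the last
  entries. Only one inclusion is assumed, so equivalence yields both inequalities.\<close>

lemma moment_solutions_le:
  assumes s: "s \<in> hankel_nonneg_ext q n" and sub: "moment_solutions q n s \<subseteq> moment_solutions q n t"
  shows "t (2 * n) - s (2 * n) \<in> psd_mats q" "\<And>j. j < 2 * n \<Longrightarrow> s j = t j"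
proof -
  have sc: "s \<in> {..2 * n} \<rightarrow>\<^sub>E carrier_mat q q"
    and H: "hblk q s 0 (n + 1) (n + 1) \<in> psd_mats ((n + 1) * q)" and sn: "shift_null q s n"
    using s by (simp_all only: hankel_nonneg_ext_iff hankel_nonneg_iff)
  have c: "\<forall>j\<le>2 * n. s j \<in> carrier_mat q q" using sc by auto
  obtain \<sigma> where \<sigma>: "\<sigma> \<in> psd_measures q" "\<And>k. psd_integrable q \<sigma> (\<lambda>x. x ^ k)"
    and mom: "\<And>j. j \<le> 2 * n \<Longrightarrow> psd_integral q \<sigma> (\<lambda>x. x ^ j) = s j"
    by (rule truncated_moment_problem[OF H c sn]) (rule that)
  have "s (2 * n) - s (2 * n) = 0\<^sub>m q q" using c by auto
  then have "\<sigma> \<in> moment_solutions q n s"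
    unfolding moment_solutions_def using \<sigma> mom psd_mats_zero by simp
  then have "\<sigma> \<in> moment_solutions q n t" using sub by blast
  note d = moment_solutionsD[OF this]
  show "t (2 * n) - s (2 * n) \<in> psd_mats q" using d(3) mom by simp
  show "s j = t j" if "j < 2 * n" for j using d(4)[OF that] mom[of j] that by simp
qed

theorem theorem4p6:
  fixes q n :: nat and s :: "nat \<Rightarrow> complex mat"
  assumes "q > 0" and "s \<in> hankel_nonneg q n"
  shows "moment_class q n s \<inter> hankel_nonneg_ext q n = {s(2 * n := Xi q s n)}"
proof -
  let ?s = "s(2 * n := Xi q s n)"
  note X = Xi_properties[OF assms(2)]
  have "?s \<in> hankel_nonneg q n" using X(1) by (simp only: hankel_nonneg_ext_iff)
  then have "?s \<in> moment_class q n s" using X(2) by (simp add: moment_class_def moment_equiv_def)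
  moreover have "t = ?s" if t: "t \<in> moment_class q n s" "t \<in> hankel_nonneg_ext q n" for t
  proof -
    have eq: "moment_solutions q n t = moment_solutions q n ?s"
      using t(1) X(2) by (simp add: moment_class_def moment_equiv_def)
    note 1 = moment_solutions_le[OF t(2), of ?s] and 2 = moment_solutions_le[OF X(1), of t]
    have c: "t \<in> {..2 * n} \<rightarrow>\<^sub>E carrier_mat q q" "?s \<in> {..2 * n} \<rightarrow>\<^sub>E carrier_mat q q"
      using t(2) X(1) by (simp_all only: hankel_nonneg_ext_iff hankel_nonneg_iff)
    have tc: "t (2 * n) \<in> carrier_mat q q" and sc: "?s (2 * n) \<in> carrier_mat q q"
      using PiE_mem[OF c(1), of "2 * n"] PiE_mem[OF c(2), of "2 * n"] by simp_all
    have last: "t (2 * n) = ?s (2 * n)"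
      by (rule psd_mats_antisym[OF tc sc 2(1) 1(1)]) (simp_all only: eq order_refl)
    show ?thesis
    proof (rule PiE_ext[OF c])
      fix j assume "j \<in> {..2 * n}"
      then consider "j < 2 * n" | "j = 2 * n" by fastforce
      then show "t j = ?s j"
      proof cases
        case 1
        show ?thesis by (rule moment_solutions_le(2)[OF t(2) _ 1]) (simp only: eq order_refl)
      qed (simp only: last)
    qed
  qed
  ultimately show ?thesis using X(1) by blast
qed

end
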